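(* Let $\mathcal{D} \subset \mathbb{R}^2$ be a nontrivial (balanced) quadriculated disk. For each $N$, let $\mathbf{T}_N$ be a random tiling of $\mathcal{R}_N = \mathcal{D} \times [0,N]$. Then there exist constants $C_0, C_1 \in (0,+\infty)$ with the following property: if $(t_N)$ is a sequence of integers with $\lim_{N \to \infty} t_N/\sqrt{N} = \tau \in \mathbb{R}$, then $$\lim_{N \to \infty} \sqrt{N}\,\operatorname{Prob}[\operatorname{Tw}(\mathbf{T}_N) = t_N] = C_0 \exp(-C_1 \tau^2).$$
   Context: Quadriculated disk: a set $\mathcal{D}\subset\mathbb{R}^2$ which is the union of finitely many closed unit squares with vertices in $\mathbb{Z}^2$ and is homeomorphic to the closed unit disk. Unit squares carry a checkerboard coloring and $\mathcal{D}$ is always assumed balanced (equal numbers of white and black squares). $\mathcal{D}$ is nontrivial if it has at least $6$ unit squares and at least one of its squares has at least three neighbours (squares of $\mathcal{D}$ sharing an edge with it). Tilings: $\mathcal{R}_N=\mathcal{D}\times[0,N]\subset\mathbb{R}^3$ ($N$ a positive integer) is a union of closed unit cubes with vertices in $\mathbb{Z}^3$. A domino is the union of two unit cubes sharing a face; a tiling of $\mathcal{R}_N$ is a set of dominoes with disjoint interiors whose union is $\mathcal{R}_N$. $\mathcal{T}(\mathcal{R}_N)$ is the (finite) set of tilings. A random tiling is uniformly distributed in $\mathcal{T}(\mathcal{R}_N)$ (which is nonempty for all sufficiently large $N$). Twist: color unit cubes black and white in a checkerboard pattern. For a domino $d$, let $v(d)\in\{\pm e_1,\pm e_2,\pm e_3\}$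 be the center of its black cube minus the center of its white cube. Fix $u\in\{\pm e_1,\pm e_2\}$. The (open) $u$-shade of a domino $d$ is $S^u(d)=\operatorname{int}\big((\bigcup_{s\ge 0}(d+su))\smallsetminus d\big)$. For dominoes $d_0,d_1$ set $\tau^u(d_0,d_1)=\frac14\det(v(d_1),v(d_0),u)$ if $d_1\cap S^u(d_0)\neq\emptyset$ and $\tau^u(d_0,d_1)=0$ otherwise. For $\mathbf{t}\in\mathcal{T}(\mathcal{R}_N)$, $\operatorname{Tw}(\mathbf{t})=\sum_{d_0,d_1\in\mathbf{t}}\tau^u(d_0,d_1)$; this is an integer and does not depend on the choice of $u$. *)

theory Defs
  imports "HOL-Probability.Probability"
begin

text \<open>Closed unit squares (in dimension 2) and closed unit cubes (in dimension 3) with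
  integer vertices are indexed by their smallest vertex.\<close>

definition lattice_cube :: "int ^ 'n \<Rightarrow> (real ^ 'n) set" where
  "lattice_cube c = cbox (\<chi> i. real_of_int (c $ i)) (\<chi> i. real_of_int (c $ i) + 1)"

definition cube_center :: "int ^ 'n \<Rightarrow> real ^ 'n" where
  "cube_center c = (\<chi> i. real_of_int (c $ i) + 1 / 2)"

text \<open>Sharing an edge in dimension 2, sharing a face in dimension 3.\<close>

definition adjacent :: "int ^ 'n \<Rightarrow> int ^ 'n \<Rightarrow> bool" where
  "adjacent a b \<longleftrightarrow> (\<exists>i. a - b = axis i 1 \<or> b - a = axis i 1)"

text \<open>Exchanging the two colors changes neither the notion of being balanced nor the twist.\<close>

definition black :: "int ^ 'n \<Rightarrow> bool" where
  "black c \<longleftrightarrow> even (\<Sum>i\<in>UNIV. c $ i)"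

definition quadriculated_disk :: "(real ^ 2) set \<Rightarrow> bool" where
  "quadriculated_disk D \<longleftrightarrow>
     (\<exists>S. finite S \<and> D = (\<Union>c\<in>S. lattice_cube c)) \<and>
     D homeomorphic (cball 0 1 :: (real ^ 2) set)"

definition squares :: "(real ^ 2) set \<Rightarrow> (int ^ 2) set" where
  "squares D = {c. lattice_cube c \<subseteq> D}"

definition balanced :: "(real ^ 2) set \<Rightarrow> bool" where
  "balanced D \<longleftrightarrow> card {c \<in> squares D. black c} = card {c \<in> squares D. \<not> black c}"

definition nontrivial :: "(real ^ 2) set \<Rightarrow> bool" where
  "nontrivial D \<longleftrightarrow> card (squares D) \<ge> 6 \<and>
     (\<exists>c\<in>squares D. card {c' \<in> squares D. adjacent c c'} \<ge> 3)"

definition cylinder :: "(real ^ 2) set \<Rightarrow> nat \<Rightarrow> (real ^ 3) set" where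
  "cylinder D N = {x. vector [x $ 1, x $ 2] \<in> D \<and> 0 \<le> x $ 3 \<and> x $ 3 \<le> real N}"

definition domino :: "(real ^ 3) set \<Rightarrow> bool" where
  "domino d \<longleftrightarrow> (\<exists>a b. adjacent a b \<and> d = lattice_cube a \<union> lattice_cube b)"

definition tilings :: "(real ^ 3) set \<Rightarrow> (real ^ 3) set set set" where
  "tilings R = {t. (\<forall>d\<in>t. domino d) \<and>
     pairwise (\<lambda>d d'. interior d \<inter> interior d' = {}) t \<and> \<Union>t = R}"

definition black_cube :: "(real ^ 3) set \<Rightarrow> int ^ 3" where
  "black_cube d = (THE c. lattice_cube c \<subseteq> d \<and> black c)"

definition white_cube :: "(real ^ 3) set \<Rightarrow> int ^ 3" where
  "white_cube d = (THE c. lattice_cube c \<subseteq> d \<and> \<not> black c)"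

definition domino_vec :: "(real ^ 3) set \<Rightarrow> real ^ 3" where
  "domino_vec d = cube_center (black_cube d) - cube_center (white_cube d)"

definition shade :: "real ^ 3 \<Rightarrow> (real ^ 3) set \<Rightarrow> (real ^ 3) set" where
  "shade u d = interior ((\<Union>s\<in>{0..}. (\<lambda>x. x + s *\<^sub>R u) ` d) - d)"

definition tau :: "real ^ 3 \<Rightarrow> (real ^ 3) set \<Rightarrow> (real ^ 3) set \<Rightarrow> real" where
  "tau u d0 d1 =
     (if d1 \<inter> shade u d0 \<noteq> {}
      then 1 / 4 * det (vector [domino_vec d1, domino_vec d0, u] :: real ^ 3 ^ 3)
      else 0)"

definition twist :: "real ^ 3 \<Rightarrow> (real ^ 3) set set \<Rightarrow> real" where
  "twist u t = (\<Sum>d0\<in>t. \<Sum>d1\<in>t. tau u d0 d1)"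

text \<open>The uniform distribution on tilings; it is meaningful only if a tiling exists, which
  for a balanced quadriculated disk is the case for all sufficiently large \<open>N\<close>.\<close>

definition random_tiling :: "(real ^ 2) set \<Rightarrow> nat \<Rightarrow> (real ^ 3) set set pmf" where
  "random_tiling D N = pmf_of_set (tilings (cylinder D N))"

end

theory Submission imports Defs "HOL-Real_Asymp.Real_Asymp" begin

text \<open>Cut a tiling of the cylinder into its \<open>N\<close> floors. A floor joins the set of squares whose
  dominoes stick out downwards to the set of those sticking out upwards; such sets are called plugs,
  and tilings are closed walks of length \<open>N\<close> in a finite graph on the plugs. The twist, computed
  with a horizontal shade, is the sum of weights of the floors. Turning a floor upside down negates
  its weight, so the drift vanishes. The
  Perron eigenvector turns counting walks into a Markov chain; two Poisson equations give the
  leading eigenvalue of the kernel twisted by a character to second order, hence a Gaussian limit of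
  the characteristic functions, and Fourier inversion turns it into a local limit theorem.

  That the twist has span exactly one follows from two facts. The weight of a floor is, modulo
  integers, the difference of a potential. Plugs evolve like tokens in an exclusion process on the
  connected board, which makes the graph primitive, and exchanging two tokens around a square with
  three neighbours yields closed walks of equal length whose weights differ by one.\<close>

text \<open>Seen along \<open>u\<close>, an upright domino and one lying across the rows share at
  most one unit square. So each term of the twist can be charged to two cubes on one line parallel
  to \<open>u\<close>, and these lie on the same floor; this is why the twist is additive over
  floors. A single floor, however, contributes only a multiple of 1/4. Fourier inversion over angles
  up to pi needs integral values on closed walks, while damping at all nonzero angles up to pi needs
  walks of equal length whose weights differ by exactly one: a difference of 2, say, would leave the
  angle pi undamped. Hence the congruence is proved modulo 4, with a potential that is quadratic
  because dominoes interact in pairs within a row. Tilings are walks with both ends fixed at the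
  empty plug, whereas an approximate eigenvector controls sums over free ends. A bounded number of
  final steps, over which the chain mixes, bridges the two. Positivity of the variance is read off
  from the damping bound, which the Gaussian limit cannot exceed.\<close>

section \<open>Nonnegative kernels on finite sets\<close>

text \<open>A nonzero linear term wins against a quadratic one near 0. This serves as the
  first-order condition at a maximum; the added 1 in the test value \<open>d / ?k\<close> keeps the
  denominator positive.\<close>

lemma linear_le_quadratic_imp_zero:
  fixes c d :: real
  assumes "\<And>t. 2 * t * d \<le> t\<^sup>2 * c"
  shows "d = 0"
proof (rule ccontr)
  assume "d \<noteq> 0"
  let ?k = "\<bar>c\<bar> + 1"
  have k: "?k > 0" by simp
  have "2 * (d / ?k) * d \<le> (d / ?k)\<^sup>2 * c" by (rule assms)
  also have "\<dots> \<le> (d / ?k)\<^sup>2 * ?k" by (intro mult_left_mono) auto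
  also have "\<dots> = d * d / ?k" using k by (simp add: power2_eq_square)
  finally have "2 * (d * d / ?k) \<le> d * d / ?k" by simp
  moreover have "d * d / ?k > 0" using \<open>d \<noteq> 0\<close> k by (intro divide_pos_pos) (auto simp: zero_less_mult_iff linorder_neq_iff)
  ultimately show False by linarith
qed

text \<open>A maximiser of the Rayleigh quotient over the nonnegative part of the unit sphere is a
  global maximiser, because replacing entries by absolute values does not decrease the quotient.\<close>

lemma perron_symmetric:
  fixes A :: "'p \<Rightarrow> 'p \<Rightarrow> real"
  assumes fin: "finite S" and ne: "S \<noteq> {}"
    and nonneg: "\<And>p q. p \<in> S \<Longrightarrow> q \<in> S \<Longrightarrow> A p q \<ge> 0"
    and sym: "\<And>p q. p \<in> S \<Longrightarrow> q \<in> S \<Longrightarrow> A p q = A q p"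
  obtains \<rho> :: real and v :: "'p \<Rightarrow> real"
    where "\<And>p. p \<in> S \<Longrightarrow> v p \<ge> 0" "\<exists>p\<in>S. v p > 0"
      "\<And>p. p \<in> S \<Longrightarrow> (\<Sum>q\<in>S. A p q * v q) = \<rho> * v p"
proof -
  define n where "n x = (\<Sum>p\<in>S. (x p)\<^sup>2)" for x :: "'p \<Rightarrow> real"
  define B where "B x y = (\<Sum>p\<in>S. \<Sum>q\<in>S. A p q * x p * y q)" for x y :: "'p \<Rightarrow> real"
  \<comment> \<open>Functions are forced to vanish outside \<open>S\<close>, so that compactness of
    \<open>P\<close> is Tychonoff's theorem for the whole function type.\<close>
  define P where "P = PiE UNIV (\<lambda>p. if p \<in> S then {0..1::real} else {0})"
  define K where "K = P \<inter> {x. n x = 1}"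
  have "compactin (product_topology (\<lambda>i. euclidean) UNIV) P"
    unfolding P_def by (subst compactin_PiE) auto
  then have "compact P" by (simp add: euclidean_product_topology)
  moreover have "continuous_on UNIV n"
    unfolding n_def by (intro continuous_intros continuous_on_product_coordinates)
  then have "closed {x. n x = 1}"
    by (intro closed_Collect_eq) auto
  ultimately have "compact K" unfolding K_def by (rule compact_Int_closed)
  obtain p0 where p0: "p0 \<in> S" using ne by auto
  have "(\<lambda>p. if p = p0 then 1 else 0) \<in> K"
    using p0 fin by (auto simp: K_def P_def n_def if_distrib[of "\<lambda>x. x^2"] cong: if_cong)
  then have "K \<noteq> {}" by auto
  have "continuous_on K (\<lambda>x. B x x)"
    unfolding B_def
    by (intro continuous_intros continuous_on_subset[OF continuous_on_product_coordinates]) auto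
  then obtain v where v: "v \<in> K" "\<And>y. y \<in> K \<Longrightarrow> B y y \<le> B v v"
    using continuous_attains_sup[OF \<open>compact K\<close> \<open>K \<noteq> {}\<close>] by blast
  define \<rho> where "\<rho> = B v v"
  have nv: "n v = 1" using v(1) by (simp add: K_def)
  have v0: "v p \<ge> 0" if "p \<in> S" for p
  proof -
    have "v p \<in> (if p \<in> S then {0..1} else {0})"
      using v(1) unfolding K_def P_def by (blast dest: PiE_mem)
    then show ?thesis using that by simp
  qed
  \<comment> \<open>The bound is needed for vectors of any sign, because the variation of
    \<open>v\<close> carried out below may leave the nonnegative cone.\<close>
  have main: "B z z \<le> \<rho> * n z" for z
  proof (cases "n z = 0")
    case True
    then have "\<forall>p\<in>S. z p = 0" unfolding n_def using fin by (subst (asm) sum_nonneg_eq_0_iff) auto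
    then show ?thesis using True by (simp add: B_def)
  next
    case False
    then have nz: "n z > 0" unfolding n_def by (simp add: order_less_le sum_nonneg)
    define y where "y p = (if p \<in> S then \<bar>z p\<bar> / sqrt (n z) else 0)" for p
    have "\<bar>z p\<bar> \<le> sqrt (n z)" if "p \<in> S" for p
    proof -
      have "(z p)\<^sup>2 \<le> n z" unfolding n_def using fin that
        by (intro member_le_sum) auto
      then show ?thesis using real_le_rsqrt real_sqrt_le_mono by fastforce
    qed
    moreover have "n y = 1"
    proof -
      have "n y = (\<Sum>p\<in>S. (z p)\<^sup>2 / n z)" unfolding n_def[of y]
        using nz by (intro sum.cong) (auto simp: y_def power_divide)
      then show ?thesis using nz by (simp add: n_def sum_divide_distrib[symmetric])
    qed
    ultimately have "y \<in> K" using nz by (auto simp: K_def P_def y_def)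
    then have "B y y \<le> \<rho>" using v(2) \<rho>_def by simp
    have "B z z \<le> (\<Sum>p\<in>S. \<Sum>q\<in>S. A p q * \<bar>z p\<bar> * \<bar>z q\<bar>)"
      unfolding B_def
    proof (intro sum_mono)
      fix p q assume pq: "p \<in> S" "q \<in> S"
      have "z p * z q \<le> \<bar>z p\<bar> * \<bar>z q\<bar>" by (metis abs_ge_self abs_mult)
      then show "A p q * z p * z q \<le> A p q * \<bar>z p\<bar> * \<bar>z q\<bar>"
        using nonneg[OF pq] by (simp add: mult.assoc mult_left_mono)
    qed
    also have "\<dots> = n z * B y y"
      unfolding B_def sum_distrib_left using nz
      by (intro sum.cong refl) (simp add: y_def)
    also have "\<dots> \<le> n z * \<rho>" using \<open>B y y \<le> \<rho>\<close> nz by simp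
    finally show ?thesis by (simp add: mult.commute)
  qed
  have eig: "(\<Sum>q\<in>S. A p q * v q) = \<rho> * v p" if p: "p \<in> S" for p
  proof -
    define e where "e q = (if q = p then 1 else 0 :: real)" for q
    define d where "d = (\<Sum>q\<in>S. A p q * v q) - \<rho> * v p"
    have Bve: "B v e = (\<Sum>q\<in>S. A p q * v q)" "B e v = (\<Sum>q\<in>S. A p q * v q)"
    proof -
      have "B v e = (\<Sum>q\<in>S. A q p * v q)" unfolding B_def e_def
        using fin p by (intro sum.cong refl) (simp add: if_distrib[of "(*) _"] cong: if_cong)
      then show "B v e = (\<Sum>q\<in>S. A p q * v q)" using sym p by (simp cong: sum.cong)
      have "B e v = (\<Sum>q\<in>S. if q = p then \<Sum>r\<in>S. A q r * v r else 0)" unfolding B_def e_def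
        by (intro sum.cong refl) auto
      then show "B e v = (\<Sum>q\<in>S. A p q * v q)" using fin p by simp
    qed
    \<comment> \<open>First variation in the direction of the basis vector \<open>e\<close>;
      symmetry of \<open>A\<close> merges the two mixed terms.\<close>
    have "2 * t * d \<le> t\<^sup>2 * (\<rho> - B e e)" for t
    proof -
      have "B (\<lambda>q. v q + t * e q) (\<lambda>q. v q + t * e q) = B v v + t * B v e + t * B e v + t\<^sup>2 * B e e"
        unfolding B_def by (simp add: sum.distrib sum_distrib_left algebra_simps power2_eq_square)
      moreover have "n (\<lambda>q. v q + t * e q) = 1 + 2 * t * v p + t\<^sup>2"
      proof -
        have "n (\<lambda>q. v q + t * e q) = n v + (\<Sum>q\<in>S. if q = p then 2 * t * v q + t\<^sup>2 else 0)"
          unfolding n_def sum.distrib[symmetric] e_def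
          by (intro sum.cong refl) (auto simp: power2_sum algebra_simps)
        then show ?thesis using nv fin p by simp
      qed
      ultimately show ?thesis
        using main[of "\<lambda>q. v q + t * e q"] by (simp add: Bve d_def algebra_simps \<rho>_def)
    qed
    from linear_le_quadratic_imp_zero[OF this] show ?thesis by (simp add: d_def)
  qed
  have "\<exists>p\<in>S. v p > 0"
  proof (rule ccontr)
    assume "\<not> ?thesis"
    then have "\<forall>p\<in>S. v p = 0" using v0 by force
    then have "n v = 0" by (simp add: n_def)
    then show False using nv by simp
  qed
  with v0 eig that show thesis by blast
qed

section \<open>Powers of kernels and Doeblin contraction\<close>

primrec kpow :: "'p set \<Rightarrow> ('p \<Rightarrow> 'p \<Rightarrow> 'a::comm_semiring_1) \<Rightarrow> nat \<Rightarrow> 'p \<Rightarrow> 'p \<Rightarrow> 'a" where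
  "kpow S M 0 = (\<lambda>p q. if p = q then 1 else 0)"
| "kpow S M (Suc n) = (\<lambda>p q. \<Sum>r\<in>S. M p r * kpow S M n r q)"

lemma kpow_add:
  assumes "finite S" "p \<in> S"
  shows "kpow S M (m + n) p q = (\<Sum>r\<in>S. kpow S M m p r * kpow S M n r q)"
  using assms(2)
proof (induction m arbitrary: p)
  case 0
  have "(\<Sum>r\<in>S. kpow S M 0 p r * kpow S M n r q) = (\<Sum>r\<in>S. if r = p then kpow S M n r q else 0)"
    by (intro sum.cong) auto
  then show ?case using 0 assms(1) by simp
next
  case (Suc m)
  have "kpow S M (Suc m + n) p q = (\<Sum>r\<in>S. \<Sum>s\<in>S. M p r * (kpow S M m r s * kpow S M n s q))"
    by (simp add: Suc.IH sum_distrib_left)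
  also have "\<dots> = (\<Sum>s\<in>S. \<Sum>r\<in>S. M p r * (kpow S M m r s * kpow S M n s q))"
    by (rule sum.swap)
  finally show ?case by (simp add: sum_distrib_right mult.assoc)
qed

lemma kpow_nonneg:
  fixes M :: "'p \<Rightarrow> 'p \<Rightarrow> real"
  assumes "\<And>p q. p \<in> S \<Longrightarrow> q \<in> S \<Longrightarrow> M p q \<ge> 0" "p \<in> S" "q \<in> S"
  shows "kpow S M n p q \<ge> 0"
  using assms(2) by (induction n arbitrary: p) (auto intro!: sum_nonneg simp: assms)

lemma norm_kpow_le:
  fixes M :: "'p \<Rightarrow> 'p \<Rightarrow> complex" and A :: "'p \<Rightarrow> 'p \<Rightarrow> real"
  assumes "\<And>p q. p \<in> S \<Longrightarrow> q \<in> S \<Longrightarrow> norm (M p q) \<le> A p q" "p \<in> S" "q \<in> S"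
  shows "norm (kpow S M n p q) \<le> kpow S A n p q"
  using assms(2)
proof (induction n arbitrary: p)
  case (Suc n)
  have "norm (kpow S M (Suc n) p q) \<le> (\<Sum>r\<in>S. norm (M p r) * norm (kpow S M n r q))"
    by (simp add: sum_norm_le norm_mult)
  also have "\<dots> \<le> (\<Sum>r\<in>S. A p r * kpow S A n r q)"
    using Suc by (intro sum_mono mult_mono assms Suc.IH) (auto intro: order_trans[OF norm_ge_zero] assms)
  finally show ?case by simp
qed auto

lemma kpow_of_real:
  "kpow S (\<lambda>p q. of_real (M p q)) n p q = (of_real (kpow S M n p q) :: complex)"
  by (induction n arbitrary: p) auto

text \<open>The factors \<open>v q / v p\<close> telescope along a path. With \<open>v\<close> a
  Perron eigenvector this is the passage from counting walks to a Markov chain.\<close>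

lemma kpow_conjugate:
  fixes M :: "'p \<Rightarrow> 'p \<Rightarrow> 'a::field"
  assumes v: "\<And>p. p \<in> S \<Longrightarrow> v p \<noteq> 0" and "\<rho> \<noteq> 0" "p \<in> S" "q \<in> S"
  shows "kpow S (\<lambda>p q. M p q * v q / (\<rho> * v p)) n p q = kpow S M n p q * v q / (\<rho> ^ n * v p)"
  using assms(3)
proof (induction n arbitrary: p)
  case 0
  then show ?case using v by auto
next
  case (Suc n)
  then show ?case using v \<open>\<rho> \<noteq> 0\<close>
    by (auto simp: sum_divide_distrib sum_distrib_left sum_distrib_right mult_ac intro!: sum.cong)
qed

lemma kpow_row_sum:
  fixes P :: "'p \<Rightarrow> 'p \<Rightarrow> real"
  assumes "finite S" "\<And>p. p \<in> S \<Longrightarrow> (\<Sum>q\<in>S. P p q) = 1" "p \<in> S"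
  shows "(\<Sum>q\<in>S. kpow S P n p q) = 1"
  using assms(3)
proof (induction n arbitrary: p)
  case (Suc n)
  have "(\<Sum>q\<in>S. kpow S P (Suc n) p q) = (\<Sum>r\<in>S. P p r * (\<Sum>q\<in>S. kpow S P n r q))"
    unfolding kpow.simps sum_distrib_left by (rule sum.swap)
  then show ?case using Suc assms(2) by (simp cong: sum.cong)
qed (use assms(1) in simp)

lemma kpow_stationary:
  fixes P :: "'p \<Rightarrow> 'p \<Rightarrow> real"
  assumes "finite S" "\<And>q. q \<in> S \<Longrightarrow> (\<Sum>p\<in>S. \<pi> p * P p q) = \<pi> q" "q \<in> S"
  shows "(\<Sum>p\<in>S. \<pi> p * kpow S P n p q) = \<pi> q"
proof (induction n)
  case 0
  show ?case using assms(1,3) by (simp add: if_distrib[of "(*) _"] cong: if_cong)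
next
  case (Suc n)
  have "(\<Sum>p\<in>S. \<pi> p * kpow S P (Suc n) p q) = (\<Sum>p\<in>S. \<Sum>r\<in>S. \<pi> p * P p r * kpow S P n r q)"
    by (simp add: sum_distrib_left mult.assoc)
  also have "\<dots> = (\<Sum>r\<in>S. (\<Sum>p\<in>S. \<pi> p * P p r) * kpow S P n r q)"
    unfolding sum_distrib_right by (rule sum.swap)
  finally show ?case using Suc assms(2) by (simp cong: sum.cong)
qed

lemma kpow_apply_Suc:
  fixes M :: "'p \<Rightarrow> 'p \<Rightarrow> 'a::comm_semiring_1"
  shows "(\<Sum>q\<in>S. kpow S M (Suc n) p q * f q) = (\<Sum>r\<in>S. M p r * (\<Sum>q\<in>S. kpow S M n r q * f q))"
  unfolding kpow.simps sum_distrib_left sum_distrib_right mult.assoc by (rule sum.swap)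

text \<open>By \<open>doeblin\<close>, after \<open>n0\<close> steps the chain has restarted from
  its stationary law with probability at least \<open>\<epsilon>\<close>. Contraction, mixing and
  the Poisson equation all come from this one inequality.\<close>

locale stationary_kernel =
  fixes S :: "'p set" and P :: "'p \<Rightarrow> 'p \<Rightarrow> real" and \<pi> :: "'p \<Rightarrow> real" and n0 :: nat and \<epsilon> :: real
  assumes finS: "finite S"
    and Pnn: "\<And>p q. p \<in> S \<Longrightarrow> q \<in> S \<Longrightarrow> P p q \<ge> 0"
    and Psum: "\<And>p. p \<in> S \<Longrightarrow> (\<Sum>q\<in>S. P p q) = 1"
    and pnn: "\<And>p. p \<in> S \<Longrightarrow> \<pi> p \<ge> 0"
    and psum: "(\<Sum>p\<in>S. \<pi> p) = 1"
    and stat: "\<And>q. q \<in> S \<Longrightarrow> (\<Sum>p\<in>S. \<pi> p * P p q) = \<pi> q"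
    and eps: "0 < \<epsilon>" "\<epsilon> \<le> 1"
    and doeblin: "\<And>p q. p \<in> S \<Longrightarrow> q \<in> S \<Longrightarrow> kpow S P n0 p q \<ge> \<epsilon> * \<pi> q"
begin

definition G :: "('p \<Rightarrow> real) \<Rightarrow> 'p \<Rightarrow> real" where
  "G f p = (\<Sum>q\<in>S. kpow S P n0 p q * f q)"

text \<open>Since \<open>f\<close> has mean zero, \<open>\<epsilon> * \<pi> q\<close> may be
  subtracted from the kernel for free. What remains is nonnegative with row sums
  \<open>1 - \<epsilon>\<close>.\<close>

lemma G_contract:
  assumes "(\<Sum>p\<in>S. \<pi> p * f p) = 0" "\<And>p. p \<in> S \<Longrightarrow> \<bar>f p\<bar> \<le> B" "p \<in> S"
  shows "\<bar>G f p\<bar> \<le> (1 - \<epsilon>) * B"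
proof -
  have "G f p = (\<Sum>q\<in>S. (kpow S P n0 p q - \<epsilon> * \<pi> q) * f q)"
    using assms(1) by (simp add: G_def left_diff_distrib sum_subtractf mult.assoc sum_distrib_left[symmetric])
  also have "\<bar>\<dots>\<bar> \<le> (\<Sum>q\<in>S. (kpow S P n0 p q - \<epsilon> * \<pi> q) * B)"
    using doeblin assms
    by (intro order_trans[OF sum_abs] sum_mono) (auto simp: abs_mult intro!: mult_mono)
  also have "\<dots> = (1 - \<epsilon>) * B"
    using assms(3) by (simp add: sum_distrib_right[symmetric] sum_subtractf kpow_row_sum[OF finS Psum]
        sum_distrib_left[symmetric] psum)
  finally show ?thesis .
qed

lemma G_mean: "(\<Sum>p\<in>S. \<pi> p * G f p) = (\<Sum>p\<in>S. \<pi> p * f p)"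
proof -
  have "(\<Sum>p\<in>S. \<pi> p * G f p) = (\<Sum>q\<in>S. (\<Sum>p\<in>S. \<pi> p * kpow S P n0 p q) * f q)"
    unfolding G_def sum_distrib_left sum_distrib_right mult.assoc by (rule sum.swap)
  then show ?thesis by (simp add: kpow_stationary[OF finS stat] cong: sum.cong)
qed

lemma G_iter:
  assumes "(\<Sum>p\<in>S. \<pi> p * f p) = 0" "\<And>p. p \<in> S \<Longrightarrow> \<bar>f p\<bar> \<le> B" "p \<in> S"
  shows "\<bar>(G ^^ k) f p\<bar> \<le> (1 - \<epsilon>) ^ k * B"
proof -
  have "(\<Sum>p\<in>S. \<pi> p * (G ^^ k) f p) = 0 \<and> (\<forall>p\<in>S. \<bar>(G ^^ k) f p\<bar> \<le> (1 - \<epsilon>) ^ k * B)"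
  proof (induction k)
    case (Suc k)
    then show ?case
      using G_contract[of "(G ^^ k) f" "(1 - \<epsilon>) ^ k * B"] by (auto simp: G_mean mult.assoc)
  qed (use assms in auto)
  then show ?thesis using assms by blast
qed

lemma G_iter_kpow:
  assumes "p \<in> S"
  shows "(G ^^ k) f p = (\<Sum>q\<in>S. kpow S P (k * n0) p q * f q)"
  using assms
proof (induction k arbitrary: p)
  case 0
  have "(\<Sum>q\<in>S. kpow S P (0 * n0) p q * f q) = (\<Sum>q\<in>S. if q = p then f q else 0)"
    by (intro sum.cong) auto
  then show ?case using finS 0 by simp
next
  case (Suc k)
  have "(G ^^ Suc k) f p = G ((G ^^ k) f) p" by simp
  also have "\<dots> = (\<Sum>r\<in>S. kpow S P n0 p r * (\<Sum>q\<in>S. kpow S P (k * n0) r q * f q))"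
    unfolding G_def[of "(G ^^ k) f"] by (intro sum.cong refl) (simp add: Suc.IH)
  also have "\<dots> = (\<Sum>q\<in>S. kpow S P (n0 + k * n0) p q * f q)"
    unfolding kpow_add[OF finS Suc.prems] sum_distrib_left sum_distrib_right mult.assoc by (rule sum.swap)
  finally show ?case by simp
qed

text \<open>The centred indicator of \<open>o0\<close> has mean zero, so iterating the contraction
  makes it small. The resulting \<open>m\<close> is a multiple of \<open>n0\<close> and serves all
  starting points at once.\<close>

lemma mixing:
  assumes "o0 \<in> S" "\<eta> > 0"
  obtains m where "\<And>p. p \<in> S \<Longrightarrow> \<bar>kpow S P m p o0 - \<pi> o0\<bar> < \<eta>"
proof -
  define f where "f p = (if p = o0 then 1 else 0) - \<pi> o0" for p
  have "(\<Sum>p\<in>S. \<pi> p * f p) = (\<Sum>p\<in>S. if p = o0 then \<pi> p else 0) - (\<Sum>p\<in>S. \<pi> p * \<pi> o0)"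
    unfolding f_def sum_subtractf[symmetric] by (intro sum.cong) (auto simp: algebra_simps)
  then have f0: "(\<Sum>p\<in>S. \<pi> p * f p) = 0"
    using assms finS by (simp add: sum_distrib_right[symmetric] psum)
  have "\<pi> o0 \<le> 1" using member_le_sum[of o0 S \<pi>] pnn finS psum assms by auto
  then have f1: "\<bar>f p\<bar> \<le> 1" for p
    using pnn[OF assms(1)] by (auto simp: f_def)
  obtain k where k: "(1 - \<epsilon>) ^ k < \<eta>"
    using real_arch_pow_inv[of \<eta> "1 - \<epsilon>"] eps assms by auto
  have "\<bar>kpow S P (k * n0) p o0 - \<pi> o0\<bar> < \<eta>" if p: "p \<in> S" for p
  proof -
    have "(G ^^ k) f p = (\<Sum>q\<in>S. if q = o0 then kpow S P (k * n0) p q else 0)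
        - (\<Sum>q\<in>S. kpow S P (k * n0) p q * \<pi> o0)"
      unfolding G_iter_kpow[OF p] f_def sum_subtractf[symmetric]
      by (intro sum.cong) (auto simp: algebra_simps)
    also have "\<dots> = kpow S P (k * n0) p o0 - \<pi> o0"
      using assms finS p by (simp add: sum_distrib_right[symmetric] kpow_row_sum[OF finS Psum])
    finally show ?thesis using G_iter[OF f0 f1 p, of k] k by simp
  qed
  then show thesis by (rule that)
qed

text \<open>Summing the Neumann series of the contraction \<open>P ^ n0\<close> first avoids estimating the
  powers of \<open>P\<close> themselves.\<close>

lemma poisson_equation:
  assumes "(\<Sum>p\<in>S. \<pi> p * g p) = 0"
  obtains \<phi> where "\<And>p. p \<in> S \<Longrightarrow> \<phi> p - (\<Sum>q\<in>S. P p q * \<phi> q) = g p"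
proof -
  define B where "B = (\<Sum>p\<in>S. \<bar>g p\<bar>)"
  have B: "\<bar>g p\<bar> \<le> B" if "p \<in> S" for p
    unfolding B_def using finS that by (intro member_le_sum) auto
  \<comment> \<open>Neumann series for \<open>1 - G\<close>, dominated by a geometric series with
    ratio \<open>1 - \<epsilon>\<close>.\<close>
  define h where "h p = (\<Sum>k. (G ^^ k) g p)" for p
  have sm: "summable (\<lambda>k. (G ^^ k) g p)" if "p \<in> S" for p
  proof (rule summable_comparison_test')
    show "summable (\<lambda>k. (1 - \<epsilon>) ^ k * B)" using eps by (intro summable_mult2 summable_geometric) auto
    show "norm ((G ^^ k) g p) \<le> (1 - \<epsilon>) ^ k * B" for k
      using G_iter[OF assms B that] by simp
  qed
  have Gh: "h p - G h p = g p" if p: "p \<in> S" for p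
  proof -
    have "G h p = (\<Sum>q\<in>S. \<Sum>k. kpow S P n0 p q * (G ^^ k) g q)"
      unfolding G_def[of h p] h_def by (intro sum.cong refl suminf_mult[symmetric] sm)
    also have "\<dots> = (\<Sum>k. \<Sum>q\<in>S. kpow S P n0 p q * (G ^^ k) g q)"
      by (intro suminf_sum[symmetric] summable_mult sm)
    also have "\<dots> = (\<Sum>k. (G ^^ Suc k) g p)" by (simp add: G_def)
    finally show ?thesis
      using suminf_split_head[OF sm[OF p]] by (simp add: h_def)
  qed
  \<comment> \<open>Applying 1 - P to the sum of the first \<open>n0\<close> powers of P leaves 1 -
    P^n0, which is 1 - G; so \<open>\<phi>\<close> solves the equation for P because
    \<open>h\<close> solves it for G.\<close>
  define \<phi> where "\<phi> p = (\<Sum>i<n0. \<Sum>q\<in>S. kpow S P i p q * h q)" for p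
  have "\<phi> p - (\<Sum>q\<in>S. P p q * \<phi> q) = g p" if p: "p \<in> S" for p
  proof -
    have "(\<Sum>r\<in>S. P p r * \<phi> r) = (\<Sum>r\<in>S. \<Sum>i<n0. P p r * (\<Sum>q\<in>S. kpow S P i r q * h q))"
      by (simp add: \<phi>_def sum_distrib_left)
    also have "\<dots> = (\<Sum>i<n0. \<Sum>r\<in>S. P p r * (\<Sum>q\<in>S. kpow S P i r q * h q))" by (rule sum.swap)
    also have "\<dots> = (\<Sum>i<n0. \<Sum>q\<in>S. kpow S P (Suc i) p q * h q)"
      by (simp only: kpow_apply_Suc)
    finally have "\<phi> p - (\<Sum>q\<in>S. P p q * \<phi> q)
        = (\<Sum>i<n0. (\<Sum>q\<in>S. kpow S P i p q * h q) - (\<Sum>q\<in>S. kpow S P (Suc i) p q * h q))"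
      by (simp only: \<phi>_def sum_subtractf)
    also have "\<dots> = (\<Sum>q\<in>S. kpow S P 0 p q * h q) - (\<Sum>q\<in>S. kpow S P n0 p q * h q)"
      by (rule sum_lessThan_telescope')
    also have "(\<Sum>q\<in>S. kpow S P 0 p q * h q) = (\<Sum>q\<in>S. if q = p then h q else 0)"
      by (intro sum.cong) auto
    also have "\<dots> = h p" using finS p by simp
    finally show ?thesis using Gh[OF p] by (simp add: G_def)
  qed
  then show thesis by (rule that)
qed

end

section \<open>Perturbation of the leading eigenvalue\<close>

text \<open>The imaginary unit is a variable with square -1, which turns the sorting of one step by
  powers of \<open>t\<close> into a polynomial identity. Here \<open>w\<close> stands for half the
  second moment.\<close>

lemma twisted_step_expansion:
  fixes i P W1 w t f s :: complex
  assumes "i * i = - 1"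
  shows "(P + i * t * W1 - t\<^sup>2 * w) * (1 + i * (t * f) + t\<^sup>2 * s)
    = P + i * (t * (P * f + W1)) + t\<^sup>2 * (P * s - W1 * f - w)
      + i * (t ^ 3 * (W1 * s - w * f)) - t ^ 4 * (w * s)"
  using assms by algebra

context stationary_kernel
begin

text \<open>The vector \<open>V\<close> is an eigenvector of \<open>T \<theta>\<close> up to \<open>O(\<theta> ^ 3)\<close>, with eigenvalue
  \<open>1 - \<kappa> \<theta>\<^sup>2\<close>; its coefficients solve two Poisson equations, the second of which fixes \<open>\<kappa>\<close>.\<close>

lemma approximate_eigenvector:
  fixes T :: "real \<Rightarrow> 'p \<Rightarrow> 'p \<Rightarrow> complex" and W1 W2 W3 :: "'p \<Rightarrow> 'p \<Rightarrow> real"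
  assumes expand: "\<And>\<theta> p q. p \<in> S \<Longrightarrow> q \<in> S \<Longrightarrow>
      norm (T \<theta> p q - (P p q + \<i> * \<theta> * W1 p q - \<theta>\<^sup>2 / 2 * W2 p q)) \<le> \<bar>\<theta>\<bar> ^ 3 * W3 p q"
    and W3nn: "\<And>p q. p \<in> S \<Longrightarrow> q \<in> S \<Longrightarrow> W3 p q \<ge> 0"
    and centred: "(\<Sum>p\<in>S. \<pi> p * (\<Sum>q\<in>S. W1 p q)) = 0"
  obtains \<kappa> c c' :: real and V :: "real \<Rightarrow> 'p \<Rightarrow> complex"
    where "\<And>\<theta> p. p \<in> S \<Longrightarrow> \<bar>\<theta>\<bar> \<le> 1 \<Longrightarrow> norm (V \<theta> p - 1) \<le> c' * \<bar>\<theta>\<bar>"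
      "\<And>\<theta> p. p \<in> S \<Longrightarrow> \<bar>\<theta>\<bar> \<le> 1 \<Longrightarrow>
         norm ((\<Sum>q\<in>S. T \<theta> p q * V \<theta> q) - of_real (1 - \<kappa> * \<theta>\<^sup>2) * V \<theta> p) \<le> c * \<bar>\<theta>\<bar> ^ 3"
      "c \<ge> 0"
proof -
  obtain \<phi> where \<phi>: "\<And>p. p \<in> S \<Longrightarrow> \<phi> p - (\<Sum>q\<in>S. P p q * \<phi> q) = (\<Sum>q\<in>S. W1 p q)"
    using poisson_equation[OF centred] by blast
  \<comment> \<open>The part of the \<theta>^2 coefficient that involves the weights: the first
    moments act on the corrector \<open>\<phi>\<close>, and half the second moments are added. The
    right-hand side \<open>\<kappa> - g p\<close> is centred only if \<open>\<kappa>\<close> is the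
    stationary mean of \<open>g\<close>.\<close>
  define g where "g p = (\<Sum>q\<in>S. W1 p q * \<phi> q) + (\<Sum>q\<in>S. W2 p q) / 2" for p
  define \<kappa> where "\<kappa> = (\<Sum>p\<in>S. \<pi> p * g p)"
  have "(\<Sum>p\<in>S. \<pi> p * (\<kappa> - g p)) = 0"
    by (simp add: right_diff_distrib sum_subtractf sum_distrib_right[symmetric] psum \<kappa>_def[symmetric])
  then obtain \<psi> where \<psi>: "\<And>p. p \<in> S \<Longrightarrow> \<psi> p - (\<Sum>q\<in>S. P p q * \<psi> q) = \<kappa> - g p"
    by (rule poisson_equation) (rule that)
  define V where "V \<theta> p = 1 + \<i> * of_real (\<theta> * \<phi> p) + of_real (\<theta>\<^sup>2 * \<psi> p)" for \<theta> :: real and p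
  define E where "E \<theta> p q = T \<theta> p q - (P p q + \<i> * \<theta> * W1 p q - \<theta>\<^sup>2 / 2 * W2 p q)" for \<theta> p q
  \<comment> \<open>What survives after orders 0 to 2 cancel: \<open>a\<close> is the coefficient of
    \<i> \<theta>^3, \<open>b\<close> that of \<theta>^4, and \<open>d\<close> bounds the expansion
    error of \<open>T\<close> acting on \<open>V\<close>.\<close>
  define a where "a p = (\<Sum>q\<in>S. W1 p q * \<psi> q) - (\<Sum>q\<in>S. W2 p q * \<phi> q) / 2 + \<kappa> * \<phi> p" for p
  define b where "b p = \<kappa> * \<psi> p - (\<Sum>q\<in>S. W2 p q * \<psi> q) / 2" for p
  define d where "d p = (\<Sum>q\<in>S. W3 p q * (1 + \<bar>\<phi> q\<bar> + \<bar>\<psi> q\<bar>))" for p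
  define c where "c = (\<Sum>p\<in>S. \<bar>a p\<bar> + \<bar>b p\<bar> + d p)"
  define c' where "c' = (\<Sum>p\<in>S. \<bar>\<phi> p\<bar> + \<bar>\<psi> p\<bar>)"
  have d0: "d p \<ge> 0" if "p \<in> S" for p
    unfolding d_def using W3nn that by (intro sum_nonneg mult_nonneg_nonneg) auto
  have cp: "\<bar>a p\<bar> + \<bar>b p\<bar> + d p \<le> c" if "p \<in> S" for p
    unfolding c_def using finS that d0 by (intro member_le_sum) auto
  have c0: "c \<ge> 0" unfolding c_def using d0 by (intro sum_nonneg) auto
  have c'p: "\<bar>\<phi> p\<bar> + \<bar>\<psi> p\<bar> \<le> c'" if "p \<in> S" for p
    unfolding c'_def using finS that by (intro member_le_sum) auto
  have sq: "\<theta>\<^sup>2 \<le> \<bar>\<theta>\<bar>" if "\<bar>\<theta>\<bar> \<le> 1" for \<theta> :: real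
    using that by (metis abs_ge_zero abs_power2 mult_left_le power2_abs power2_eq_square)
  have V1: "norm (V \<theta> p - 1) \<le> \<bar>\<theta>\<bar> * (\<bar>\<phi> p\<bar> + \<bar>\<psi> p\<bar>)" if "\<bar>\<theta>\<bar> \<le> 1" for \<theta> p
  proof -
    have "norm (V \<theta> p - 1) \<le> norm (\<i> * of_real (\<theta> * \<phi> p)) + norm (of_real (\<theta>\<^sup>2 * \<psi> p) :: complex)"
      unfolding V_def by (rule order_trans[OF _ norm_triangle_ineq]) simp
    also have "\<dots> = \<bar>\<theta>\<bar> * \<bar>\<phi> p\<bar> + \<theta>\<^sup>2 * \<bar>\<psi> p\<bar>"
      unfolding norm_mult norm_of_real by (simp add: abs_mult)
    also have "\<dots> \<le> \<bar>\<theta>\<bar> * \<bar>\<phi> p\<bar> + \<bar>\<theta>\<bar> * \<bar>\<psi> p\<bar>"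
      using sq[OF that] by (intro add_left_mono mult_right_mono) auto
    finally show ?thesis by (simp add: distrib_left)
  qed
  have V2: "norm (V \<theta> p) \<le> 1 + \<bar>\<phi> p\<bar> + \<bar>\<psi> p\<bar>" if "\<bar>\<theta>\<bar> \<le> 1" for \<theta> p
  proof -
    have "norm (V \<theta> p) \<le> norm (V \<theta> p - 1) + 1"
      using norm_triangle_ineq[of "V \<theta> p - 1" 1] by simp
    also have "norm (V \<theta> p - 1) \<le> 1 * (\<bar>\<phi> p\<bar> + \<bar>\<psi> p\<bar>)"
      by (rule order_trans[OF V1[OF that]]) (intro mult_right_mono, use that in auto)
    finally show ?thesis by simp
  qed
  have res: "(\<Sum>q\<in>S. T \<theta> p q * V \<theta> q) - of_real (1 - \<kappa> * \<theta>\<^sup>2) * V \<theta> p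
      = \<i> * of_real (\<theta> ^ 3 * a p) + of_real (\<theta> ^ 4 * b p) + (\<Sum>q\<in>S. E \<theta> p q * V \<theta> q)"
    if p: "p \<in> S" for \<theta> p
  proof -
    have "(\<Sum>q\<in>S. T \<theta> p q * V \<theta> q) = (\<Sum>q\<in>S. of_real (P p q) + \<i> * (\<theta> * (P p q * \<phi> q + W1 p q))
         + \<theta>\<^sup>2 * (P p q * \<psi> q - (W1 p q * \<phi> q) - W2 p q / 2)
         + \<i> * (\<theta> ^ 3 * (W1 p q * \<psi> q - W2 p q * \<phi> q / 2)) - \<theta> ^ 4 * (W2 p q * \<psi> q / 2)
         + E \<theta> p q * V \<theta> q)"
    proof (intro sum.cong refl)
      fix q
      have "T \<theta> p q * V \<theta> q
          = (of_real (P p q) + \<i> * of_real \<theta> * of_real (W1 p q) - (of_real \<theta>)\<^sup>2 * of_real (W2 p q / 2))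
          * (1 + \<i> * (of_real \<theta> * of_real (\<phi> q)) + (of_real \<theta>)\<^sup>2 * of_real (\<psi> q)) + E \<theta> p q * V \<theta> q"
        by (simp add: E_def V_def algebra_simps)
      then show "T \<theta> p q * V \<theta> q = of_real (P p q) + \<i> * (\<theta> * (P p q * \<phi> q + W1 p q))
         + \<theta>\<^sup>2 * (P p q * \<psi> q - (W1 p q * \<phi> q) - W2 p q / 2)
         + \<i> * (\<theta> ^ 3 * (W1 p q * \<psi> q - W2 p q * \<phi> q / 2)) - \<theta> ^ 4 * (W2 p q * \<psi> q / 2)
         + E \<theta> p q * V \<theta> q"
        by (subst (asm) twisted_step_expansion) simp_all
    qed
    also have "\<dots> = 1 + \<i> * (\<theta> * ((\<Sum>q\<in>S. P p q * \<phi> q) + (\<Sum>q\<in>S. W1 p q)))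
         + \<theta>\<^sup>2 * ((\<Sum>q\<in>S. P p q * \<psi> q) - g p)
         + \<i> * (\<theta> ^ 3 * (a p - \<kappa> * \<phi> p)) - \<theta> ^ 4 * (\<kappa> * \<psi> p - b p) + (\<Sum>q\<in>S. E \<theta> p q * V \<theta> q)"
    proof -
      have "(\<Sum>q\<in>S. \<theta> * (P p q * \<phi> q + W1 p q)) = \<theta> * ((\<Sum>q\<in>S. P p q * \<phi> q) + (\<Sum>q\<in>S. W1 p q))"
        by (simp add: sum_distrib_left[symmetric] sum.distrib)
      moreover have "(\<Sum>q\<in>S. \<theta>\<^sup>2 * (P p q * \<psi> q - (W1 p q * \<phi> q) - W2 p q / 2))
          = \<theta>\<^sup>2 * ((\<Sum>q\<in>S. P p q * \<psi> q) - g p)"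
        by (simp add: sum_distrib_left[symmetric] sum.distrib sum_subtractf g_def sum_divide_distrib)
      moreover have "(\<Sum>q\<in>S. \<theta> ^ 3 * (W1 p q * \<psi> q - W2 p q * \<phi> q / 2)) = \<theta> ^ 3 * (a p - \<kappa> * \<phi> p)"
        by (simp add: sum_distrib_left[symmetric] sum_subtractf a_def sum_divide_distrib)
      moreover have "(\<Sum>q\<in>S. \<theta> ^ 4 * (W2 p q * \<psi> q / 2)) = \<theta> ^ 4 * (\<kappa> * \<psi> p - b p)"
        unfolding sum_distrib_left[symmetric] by (simp add: b_def sum_divide_distrib)
      ultimately show ?thesis
        using Psum[OF p]
        by (simp only: sum.distrib sum_subtractf sum_distrib_left[symmetric] of_real_sum[symmetric] of_real_1)
    qed
    also have "(\<Sum>q\<in>S. P p q * \<phi> q) + (\<Sum>q\<in>S. W1 p q) = \<phi> p" using \<phi>[OF p] by simp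
    also have "(\<Sum>q\<in>S. P p q * \<psi> q) - g p = \<psi> p - \<kappa>" using \<psi>[OF p] by simp
    finally show ?thesis
      by (simp add: V_def algebra_simps power2_eq_square power3_eq_cube power4_eq_xxxx)
  qed
  have "norm ((\<Sum>q\<in>S. T \<theta> p q * V \<theta> q) - of_real (1 - \<kappa> * \<theta>\<^sup>2) * V \<theta> p) \<le> c * \<bar>\<theta>\<bar> ^ 3"
    if p: "p \<in> S" and \<theta>: "\<bar>\<theta>\<bar> \<le> 1" for \<theta> p
  proof -
    have "norm (\<Sum>q\<in>S. E \<theta> p q * V \<theta> q) \<le> (\<Sum>q\<in>S. (\<bar>\<theta>\<bar> ^ 3 * W3 p q) * (1 + \<bar>\<phi> q\<bar> + \<bar>\<psi> q\<bar>))"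
      using p expand[OF p] W3nn[OF p] V2[OF \<theta>]
      by (intro sum_norm_le) (auto simp: norm_mult E_def intro!: mult_mono)
    then have e: "norm (\<Sum>q\<in>S. E \<theta> p q * V \<theta> q) \<le> \<bar>\<theta>\<bar> ^ 3 * d p"
      by (simp add: d_def sum_distrib_left mult.assoc)
    have "\<theta> ^ 4 \<le> \<bar>\<theta>\<bar> ^ 3"
      using power_decreasing[of 3 4 "\<bar>\<theta>\<bar>"] \<theta> by (simp add: power_even_abs_numeral)
    then have "norm (of_real (\<theta> ^ 4 * b p) :: complex) \<le> \<bar>\<theta>\<bar> ^ 3 * \<bar>b p\<bar>"
      unfolding norm_of_real abs_mult by (intro mult_right_mono) auto
    moreover have "norm (\<i> * of_real (\<theta> ^ 3 * a p)) = \<bar>\<theta>\<bar> ^ 3 * \<bar>a p\<bar>"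
      unfolding norm_mult norm_of_real abs_mult power_abs by simp
    ultimately have "norm ((\<Sum>q\<in>S. T \<theta> p q * V \<theta> q) - of_real (1 - \<kappa> * \<theta>\<^sup>2) * V \<theta> p)
        \<le> \<bar>\<theta>\<bar> ^ 3 * \<bar>a p\<bar> + \<bar>\<theta>\<bar> ^ 3 * \<bar>b p\<bar> + \<bar>\<theta>\<bar> ^ 3 * d p"
      unfolding res[OF p] using e by (intro norm_triangle_le add_mono) auto
    also have "\<dots> = (\<bar>a p\<bar> + \<bar>b p\<bar> + d p) * \<bar>\<theta>\<bar> ^ 3" by (simp add: algebra_simps)
    also have "\<dots> \<le> c * \<bar>\<theta>\<bar> ^ 3" using cp[OF p] by (intro mult_right_mono) auto
    finally show ?thesis .
  qed
  moreover have "norm (V \<theta> p - 1) \<le> c' * \<bar>\<theta>\<bar>" if "p \<in> S" "\<bar>\<theta>\<bar> \<le> 1" for \<theta> p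
  proof -
    have "\<bar>\<theta>\<bar> * (\<bar>\<phi> p\<bar> + \<bar>\<psi> p\<bar>) \<le> \<bar>\<theta>\<bar> * c'" using c'p[OF that(1)] by (intro mult_left_mono) auto
    then show ?thesis using V1[OF that(2), of p] by (simp add: mult.commute)
  qed
  ultimately show thesis using that c0 by blast
qed

text \<open>Each of the \<open>n\<close> steps adds an error of at most \<open>d\<close>. The kernel
  does not amplify it, being dominated by the stochastic \<open>P\<close>; only the powers of
  \<open>l\<close> do, which costs at most \<open>L ^ n\<close>.\<close>

lemma approximate_eigenvector_power:
  fixes M :: "'p \<Rightarrow> 'p \<Rightarrow> complex" and V :: "'p \<Rightarrow> complex" and l :: complex and L :: real
  assumes sub: "\<And>p q. p \<in> S \<Longrightarrow> q \<in> S \<Longrightarrow> norm (M p q) \<le> P p q"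
    and V: "\<And>p. p \<in> S \<Longrightarrow> norm ((\<Sum>q\<in>S. M p q * V q) - l * V p) \<le> d"
    and L: "norm l \<le> L" "1 \<le> L" and "d \<ge> 0" and p: "p \<in> S"
  shows "norm ((\<Sum>q\<in>S. kpow S M n p q * V q) - l ^ n * V p) \<le> n * d * L ^ n"
  using p
proof (induction n arbitrary: p)
  case 0
  have "(\<Sum>q\<in>S. kpow S M 0 p q * V q) = (\<Sum>q\<in>S. if q = p then V q else 0)"
    by (intro sum.cong) auto
  then show ?case using 0 finS by simp
next
  case (Suc n)
  let ?e = "\<lambda>r. (\<Sum>q\<in>S. kpow S M n r q * V q) - l ^ n * V r"
  have "(\<Sum>q\<in>S. kpow S M (Suc n) p q * V q) - l ^ Suc n * V p
      = (\<Sum>r\<in>S. M p r * ?e r) + l ^ n * ((\<Sum>q\<in>S. M p q * V q) - l * V p)"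
    unfolding kpow_apply_Suc
    by (simp add: right_diff_distrib sum_subtractf sum_distrib_left mult_ac)
  also have "norm \<dots> \<le> (\<Sum>r\<in>S. P p r * (n * d * L ^ n)) + L ^ n * d"
  proof (intro norm_triangle_le add_mono)
    show "norm (\<Sum>r\<in>S. M p r * ?e r) \<le> (\<Sum>r\<in>S. P p r * (n * d * L ^ n))"
      using Suc sub by (intro sum_norm_le) (auto simp: norm_mult intro!: mult_mono Pnn)
    show "norm (l ^ n * ((\<Sum>q\<in>S. M p q * V q) - l * V p)) \<le> L ^ n * d"
      using V[OF Suc.prems] L by (auto simp: norm_mult norm_power intro!: mult_mono power_mono)
  qed
  also have "\<dots> = (n + 1) * d * L ^ n"
    using Psum[OF Suc.prems] by (simp only: sum_distrib_right[symmetric]) (simp add: algebra_simps)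
  also have "\<dots> \<le> (n + 1) * d * L ^ Suc n"
    using L \<open>d \<ge> 0\<close> by (intro mult_left_mono power_increasing) auto
  finally show ?case by (simp add: add.commute)
qed

text \<open>With a free endpoint the limit follows from the approximate eigenvector, since
  \<open>V\<close> tends to 1. To pin the endpoint, a fixed number \<open>m\<close> of final steps
  is split off: over them the twisted kernel tends to \<open>P\<close>, and \<open>P\<close> mixes.
  The sign of \<open>\<kappa>\<close> is not yet decided.\<close>

lemma pinned_clt:
  fixes T :: "real \<Rightarrow> 'p \<Rightarrow> 'p \<Rightarrow> complex" and W1 W2 W3 :: "'p \<Rightarrow> 'p \<Rightarrow> real"
  assumes sub: "\<And>\<theta> p q. p \<in> S \<Longrightarrow> q \<in> S \<Longrightarrow> norm (T \<theta> p q) \<le> P p q"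
    and expand: "\<And>\<theta> p q. p \<in> S \<Longrightarrow> q \<in> S \<Longrightarrow>
      norm (T \<theta> p q - (P p q + \<i> * \<theta> * W1 p q - \<theta>\<^sup>2 / 2 * W2 p q)) \<le> \<bar>\<theta>\<bar> ^ 3 * W3 p q"
    and W3nn: "\<And>p q. p \<in> S \<Longrightarrow> q \<in> S \<Longrightarrow> W3 p q \<ge> 0"
    and centred: "(\<Sum>p\<in>S. \<pi> p * (\<Sum>q\<in>S. W1 p q)) = 0"
    and o0: "o0 \<in> S"
  obtains \<kappa> :: real where
    "\<And>x. (\<lambda>N. kpow S (T (x / sqrt (real N))) N o0 o0) \<longlonglongrightarrow> of_real (\<pi> o0 * exp (- \<kappa> * x\<^sup>2))"
proof -
  obtain \<kappa> c c' V where V1: "\<And>\<theta> p. p \<in> S \<Longrightarrow> \<bar>\<theta>\<bar> \<le> 1 \<Longrightarrow> norm (V \<theta> p - 1) \<le> c' * \<bar>\<theta>\<bar>"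
    and V2: "\<And>\<theta> p. p \<in> S \<Longrightarrow> \<bar>\<theta>\<bar> \<le> 1 \<Longrightarrow>
         norm ((\<Sum>q\<in>S. T \<theta> p q * V \<theta> q) - of_real (1 - \<kappa> * \<theta>\<^sup>2) * V \<theta> p) \<le> c * \<bar>\<theta>\<bar> ^ 3"
    and c0: "c \<ge> 0"
    by (rule approximate_eigenvector[OF expand W3nn centred]) (rule that | assumption)+
  have T0: "(\<lambda>N. T (x / sqrt (real N)) p q) \<longlonglongrightarrow> of_real (P p q)" if "p \<in> S" "q \<in> S" for x p q
  proof -
    have z: "(\<lambda>N. x / sqrt (real N)) \<longlonglongrightarrow> 0" by real_asymp
    have 1: "(\<lambda>N. T (x / sqrt (real N)) p q - (P p q + \<i> * (x / sqrt (real N)) * W1 p q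
         - (x / sqrt (real N))\<^sup>2 / 2 * W2 p q)) \<longlonglongrightarrow> 0"
    proof (rule Lim_null_comparison)
      show "\<forall>\<^sub>F N in sequentially. norm (T (x / sqrt (real N)) p q - (P p q + \<i> * (x / sqrt (real N)) * W1 p q
         - (x / sqrt (real N))\<^sup>2 / 2 * W2 p q)) \<le> \<bar>x / sqrt (real N)\<bar> ^ 3 * W3 p q"
        using expand[OF that, of "x / sqrt (real _)"] by (intro always_eventually) (simp only: of_real_power simp_thms)
      show "(\<lambda>N. \<bar>x / sqrt (real N)\<bar> ^ 3 * W3 p q) \<longlonglongrightarrow> 0"
        using tendsto_mult_right[OF tendsto_power[OF tendsto_rabs[OF z], of 3], of "W3 p q"] by simp
    qed
    have 2: "(\<lambda>N. P p q + \<i> * (x / sqrt (real N)) * W1 p q - (x / sqrt (real N))\<^sup>2 / 2 * W2 p q)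
        \<longlonglongrightarrow> of_real (P p q) + \<i> * of_real 0 * W1 p q - (of_real 0)\<^sup>2 / 2 * W2 p q"
      by (intro tendsto_intros) (use z in auto)
    from tendsto_add[OF 1 2] show ?thesis by simp
  qed
  have Tn0: "(\<lambda>N. kpow S (T (x / sqrt (real N))) m p q) \<longlonglongrightarrow> of_real (kpow S P m p q)"
    if "p \<in> S" "q \<in> S" for x m p q
    using that(1)
  proof (induction m arbitrary: p)
    case (Suc m)
    then show ?case using that(2)
      by (auto intro!: tendsto_sum tendsto_mult T0)
  qed auto
  \<comment> \<open>Free endpoint and only \<open>N - m\<close> steps, while the angle is still
    scaled by N; dropping \<open>m\<close> steps does not change the limit of the powers of
    \<open>l\<close>.\<close>
  have rows: "(\<lambda>N. \<Sum>q\<in>S. kpow S (T (x / sqrt (real N))) (N - m) o0 q) \<longlonglongrightarrow> of_real (exp (- \<kappa> * x\<^sup>2))"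
    for x m
  proof -
    define \<theta> where "\<theta> N = x / sqrt (real N)" for N
    define l where "l N = 1 - \<kappa> * (\<theta> N)\<^sup>2" for N
    have z: "\<theta> \<longlonglongrightarrow> 0" unfolding \<theta>_def by real_asymp
    have ev1: "\<forall>\<^sub>F N in sequentially. \<bar>\<theta> N\<bar> \<le> 1 \<and> N > m"
    proof (intro eventually_conj)
      show "\<forall>\<^sub>F N in sequentially. \<bar>\<theta> N\<bar> \<le> 1"
        using tendsto_rabs[OF z] by (auto dest!: order_tendstoD(2)[of _ _ _ 1] elim: eventually_mono)
    qed (rule eventually_gt_at_top)
    \<comment> \<open>The accumulated error is of order N |\<theta>|^3 = |x|^3 / sqrt N, and the
      growth factor stays below \<open>exp (\<bar>\<kappa>\<bar> * x\<^sup>2)\<close>.\<close>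
    have b1: "(\<lambda>N. (\<Sum>q\<in>S. kpow S (T (\<theta> N)) (N - m) o0 q * V (\<theta> N) q)
        - of_real (l N) ^ (N - m) * V (\<theta> N) o0) \<longlonglongrightarrow> 0"
    proof (rule Lim_null_comparison)
      show "\<forall>\<^sub>F N in sequentially. norm ((\<Sum>q\<in>S. kpow S (T (\<theta> N)) (N - m) o0 q * V (\<theta> N) q)
        - of_real (l N) ^ (N - m) * V (\<theta> N) o0) \<le> real N * (c * \<bar>\<theta> N\<bar> ^ 3) * exp (\<bar>\<kappa>\<bar> * x\<^sup>2)"
        using ev1
      proof eventually_elim
        case (elim N)
        define L where "L = 1 + \<bar>\<kappa>\<bar> * (\<theta> N)\<^sup>2"
        have "norm ((\<Sum>q\<in>S. kpow S (T (\<theta> N)) (N - m) o0 q * V (\<theta> N) q)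
          - of_real (l N) ^ (N - m) * V (\<theta> N) o0) \<le> real (N - m) * (c * \<bar>\<theta> N\<bar> ^ 3) * L ^ (N - m)"
        proof (rule approximate_eigenvector_power[OF sub])
          show "norm ((\<Sum>q\<in>S. T (\<theta> N) p q * V (\<theta> N) q) - of_real (l N) * V (\<theta> N) p)
              \<le> c * \<bar>\<theta> N\<bar> ^ 3" if "p \<in> S" for p
            using V2[OF that, of "\<theta> N"] elim by (simp add: l_def)
          show "norm (of_real (l N) :: complex) \<le> L"
            unfolding norm_of_real l_def L_def
            by (rule order_trans[OF abs_triangle_ineq4]) (simp add: abs_mult)
        qed (use c0 o0 in \<open>auto simp: L_def\<close>)
        also have "\<dots> \<le> real N * (c * \<bar>\<theta> N\<bar> ^ 3) * exp (\<bar>\<kappa>\<bar> * x\<^sup>2)"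
        proof (intro mult_mono)
          have "L ^ (N - m) \<le> L ^ N" by (intro power_increasing) (auto simp: L_def)
          also have "L \<le> exp (\<bar>\<kappa>\<bar> * (\<theta> N)\<^sup>2)" unfolding L_def by simp
          then have "L ^ N \<le> exp (\<bar>\<kappa>\<bar> * (\<theta> N)\<^sup>2) ^ N" by (intro power_mono) (auto simp: L_def)
          also have "\<dots> = exp (\<bar>\<kappa>\<bar> * x\<^sup>2)" using elim
            by (simp add: exp_of_nat_mult[symmetric] \<theta>_def power_divide)
          finally show "L ^ (N - m) \<le> exp (\<bar>\<kappa>\<bar> * x\<^sup>2)" .
        qed (use c0 in \<open>auto simp: L_def\<close>)
        finally show ?case .
      qed
      have "(\<lambda>N. real N * (c * \<bar>\<theta> N\<bar> ^ 3) * exp (\<bar>\<kappa>\<bar> * x\<^sup>2))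
          = (\<lambda>N. (c * \<bar>x\<bar> ^ 3 * exp (\<bar>\<kappa>\<bar> * x\<^sup>2)) * (real N / sqrt (real N) ^ 3))"
        unfolding \<theta>_def by (auto simp: abs_divide power_divide)
      moreover have "(\<lambda>N. real N / sqrt (real N) ^ 3) \<longlonglongrightarrow> 0" by real_asymp
      ultimately show "(\<lambda>N. real N * (c * \<bar>\<theta> N\<bar> ^ 3) * exp (\<bar>\<kappa>\<bar> * x\<^sup>2)) \<longlonglongrightarrow> 0"
        by (simp only: tendsto_mult_right_zero)
    qed
    have Vone: "(\<lambda>N. V (\<theta> N) p) \<longlonglongrightarrow> 1" if "p \<in> S" for p
    proof -
      have "(\<lambda>N. V (\<theta> N) p - 1) \<longlonglongrightarrow> 0"
      proof (rule Lim_null_comparison)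
        show "\<forall>\<^sub>F N in sequentially. norm (V (\<theta> N) p - 1) \<le> c' * \<bar>\<theta> N\<bar>"
          using ev1 by eventually_elim (use V1[OF that] in auto)
        show "(\<lambda>N. c' * \<bar>\<theta> N\<bar>) \<longlonglongrightarrow> 0"
          using tendsto_mult_left[OF tendsto_rabs[OF z], of c'] by simp
      qed
      then show ?thesis by (simp add: LIM_zero_iff)
    qed
    have b2: "(\<lambda>N. \<Sum>q\<in>S. kpow S (T (\<theta> N)) (N - m) o0 q * (1 - V (\<theta> N) q)) \<longlonglongrightarrow> 0"
    proof (rule tendsto_null_sum)
      fix q assume q: "q \<in> S"
      show "(\<lambda>N. kpow S (T (\<theta> N)) (N - m) o0 q * (1 - V (\<theta> N) q)) \<longlonglongrightarrow> 0"
      proof (rule Lim_null_comparison)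
        show "\<forall>\<^sub>F N in sequentially. norm (kpow S (T (\<theta> N)) (N - m) o0 q * (1 - V (\<theta> N) q))
            \<le> norm (1 - V (\<theta> N) q)"
        proof (intro always_eventually allI)
          fix N
          have "norm (kpow S (T (\<theta> N)) (N - m) o0 q) \<le> kpow S P (N - m) o0 q"
            by (rule norm_kpow_le[OF sub o0 q])
          also have "\<dots> \<le> (\<Sum>q\<in>S. kpow S P (N - m) o0 q)"
            using finS q kpow_nonneg[OF Pnn o0] by (intro member_le_sum) auto
          also have "\<dots> = 1" by (rule kpow_row_sum[OF finS Psum o0])
          finally show "norm (kpow S (T (\<theta> N)) (N - m) o0 q * (1 - V (\<theta> N) q)) \<le> norm (1 - V (\<theta> N) q)"
            by (simp add: norm_mult mult_left_le_one_le)
        qed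
        show "(\<lambda>N. norm (1 - V (\<theta> N) q)) \<longlonglongrightarrow> 0"
          using tendsto_norm[OF tendsto_diff[OF tendsto_const[of 1] Vone[OF q]]] by simp
      qed
    qed
    have lN: "(\<lambda>N. l N ^ (N - m)) \<longlonglongrightarrow> exp (- \<kappa> * x\<^sup>2)"
    proof -
      have "(\<lambda>N. (1 + (- \<kappa> * x\<^sup>2) / real N) ^ N) \<longlonglongrightarrow> exp (- \<kappa> * x\<^sup>2)"
        by (rule tendsto_exp_limit_sequentially)
      then have e: "(\<lambda>N. l N ^ N) \<longlonglongrightarrow> exp (- \<kappa> * x\<^sup>2)"
        by (rule Lim_transform_eventually)
          (auto simp: l_def \<theta>_def power_divide intro!: always_eventually)
      have l1: "l \<longlonglongrightarrow> 1"
        using tendsto_diff[OF tendsto_const[of 1] tendsto_mult[OF tendsto_const[of \<kappa>] tendsto_power[OF z, of 2]]]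
        unfolding l_def[abs_def] by simp
      then have "(\<lambda>N. l N ^ N / l N ^ m) \<longlonglongrightarrow> exp (- \<kappa> * x\<^sup>2) / 1 ^ m"
        by (intro tendsto_intros e) auto
      moreover have "\<forall>\<^sub>F N in sequentially. l N ^ N / l N ^ m = l N ^ (N - m)"
        using order_tendstoD(1)[OF l1, of 0, simplified] eventually_ge_at_top[of m]
        by eventually_elim (auto simp: power_diff)
      ultimately show ?thesis by (simp add: Lim_transform_eventually)
    qed
    have "(\<lambda>N. ((\<Sum>q\<in>S. kpow S (T (\<theta> N)) (N - m) o0 q * V (\<theta> N) q)
        - of_real (l N) ^ (N - m) * V (\<theta> N) o0) + of_real (l N ^ (N - m)) * V (\<theta> N) o0
        + (\<Sum>q\<in>S. kpow S (T (\<theta> N)) (N - m) o0 q * (1 - V (\<theta> N) q)))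
        \<longlonglongrightarrow> 0 + of_real (exp (- \<kappa> * x\<^sup>2)) * 1 + 0"
      by (intro tendsto_add b1 b2 tendsto_mult tendsto_of_real lN Vone o0)
    then show ?thesis
      by (simp add: \<theta>_def[symmetric] right_diff_distrib sum_subtractf)
  qed
  have "(\<lambda>N. kpow S (T (x / sqrt (real N))) N o0 o0) \<longlonglongrightarrow> of_real (\<pi> o0 * exp (- \<kappa> * x\<^sup>2))" for x
  proof (rule LIMSEQ_I)
    fix r :: real assume r: "r > 0"
    obtain m where m: "\<And>p. p \<in> S \<Longrightarrow> \<bar>kpow S P m p o0 - \<pi> o0\<bar> < r / 3"
      using mixing[OF o0, of "r / 3"] r by auto
    define K where "K N = T (x / sqrt (real N))" for N
    define R where "R N = (\<Sum>q\<in>S. kpow S (K N) (N - m) o0 q)" for N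
    have "\<forall>\<^sub>F N in sequentially. \<forall>q\<in>S. norm (kpow S (K N) m q o0 - of_real (kpow S P m q o0)) < r / 3"
      unfolding K_def dist_norm[symmetric] using r
      by (intro eventually_ball_finite finS ballI tendstoD Tn0 o0) auto
    moreover have "\<forall>\<^sub>F N in sequentially. norm (of_real (\<pi> o0) * R N - of_real (\<pi> o0 * exp (- \<kappa> * x\<^sup>2))) < r / 3"
      using tendstoD[OF tendsto_mult[OF tendsto_const[of "of_real (\<pi> o0)"] rows[of x m]], of "r / 3"] r
      unfolding R_def K_def dist_norm of_real_mult by simp
    ultimately have "\<forall>\<^sub>F N in sequentially.
        norm (kpow S (K N) N o0 o0 - of_real (\<pi> o0 * exp (- \<kappa> * x\<^sup>2))) < r"
      using eventually_ge_at_top[of m]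
    proof eventually_elim
      case (elim N)
      have "kpow S (K N) N o0 o0 = (\<Sum>q\<in>S. kpow S (K N) (N - m) o0 q * kpow S (K N) m q o0)"
        using kpow_add[OF finS o0, of "K N" "N - m" m o0] elim by simp
      \<comment> \<open>From every intermediate state the last \<open>m\<close> steps reach
        \<open>o0\<close> with total mass close to \<open>\<pi> o0\<close>. The budget is
        \<open>r / 3\<close> for twisted against untwisted kernel, \<open>r / 3\<close> for mixing
        and \<open>r / 3\<close> for the row sums.\<close>
      then have "kpow S (K N) N o0 o0 - of_real (\<pi> o0) * R N
          = (\<Sum>q\<in>S. kpow S (K N) (N - m) o0 q * (kpow S (K N) m q o0 - of_real (\<pi> o0)))"
        by (simp add: R_def right_diff_distrib sum_subtractf sum_distrib_left mult.commute)
      also have "norm \<dots> \<le> (\<Sum>q\<in>S. kpow S P (N - m) o0 q * (2 * r / 3))"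
      proof (intro sum_norm_le)
        fix q assume q: "q \<in> S"
        have "kpow S (K N) m q o0 - of_real (\<pi> o0)
            = (kpow S (K N) m q o0 - of_real (kpow S P m q o0)) + of_real (kpow S P m q o0 - \<pi> o0)"
          by simp
        also have "norm \<dots> \<le> r / 3 + r / 3"
          using elim q m[OF q] by (intro norm_triangle_le add_mono) (auto simp only: norm_of_real less_imp_le)
        finally have "norm (kpow S (K N) m q o0 - of_real (\<pi> o0)) \<le> 2 * r / 3" by simp
        then show "norm (kpow S (K N) (N - m) o0 q * (kpow S (K N) m q o0 - of_real (\<pi> o0)))
            \<le> kpow S P (N - m) o0 q * (2 * r / 3)"
          unfolding norm_mult K_def
          using kpow_nonneg[OF Pnn o0 q] by (intro mult_mono norm_kpow_le[OF sub o0 q]) auto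
      qed
      also have "\<dots> = 2 * r / 3"
        using kpow_row_sum[of S P o0 "N - m", OF finS Psum o0] by (simp only: sum_distrib_right[symmetric])
      finally show ?case
        using elim norm_triangle_ineq[of "kpow S (K N) N o0 o0 - of_real (\<pi> o0) * R N"
            "of_real (\<pi> o0) * R N - of_real (\<pi> o0 * exp (- \<kappa> * x\<^sup>2))"]
        by simp
    qed
    then show "\<exists>no. \<forall>n\<ge>no. norm (kpow S (T (x / sqrt (real n))) n o0 o0 - of_real (\<pi> o0 * exp (- \<kappa> * x\<^sup>2))) < r"
      by (simp add: K_def eventually_sequentially)
  qed
  then show thesis by (rule that)
qed

end

section \<open>Fourier inversion\<close>

text \<open>Orthogonality of characters over a full period, stretched by \<open>R\<close>: for
  nonzero \<open>k\<close> the primitive takes equal values at both ends, because the angles there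
  differ by \<open>2 * pi * k\<close>.\<close>

lemma lborel_integral_cis_int:
  fixes k :: int and R :: real
  assumes "R > 0"
  shows "integral\<^sup>L lborel (\<lambda>x. indicator {- pi * R .. pi * R} x *\<^sub>R cis (k * x / R))
    = (if k = 0 then of_real (2 * pi * R) else 0)"
proof (cases "k = 0")
  case True
  have "integral\<^sup>L lborel (\<lambda>x. indicator {- pi * R .. pi * R} x *\<^sub>R (1::complex)) = pi * R - (- pi * R)"
    using assms has_vector_derivative_of_real[of "\<lambda>x. x" 1]
    by (subst integral_FTC_atLeastAtMost[where F = "\<lambda>x. of_real x"]) auto
  then show ?thesis using True by simp
next
  case False
  define a where "a = \<i> * of_real (k / R)"
  have a: "a \<noteq> 0" using False assms by (simp add: a_def)
  have cis_a: "cis (k * x / R) = exp (a * of_real x)" for x :: real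
    by (simp add: a_def cis_conv_exp mult.assoc)
  define F where "F x = exp (a * of_real x) / a" for x :: real
  have ftc: "integral\<^sup>L lborel (\<lambda>x. indicator {- pi * R .. pi * R} x *\<^sub>R exp (a * of_real x))
      = F (pi * R) - F (- pi * R)"
  proof (rule integral_FTC_atLeastAtMost)
    show "- pi * R \<le> pi * R" using assms by simp
    show "(F has_vector_derivative exp (a * of_real x)) (at x within {- pi * R..pi * R})" for x
      unfolding F_def
      by (rule has_vector_derivative_real_field[of "\<lambda>z. exp (a * z) / a"])
        (use a in \<open>auto intro!: derivative_eq_intros\<close>)
    show "continuous_on {- pi * R..pi * R} (\<lambda>x. exp (a * complex_of_real x))"
      by (intro continuous_intros)
  qed
  have "cis (k * (pi * R) / R) = cis (k * (- pi * R) / R)"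
  proof -
    have "cis (k * (pi * R) / R) = cis (k * (- pi * R) / R) * cis (2 * pi * k)"
      using assms by (simp add: cis_mult field_simps)
    also have "cis (2 * pi * k) = 1" by (rule cis_multiple_2pi) simp
    finally show ?thesis by simp
  qed
  then have "F (pi * R) - F (- pi * R) = 0" by (simp only: F_def cis_a) simp
  then show ?thesis using False ftc by (simp only: cis_a if_False)
qed

text \<open>Obtained from the characteristic function of the standard normal law by the substitution
  with factor \<open>s = sqrt (2 * \<kappa>)\<close>.\<close>

lemma lborel_integral_gaussian_cis:
  fixes \<kappa> \<tau> :: real
  assumes "\<kappa> > 0"
  shows "integral\<^sup>L lborel (\<lambda>x. of_real (exp (- \<kappa> * x\<^sup>2)) * cis (- x * \<tau>))
    = of_real (sqrt (pi / \<kappa>) * exp (- \<tau>\<^sup>2 / (4 * \<kappa>)))"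
proof -
  define s where "s = sqrt (2 * \<kappa>)"
  have s: "s > 0" "s\<^sup>2 = 2 * \<kappa>" using assms by (auto simp: s_def)
  define t where "t = - \<tau> / s"
  have "char std_normal_distribution t = integral\<^sup>L lborel (\<lambda>x. std_normal_density x *\<^sub>R iexp (t * x))"
    unfolding char_def by (subst integral_density) auto
  also have "\<dots> = \<bar>s\<bar> *\<^sub>R integral\<^sup>L lborel (\<lambda>x. std_normal_density (0 + s * x) *\<^sub>R iexp (t * (0 + s * x)))"
    using s by (intro lborel_integral_real_affine) auto
  also have "(\<lambda>x. std_normal_density (0 + s * x) *\<^sub>R iexp (t * (0 + s * x)))
     = (\<lambda>x. of_real (1 / sqrt (2 * pi)) * (of_real (exp (- \<kappa> * x\<^sup>2)) * cis (- x * \<tau>)))"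
  proof
    fix x
    have "- (s * x)\<^sup>2 / 2 = - \<kappa> * x\<^sup>2" using s by (simp add: power_mult_distrib)
    moreover have "t * (s * x) = - x * \<tau>" using s by (simp add: t_def)
    ultimately show "std_normal_density (0 + s * x) *\<^sub>R iexp (t * (0 + s * x))
     = of_real (1 / sqrt (2 * pi)) * (of_real (exp (- \<kappa> * x\<^sup>2)) * cis (- x * \<tau>))"
      by (simp add: normal_density_def cis_conv_exp scaleR_conv_of_real)
  qed
  also have "integral\<^sup>L lborel \<dots> = of_real (1 / sqrt (2 * pi))
      * integral\<^sup>L lborel (\<lambda>x. of_real (exp (- \<kappa> * x\<^sup>2)) * cis (- x * \<tau>))"
    by (rule integral_mult_right_zero)
  finally have e: "of_real (exp (- t\<^sup>2 / 2)) = of_real (s / sqrt (2 * pi))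
      * integral\<^sup>L lborel (\<lambda>x. of_real (exp (- \<kappa> * x\<^sup>2)) * cis (- x * \<tau>))"
    using s by (simp add: char_std_normal_distribution scaleR_conv_of_real)
  have "t\<^sup>2 / 2 = \<tau>\<^sup>2 / (4 * \<kappa>)" using s assms by (simp add: t_def power_divide)
  moreover have "sqrt (2 * pi) / s = sqrt (pi / \<kappa>)"
    unfolding s_def real_sqrt_divide[symmetric] by simp
  moreover have "integral\<^sup>L lborel (\<lambda>x. of_real (exp (- \<kappa> * x\<^sup>2)) * cis (- x * \<tau>))
      = of_real (sqrt (2 * pi) / s * exp (- t\<^sup>2 / 2))"
  proof -
    have "of_real E = of_real c * I \<Longrightarrow> c \<noteq> 0 \<Longrightarrow> I = of_real (E / c)" for E c :: real and I :: complex
      by simp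
    from this[OF e] s show ?thesis by (simp add: field_simps)
  qed
  ultimately show ?thesis by simp
qed

text \<open>Taylor expansion gives cos x \<le> 1 - x^2/2 + x^4/24, and x^2 \<le> 10 on this interval
  since pi^2 < 10. The constant is 1/2 - 10/24 = 1/12.\<close>

lemma one_minus_cos_ge:
  fixes x :: real
  assumes "\<bar>x\<bar> \<le> pi"
  shows "1 - cos x \<ge> x\<^sup>2 / 12"
proof -
  define D where "D = iexp x - (\<Sum>k\<le>3. (\<i> * x) ^ k / fact k)"
  have "cmod D \<le> \<bar>x\<bar> ^ Suc 3 / fact (Suc 3)"
    unfolding D_def by (rule iexp_approx1)
  then have "cmod D \<le> x ^ 4 / 24" by (simp add: fact_numeral power_even_abs)
  moreover have "Re D = cos x - (1 - x\<^sup>2 / 2)"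
    unfolding D_def by (simp add: numeral_3_eq_3 Re_exp power2_eq_square Re_divide_of_nat)
  ultimately have "cos x \<le> 1 - x\<^sup>2 / 2 + x ^ 4 / 24"
    using abs_Re_le_cmod[of D] by linarith
  moreover have "x ^ 4 \<le> 10 * x\<^sup>2"
  proof -
    have "pi\<^sup>2 \<le> 3.15\<^sup>2" using pi_approx by (intro power_mono) auto
    then have "x\<^sup>2 \<le> 10"
      using power_mono[OF assms, of 2] by (simp add: power2_eq_square)
    then have "x\<^sup>2 * x\<^sup>2 \<le> 10 * x\<^sup>2" by (intro mult_right_mono) auto
    then show ?thesis by (simp add: power4_eq_xxxx power2_eq_square mult.assoc)
  qed
  ultimately show ?thesis by linarith
qed

text \<open>\<open>R N\<close> is the characteristic function of \<open>X\<close> under the uniform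
  law on \<open>W N\<close>. Stretching the inversion integral by sqrt N produces the factor in the
  claim. As the bound holds at all angles up to pi, one Gaussian dominates the whole integrand, and
  no separate estimate away from 0 is required.\<close>

lemma local_limit_fourier:
  fixes W :: "nat \<Rightarrow> 'l set" and X :: "'l \<Rightarrow> real" and c C \<kappa> :: real
  defines "R N \<theta> \<equiv> (\<Sum>l\<in>W N. cis (\<theta> * X l)) / of_nat (card (W N))"
  assumes fin: "\<And>N. finite (W N)"
    and int: "\<And>N l. l \<in> W N \<Longrightarrow> X l \<in> \<int>"
    and bound: "\<And>N \<theta>. \<bar>\<theta>\<bar> \<le> pi \<Longrightarrow> norm (R N \<theta>) \<le> C * exp (- c * N * \<theta>\<^sup>2)"
    and lim: "\<And>x. (\<lambda>N. R N (x / sqrt (real N))) \<longlonglongrightarrow> of_real (exp (- \<kappa> * x\<^sup>2))"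
    and "\<kappa> > 0" "c > 0" "C \<ge> 0"
    and t: "(\<lambda>N. of_int (t N) / sqrt (real N)) \<longlonglongrightarrow> \<tau>"
  shows "(\<lambda>N. sqrt (real N) * (card {l \<in> W N. X l = of_int (t N)} / card (W N)))
    \<longlonglongrightarrow> 1 / (2 * sqrt (pi * \<kappa>)) * exp (- 1 / (4 * \<kappa>) * \<tau>\<^sup>2)"
proof -
  define f where "f N x = indicator {- pi * sqrt N .. pi * sqrt N} x *\<^sub>R
      (R N (x / sqrt (real N)) * cis (- x * (t N / sqrt N)))" for N x
  define g where "g x = of_real (exp (- \<kappa> * x\<^sup>2)) * cis (- x * \<tau>)" for x
  \<comment> \<open>Inversion formula: by orthogonality only the elements with
    \<open>X l = t N\<close> contribute, each with the full length of the interval.\<close>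
  have int_f: "integral\<^sup>L lborel (f N) = 2 * pi * sqrt N * (card {l \<in> W N. X l = of_int (t N)} / card (W N))"
    if N: "N \<ge> 1" for N
  proof -
    have f_eq: "f N = (\<lambda>x. \<Sum>l\<in>W N. (indicator {- pi * sqrt N .. pi * sqrt N} x *\<^sub>R
        cis (of_int (\<lfloor>X l\<rfloor> - t N) * x / sqrt N)) / of_nat (card (W N)))"
    proof
      fix x
      have "cis (of_int (\<lfloor>X l\<rfloor> - t N) * x / sqrt N) = cis (x / sqrt N * X l) * cis (- x * (t N / sqrt N))"
        if "l \<in> W N" for l
        using int[OF that] by (auto simp: cis_mult elim!: Ints_cases simp: algebra_simps diff_divide_distrib)
      then have e: "(\<Sum>l\<in>W N. cis (x / sqrt N * X l)) * cis (- x * (t N / sqrt N))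
          = (\<Sum>l\<in>W N. cis (of_int (\<lfloor>X l\<rfloor> - t N) * x / sqrt N))"
        unfolding sum_distrib_right by simp
      have R_e: "R N (x / sqrt N) * cis (- x * (t N / sqrt N))
          = (\<Sum>l\<in>W N. cis (of_int (\<lfloor>X l\<rfloor> - t N) * x / sqrt N)) / of_nat (card (W N))"
        unfolding R_def e[symmetric] by simp
      show "f N x = (\<Sum>l\<in>W N. (indicator {- pi * sqrt N .. pi * sqrt N} x *\<^sub>R
        cis (of_int (\<lfloor>X l\<rfloor> - t N) * x / sqrt N)) / of_nat (card (W N)))"
        unfolding f_def R_e by (simp only: scaleR_conv_of_real sum_distrib_left sum_divide_distrib times_divide_eq_right)
    qed
    have "integral\<^sup>L lborel (f N) = (\<Sum>l\<in>W N. integral\<^sup>L lborel (\<lambda>x.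
        (indicator {- pi * sqrt N .. pi * sqrt N} x *\<^sub>R
        cis (of_int (\<lfloor>X l\<rfloor> - t N) * x / sqrt N)) / of_nat (card (W N))))"
      unfolding f_eq
    proof (intro Bochner_Integration.integral_sum integrable_divide)
      fix l
      have "set_integrable lborel {- pi * sqrt N .. pi * sqrt N} (\<lambda>x. cis (of_int (\<lfloor>X l\<rfloor> - t N) * x / sqrt N))"
        using N by (intro borel_integrable_atLeastAtMost' continuous_intros) auto
      then show "integrable lborel (\<lambda>x. indicator {- pi * sqrt N .. pi * sqrt N} x *\<^sub>R
        cis (of_int (\<lfloor>X l\<rfloor> - t N) * x / sqrt N))" by (simp add: set_integrable_def)
    qed
    also have "\<dots> = (\<Sum>l\<in>W N. if \<lfloor>X l\<rfloor> = t N then of_real (2 * pi * sqrt N) / of_nat (card (W N)) else 0)"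
    proof (rule sum.cong[OF refl])
      fix l
      have "sqrt N > 0" using N by simp
      from lborel_integral_cis_int[OF this, of "\<lfloor>X l\<rfloor> - t N"]
      show "integral\<^sup>L lborel (\<lambda>x. (indicator {- pi * sqrt N .. pi * sqrt N} x *\<^sub>R
        cis (of_int (\<lfloor>X l\<rfloor> - t N) * x / sqrt N)) / of_nat (card (W N)))
        = (if \<lfloor>X l\<rfloor> = t N then of_real (2 * pi * sqrt N) / of_nat (card (W N)) else 0)"
        unfolding integral_divide_zero by (simp only: if_distrib[of "\<lambda>z. z / _"] right_minus_eq div_0)
    qed
    also have "\<dots> = (\<Sum>l\<in>{l \<in> W N. X l = t N}. of_real (2 * pi * sqrt N) / of_nat (card (W N)))"
    proof (rule sum.mono_neutral_cong_right)
      have "\<lfloor>X l\<rfloor> = t N \<longleftrightarrow> X l = t N" if "l \<in> W N" for l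
        using int[OF that] by (auto elim!: Ints_cases)
      then show "\<forall>l\<in>W N - {l \<in> W N. X l = t N}.
          (if \<lfloor>X l\<rfloor> = t N then of_real (2 * pi * sqrt N) / of_nat (card (W N)) else 0) = (0::complex)" by auto
    qed (use fin in auto)
    finally show ?thesis by simp
  qed
  have cis_measurable [measurable]: "cis \<in> borel_measurable borel"
    by (intro borel_measurable_continuous_onI continuous_intros)
  have mf: "f N \<in> borel_measurable lborel" for N
    unfolding f_def R_def by measurable
  have mg: "g \<in> borel_measurable lborel" unfolding g_def by measurable
  have "(\<lambda>N. integral\<^sup>L lborel (f N)) \<longlonglongrightarrow> integral\<^sup>L lborel g"
  proof (rule integral_dominated_convergence)
    show "integrable lborel (\<lambda>x. C * exp (- c * x\<^sup>2))"
    proof -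
      have "integrable lborel (\<lambda>x. normal_density 0 (sqrt (1 / (2 * c))) x * (C * sqrt (2 * pi * (1 / (2 * c)))))"
        using \<open>c > 0\<close> by (intro integrable_mult_left integrable_normal_density) auto
      moreover have "normal_density 0 (sqrt (1 / (2 * c))) x * (C * sqrt (2 * pi * (1 / (2 * c)))) = C * exp (- c * x\<^sup>2)" for x
        using \<open>c > 0\<close> by (simp add: normal_density_def real_sqrt_divide real_sqrt_mult field_simps)
      ultimately show ?thesis by (simp only:)
    qed
    show "AE x in lborel. norm (f N x) \<le> C * exp (- c * x\<^sup>2)" for N
    proof (intro AE_I2)
      fix x
      show "norm (f N x) \<le> C * exp (- c * x\<^sup>2)"
      proof (cases "x \<in> {- pi * sqrt N .. pi * sqrt N}")
        case True
        then have "\<bar>x / sqrt N\<bar> \<le> pi" by (cases "N = 0") (auto simp: field_simps abs_le_iff)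
        from bound[OF this, of N] True show ?thesis
          by (cases "N = 0") (auto simp: f_def norm_mult power_divide)
      next
        case False
        then show ?thesis using \<open>C \<ge> 0\<close> by (simp add: f_def)
      qed
    qed
    show "AE x in lborel. (\<lambda>N. f N x) \<longlonglongrightarrow> g x"
    proof (intro AE_I2)
      fix x
      have "(\<lambda>N. R N (x / sqrt (real N)) * cis (- x * (t N / sqrt N))) \<longlonglongrightarrow> g x"
        unfolding g_def cis_conv_exp by (intro tendsto_mult lim tendsto_exp tendsto_of_real tendsto_const tendsto_minus t)
      moreover have "\<forall>\<^sub>F N in sequentially. R N (x / sqrt (real N)) * cis (- x * (t N / sqrt N)) = f N x"
      proof -
        have "\<forall>\<^sub>F N in sequentially. pi * sqrt (real N) \<ge> \<bar>x\<bar>" by real_asymp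
        then show ?thesis by eventually_elim (auto simp: f_def indicator_def)
      qed
      ultimately show "(\<lambda>N. f N x) \<longlonglongrightarrow> g x" by (rule Lim_transform_eventually)
    qed
  qed (use mf mg in auto)
  then have "(\<lambda>N. Re (integral\<^sup>L lborel (f N)) / (2 * pi)) \<longlonglongrightarrow> Re (integral\<^sup>L lborel g) / (2 * pi)"
    by (intro tendsto_intros) auto
  also have "Re (integral\<^sup>L lborel g) / (2 * pi) = 1 / (2 * sqrt (pi * \<kappa>)) * exp (- 1 / (4 * \<kappa>) * \<tau>\<^sup>2)"
  proof -
    have "sqrt (pi / \<kappa>) / pi = 1 / sqrt (pi * \<kappa>)"
      using \<open>\<kappa> > 0\<close> by (simp add: real_sqrt_divide real_sqrt_mult field_simps)
    then show ?thesis
      unfolding g_def lborel_integral_gaussian_cis[OF \<open>\<kappa> > 0\<close>] Re_complex_of_real by (simp add: field_simps)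
  qed
  finally show ?thesis
    by (rule Lim_transform_eventually)
      (use eventually_ge_at_top[of 1] in \<open>eventually_elim, simp add: int_f\<close>)
qed

section \<open>Weighted walks\<close>

lemma norm_cis_expansion_le:
  "norm (cis x - (1 + \<i> * of_real x - (of_real x)\<^sup>2 / 2)) \<le> \<bar>x\<bar> ^ 3 / 6"
proof -
  have "(\<Sum>k\<le>2. (\<i> * complex_of_real x) ^ k / fact k) = 1 + \<i> * of_real x - (of_real x)\<^sup>2 / 2"
  proof -
    have "{..2 :: nat} = {0, 1, 2}" by auto
    then show ?thesis by (simp add: power_mult_distrib)
  qed
  moreover have "fact (Suc 2) = (6 :: real)" by (simp add: eval_nat_numeral)
  moreover have "Suc 2 = 3" by simp
  ultimately show ?thesis
    using iexp_approx1[of x 2] by (simp only: cis_conv_exp)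
qed

text \<open>With y = |1 + cis x| one has y^2 = 2 + 2 cos x, and 4 y \<le> y^2 + 4 makes the bound
  linear in cos x.\<close>

lemma norm_add_cis_le: "norm (cis a + cis (a + x)) \<le> 2 - (1 - cos x) / 2"
proof -
  have "(norm (1 + cis x))\<^sup>2 = 2 + 2 * cos x"
    using sin_cos_squared_add[of x] by (simp add: cmod_power2 power2_sum)
  moreover have "0 \<le> (norm (1 + cis x) - 2)\<^sup>2" by simp
  ultimately have "4 * norm (1 + cis x) \<le> 6 + 2 * cos x"
    by (simp add: power2_diff)
  moreover have "cis a + cis (a + x) = cis a * (1 + cis x)"
    by (simp add: cis_mult distrib_left)
  then have "norm (cis a + cis (a + x)) = norm (1 + cis x)" by (simp only: norm_mult norm_cis mult_1)
  ultimately show ?thesis by (simp add: field_simps)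
qed

text \<open>Abstract transfer matrix: vertices are plugs, \<open>F p q\<close> holds the floors
  between two plugs, \<open>om\<close> is their weight and \<open>rv\<close> the reflection. By
  \<open>disjF\<close> a floor and its source determine the target, so a walk is faithfully recorded
  by its list of floors.\<close>

locale floor_walks =
  fixes S :: "'p set" and o0 :: 'p and F :: "'p \<Rightarrow> 'p \<Rightarrow> 's set" and om :: "'s \<Rightarrow> real"
    and rv :: "'s \<Rightarrow> 's"
  assumes finS: "finite S" and o0: "o0 \<in> S" and finF: "\<And>p q. finite (F p q)"
    and disjF: "\<And>p q q' s. s \<in> F p q \<Longrightarrow> s \<in> F p q' \<Longrightarrow> q = q'"
    and rvF: "\<And>p q s. s \<in> F p q \<Longrightarrow> rv s \<in> F q p"
    and rv_rv: "\<And>p q s. s \<in> F p q \<Longrightarrow> rv (rv s) = s"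
    and om_rv: "\<And>p q s. s \<in> F p q \<Longrightarrow> om (rv s) = - om s"
begin

primrec walks :: "nat \<Rightarrow> 'p \<Rightarrow> 'p \<Rightarrow> 's list set" where
  "walks 0 = (\<lambda>p q. if p = q then {[]} else {})"
| "walks (Suc n) = (\<lambda>p q. \<Union>r\<in>S. (\<lambda>(s, l). s # l) ` (F p r \<times> walks n r q))"

lemma walks_Suc_iff:
  "l \<in> walks (Suc n) p q \<longleftrightarrow> (\<exists>r\<in>S. \<exists>s\<in>F p r. \<exists>l'\<in>walks n r q. l = s # l')"
  by auto

definition weight :: "'s list \<Rightarrow> real" where "weight l = sum_list (map om l)"

lemma weight_simps [simp]: "weight [] = 0" "weight (s # l) = om s + weight l"
  "weight (l @ l') = weight l + weight l'"
  by (simp_all add: weight_def)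

lemma finite_walks: "finite (walks n p q)"
  by (induction n arbitrary: p) (auto simp: finS finF)

lemma sum_walks_Suc:
  "(\<Sum>l\<in>walks (Suc n) p q. f l) = (\<Sum>r\<in>S. \<Sum>s\<in>F p r. \<Sum>l\<in>walks n r q. f (s # l))"
proof -
  have "(\<Sum>l\<in>walks (Suc n) p q. f l) = (\<Sum>r\<in>S. \<Sum>l\<in>(\<lambda>(s, l). s # l) ` (F p r \<times> walks n r q). f l)"
    unfolding walks.simps
    by (rule sum.UNION_disjoint) (auto simp: finS finF finite_walks dest: disjF)
  also have "\<dots> = (\<Sum>r\<in>S. \<Sum>(s, l)\<in>F p r \<times> walks n r q. f (s # l))"
    by (intro sum.cong refl, subst sum.reindex) (auto simp: inj_on_def intro!: sum.cong)
  finally show ?thesis by (simp add: sum.cartesian_product)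
qed

definition kernel :: "real \<Rightarrow> 'p \<Rightarrow> 'p \<Rightarrow> complex" where
  "kernel \<theta> p q = (\<Sum>s\<in>F p q. cis (\<theta> * om s))"

text \<open>This makes matrix powers the unnormalised characteristic functions of the weight of a
  walk.\<close>

lemma kpow_kernel: "kpow S (kernel \<theta>) n p q = (\<Sum>l\<in>walks n p q. cis (\<theta> * weight l))"
proof (induction n arbitrary: p)
  case (Suc n)
  then show ?case
    by (simp add: sum_walks_Suc kernel_def sum_distrib_left sum_distrib_right cis_mult distrib_left del: walks.simps)
qed simp

abbreviation adj :: "'p \<Rightarrow> 'p \<Rightarrow> real" where "adj p q \<equiv> real (card (F p q))"

lemma kpow_adj: "kpow S adj n p q = real (card (walks n p q))"
proof -
  have k0: "kernel 0 = (\<lambda>p q. of_real (adj p q))" by (intro ext) (simp add: kernel_def)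
  have "complex_of_real (kpow S adj n p q) = kpow S (kernel 0) n p q" by (simp only: k0 kpow_of_real)
  also have "\<dots> = of_real (real (card (walks n p q)))" by (simp add: kpow_kernel)
  finally have "complex_of_real (kpow S adj n p q) = of_real (real (card (walks n p q)))" .
  then show ?thesis by (simp only: of_real_eq_iff)
qed

lemma norm_kernel_le: "norm (kernel \<theta> p q) \<le> adj p q"
  unfolding kernel_def by (rule order_trans[OF sum_norm_le[of _ _ "\<lambda>_. 1"]]) auto

lemma bij_rv: "bij_betw rv (F p q) (F q p)"
  by (rule bij_betw_byWitness[where f' = rv]) (auto simp: rv_rv rvF)

lemma adj_sym: "adj p q = adj q p"
  using bij_betw_same_card[OF bij_rv[of p q]] by simp

lemma sum_om_antisym: "(\<Sum>s\<in>F q p. om s) = - (\<Sum>s\<in>F p q. om s)"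
  by (subst sum.reindex_bij_betw[OF bij_rv, symmetric]) (simp add: om_rv sum_negf)

lemma walks_append:
  assumes "l \<in> walks m p r" "l' \<in> walks n r q" 
  shows "l @ l' \<in> walks (m + n) p q"
  using assms(1)
proof (induction m arbitrary: p l)
  case (Suc m)
  then show ?case unfolding add_Suc walks_Suc_iff by fastforce
qed (use assms(2) in \<open>auto split: if_splits\<close>)

lemma walks_rev:
  assumes "l \<in> walks n p q" "p \<in> S"
  shows "rev (map rv l) \<in> walks n q p" "weight (rev (map rv l)) = - weight l"
proof -
  have "rev (map rv l) \<in> walks n q p \<and> weight (rev (map rv l)) = - weight l"
    using assms
  proof (induction n arbitrary: p l)
    case (Suc n)
    then obtain s l' r where l: "l = s # l'" "r \<in> S" "s \<in> F p r" "l' \<in> walks n r q" by auto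
    have "[rv s] \<in> walks 1 r p" using l(3) Suc.prems by (auto intro!: rvF)
    then show ?case using walks_append[of "rev (map rv l')" n q r "[rv s]" 1 p] Suc.IH[OF l(4,2)] l om_rv
      by (auto simp del: walks.simps)
  qed (auto split: if_splits)
  then show "rev (map rv l) \<in> walks n q p" "weight (rev (map rv l)) = - weight l" by auto
qed

definition wk :: "nat \<Rightarrow> 'p \<Rightarrow> 'p \<Rightarrow> real \<Rightarrow> bool" where
  "wk n p q w \<longleftrightarrow> (\<exists>l\<in>walks n p q. weight l = w)"

lemma wk_append:
  assumes "wk m p r w" "wk n r q w'"
  shows "wk (m + n) p q (w + w')"
proof -
  obtain l l' where "l \<in> walks m p r" "weight l = w" "l' \<in> walks n r q" "weight l' = w'"
    using assms unfolding wk_def by blast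
  then show ?thesis unfolding wk_def by (intro bexI[OF _ walks_append]) auto
qed

lemma wk_rev: "wk n p q w \<Longrightarrow> p \<in> S \<Longrightarrow> wk n q p (- w)"
  unfolding wk_def using walks_rev by blast

lemma wk_step: "s \<in> F p q \<Longrightarrow> q \<in> S \<Longrightarrow> wk 1 p q (om s)"
  unfolding wk_def by (intro bexI[of _ "[s]"]) auto

lemma wk_0: "wk 0 p p 0" by (simp add: wk_def)

end

section \<open>Damping of characteristic functions and the local limit theorem for closed
  walks\<close>

locale span_floor_walks = floor_walks +
  fixes n1 M :: nat
  assumes prim: "\<And>n p q. n \<ge> n1 \<Longrightarrow> p \<in> S \<Longrightarrow> q \<in> S \<Longrightarrow> walks n p q \<noteq> {}"
    and span: "\<And>p q. p \<in> S \<Longrightarrow> q \<in> S \<Longrightarrow> \<exists>w. wk M p q w \<and> wk M p q (w + 1)"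
    and M: "M > 0"
    and integral: "\<And>n l. l \<in> walks n o0 o0 \<Longrightarrow> weight l \<in> \<int>"
begin

text \<open>The two walks provided by \<open>span\<close> are out of phase by the angle
  \<open>\<theta>\<close> and lose at least (1 - cos \<theta>)/2 together. As \<open>c\<close>
  bounds all numbers of walks of length \<open>M\<close>, the relative loss is at least this amount
  divided by \<open>c\<close>, which gives \<delta> = 1/(2c).\<close>

lemma span_bound:
  obtains \<delta> where "0 < \<delta>" "\<delta> \<le> 1/2"
    "\<And>\<theta> p q. p \<in> S \<Longrightarrow> q \<in> S \<Longrightarrow>
       norm (kpow S (kernel \<theta>) M p q) \<le> (1 - \<delta> * (1 - cos \<theta>)) * kpow S adj M p q"
proof -
  define c where "c = 1 + (\<Sum>p\<in>S. \<Sum>q\<in>S. kpow S adj M p q)"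
  have nn: "kpow S adj M p q \<ge> 0" for p q by (simp add: kpow_adj)
  have c: "kpow S adj M p q \<le> c" if "p \<in> S" "q \<in> S" for p q
  proof -
    have "kpow S adj M p q \<le> (\<Sum>q\<in>S. kpow S adj M p q)"
      using finS that nn by (intro member_le_sum) auto
    also have "\<dots> \<le> (\<Sum>p\<in>S. \<Sum>q\<in>S. kpow S adj M p q)"
      using finS that nn by (intro member_le_sum[of p S "\<lambda>p. \<Sum>q\<in>S. kpow S adj M p q"]) (auto intro: sum_nonneg)
    finally show ?thesis by (simp add: c_def)
  qed
  have c1: "c \<ge> 1" using nn by (auto simp: c_def intro!: sum_nonneg)
  show thesis
  proof (rule that[of "1 / (2 * c)"])
    fix \<theta> p q assume pq: "p \<in> S" "q \<in> S"
    obtain w where "wk M p q w" "wk M p q (w + 1)" using span[OF pq] by blast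
    then obtain l l' where l: "l \<in> walks M p q" "l' \<in> walks M p q" "weight l' = weight l + 1"
      unfolding wk_def by auto
    then have "l \<noteq> l'" by auto
    let ?W = "walks M p q"
    have "kpow S (kernel \<theta>) M p q = (\<Sum>k\<in>?W - {l, l'}. cis (\<theta> * weight k)) + (\<Sum>k\<in>{l, l'}. cis (\<theta> * weight k))"
      unfolding kpow_kernel using l finite_walks by (intro sum.subset_diff) auto
    also have "norm \<dots> \<le> real (card (?W - {l, l'})) + (2 - (1 - cos \<theta>) / 2)"
    proof (intro norm_triangle_le add_mono)
      show "norm (\<Sum>k\<in>?W - {l, l'}. cis (\<theta> * weight k)) \<le> real (card (?W - {l, l'}))"
        by (rule order_trans[OF sum_norm_le[of _ _ "\<lambda>_. 1"]]) auto
      show "norm (\<Sum>k\<in>{l, l'}. cis (\<theta> * weight k)) \<le> 2 - (1 - cos \<theta>) / 2"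
        using norm_add_cis_le[of "\<theta> * weight l" \<theta>] \<open>l \<noteq> l'\<close> l by (simp add: distrib_left)
    qed
    also have "real (card (?W - {l, l'})) = real (card ?W) - 2"
    proof -
      have "card (?W - {l, l'}) = card ?W - 2" "card {l, l'} \<le> card ?W"
        using l \<open>l \<noteq> l'\<close> card_mono[OF finite_walks, of "{l, l'}" M p q] by (auto simp: card_Diff_subset)
      then show ?thesis using \<open>l \<noteq> l'\<close> by simp
    qed
    finally have "norm (kpow S (kernel \<theta>) M p q) \<le> kpow S adj M p q - (1 - cos \<theta>) / 2"
      by (simp add: kpow_adj)
    also have "\<dots> \<le> (1 - 1 / (2 * c) * (1 - cos \<theta>)) * kpow S adj M p q"
    proof -
      have "(1 - cos \<theta>) * kpow S adj M p q \<le> (1 - cos \<theta>) * c"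
        using c[OF pq] by (intro mult_left_mono) auto
      then show ?thesis using c1 by (simp add: field_simps)
    qed
    finally show "norm (kpow S (kernel \<theta>) M p q) \<le> (1 - 1 / (2 * c) * (1 - cos \<theta>)) * kpow S adj M p q" .
  qed (use c1 in \<open>auto simp: field_simps\<close>)
qed

text \<open>\<open>N div M\<close> blocks each lose the factor of \<open>span_bound\<close>, which
  is at most exp(-a \<theta>^2) with a = \<delta>/12. The prefactor
  \<open>exp (a * pi\<^sup>2)\<close> pays for the incomplete last block.\<close>

lemma char_bound:
  obtains c C :: real where "c > 0" "C \<ge> 1"
    "\<And>\<theta> N. \<bar>\<theta>\<bar> \<le> pi \<Longrightarrow>
       norm (kpow S (kernel \<theta>) N o0 o0) \<le> C * exp (- c * N * \<theta>\<^sup>2) * kpow S adj N o0 o0"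
proof -
  obtain \<delta> where d: "0 < \<delta>" "\<delta> \<le> 1/2"
    "\<And>\<theta> p q. p \<in> S \<Longrightarrow> q \<in> S \<Longrightarrow>
       norm (kpow S (kernel \<theta>) M p q) \<le> (1 - \<delta> * (1 - cos \<theta>)) * kpow S adj M p q"
    using span_bound by blast
  have b0: "0 \<le> 1 - \<delta> * (1 - cos \<theta>)" for \<theta>
  proof -
    have "\<delta> * (1 - cos \<theta>) \<le> 1/2 * 2" using d(1,2) by (intro mult_mono) auto
    then show ?thesis by simp
  qed
  have blocks: "norm (kpow S (kernel \<theta>) (M * k + r) p q)
      \<le> (1 - \<delta> * (1 - cos \<theta>)) ^ k * kpow S adj (M * k + r) p q" if "p \<in> S" "q \<in> S" for \<theta> k r p q
    using that(1)
  proof (induction k arbitrary: p)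
    case 0
    then show ?case using norm_kpow_le[OF norm_kernel_le _ that(2)] by simp
  next
    case (Suc k)
    let ?b = "1 - \<delta> * (1 - cos \<theta>)"
    have "kpow S (kernel \<theta>) (M * Suc k + r) p q
        = (\<Sum>s\<in>S. kpow S (kernel \<theta>) M p s * kpow S (kernel \<theta>) (M * k + r) s q)"
      using kpow_add[OF finS Suc.prems, of "kernel \<theta>" M "M * k + r" q] by (simp add: add.assoc)
    also have "norm \<dots> \<le> (\<Sum>s\<in>S. (?b * kpow S adj M p s) * (?b ^ k * kpow S adj (M * k + r) s q))"
    proof (rule sum_norm_le)
      fix s assume s: "s \<in> S"
      show "norm (kpow S (kernel \<theta>) M p s * kpow S (kernel \<theta>) (M * k + r) s q)
          \<le> (?b * kpow S adj M p s) * (?b ^ k * kpow S adj (M * k + r) s q)"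
        unfolding norm_mult using b0[of \<theta>]
        by (intro mult_mono d(3) Suc.prems Suc.IH s mult_nonneg_nonneg) (simp_all add: kpow_adj)
    qed
    also have "\<dots> = ?b ^ Suc k * (\<Sum>s\<in>S. kpow S adj M p s * kpow S adj (M * k + r) s q)"
      by (simp add: sum_distrib_left mult_ac)
    also have "(\<Sum>s\<in>S. kpow S adj M p s * kpow S adj (M * k + r) s q) = kpow S adj (M * Suc k + r) p q"
      using kpow_add[OF finS Suc.prems, of adj M "M * k + r" q] by (simp add: add.assoc)
    finally show ?case .
  qed
  define a where "a = \<delta> / 12"
  have a: "a > 0" using d by (simp add: a_def)
  show thesis
  proof (rule that[of "a / M" "exp (a * pi\<^sup>2)"])
    fix \<theta> :: real and N :: nat assume th: "\<bar>\<theta>\<bar> \<le> pi"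
    let ?b = "1 - \<delta> * (1 - cos \<theta>)"
    have "?b \<le> exp (- (\<delta> * (1 - cos \<theta>)))" using exp_ge_add_one_self[of "- (\<delta> * (1 - cos \<theta>))"] by simp
    also have "\<dots> \<le> exp (- (a * \<theta>\<^sup>2))"
      using mult_left_mono[OF one_minus_cos_ge[OF th], of \<delta>] d by (simp add: a_def)
    finally have "?b ^ (N div M) \<le> exp (- (a * \<theta>\<^sup>2)) ^ (N div M)" using b0 by (intro power_mono) auto
    also have "\<dots> = exp (- (real (N div M) * (a * \<theta>\<^sup>2)))" by (simp add: exp_of_nat_mult[symmetric])
    also have "\<dots> \<le> exp (a * pi\<^sup>2 + - (a / M) * N * \<theta>\<^sup>2)"
    proof -
      have "real N / M \<le> real (N div M) + 1"
      proof -
        have "N < M * (N div M + 1)" using dividend_less_times_div[OF M, of N] by simp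
        then have "real N \<le> real (M * (N div M + 1))" by (simp only: of_nat_le_iff less_imp_le)
        then show ?thesis using M by (simp add: field_simps)
      qed
      then have "a * \<theta>\<^sup>2 * (real N / M) \<le> a * \<theta>\<^sup>2 * (real (N div M) + 1)"
        using a by (intro mult_left_mono) auto
      moreover have "a * \<theta>\<^sup>2 \<le> a * pi\<^sup>2"
        using th a power_mono[OF th, of 2] by (intro mult_left_mono) auto
      ultimately show ?thesis by (simp add: algebra_simps)
    qed
    finally have "?b ^ (N div M) \<le> exp (a * pi\<^sup>2) * exp (- (a / M) * N * \<theta>\<^sup>2)" by (simp only: exp_add)
    then have "?b ^ (N div M) * kpow S adj N o0 o0 \<le> exp (a * pi\<^sup>2) * exp (- (a / M) * N * \<theta>\<^sup>2) * kpow S adj N o0 o0"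
      by (intro mult_right_mono) (auto simp: kpow_adj)
    then show "norm (kpow S (kernel \<theta>) N o0 o0) \<le> exp (a * pi\<^sup>2) * exp (- (a / M) * N * \<theta>\<^sup>2) * kpow S adj N o0 o0"
      using blocks[OF o0 o0, of \<theta> "N div M" "N mod M"] by (simp add: mult_div_mod_eq)
  qed (use a M in auto)
qed

text \<open>After conjugation by the Perron vector this is \<open>pinned_clt\<close>. At the entry
  \<open>(o0, o0)\<close> the conjugating factors cancel from the quotient, so the statement
  concerns plain numbers of walks.\<close>

lemma char_limit:
  obtains \<kappa> :: real where
    "\<And>x. (\<lambda>N. kpow S (kernel (x / sqrt (real N))) N o0 o0 / of_real (kpow S adj N o0 o0))
       \<longlonglongrightarrow> of_real (exp (- \<kappa> * x\<^sup>2))"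
proof -
  have ne: "S \<noteq> {}" using o0 by auto
  obtain \<rho> v where v0: "\<And>p. p \<in> S \<Longrightarrow> v p \<ge> 0" and v1: "\<exists>p\<in>S. v p > 0"
    and v: "\<And>p. p \<in> S \<Longrightarrow> (\<Sum>q\<in>S. adj p q * v q) = \<rho> * v p"
    by (rule perron_symmetric[OF finS ne of_nat_0_le_iff adj_sym]) (rule that | assumption)+
  have v_pow: "(\<Sum>q\<in>S. kpow S adj n p q * v q) = \<rho> ^ n * v p" if "p \<in> S" for n p
    using that
  proof (induction n arbitrary: p)
    case 0
    have "(\<Sum>q\<in>S. kpow S adj 0 p q * v q) = (\<Sum>q\<in>S. if q = p then v q else 0)"
      by (intro sum.cong) auto
    then show ?case using finS 0 by simp
  next
    case (Suc n)
    then show ?case unfolding kpow_apply_Suc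
      using v by (simp add: sum_distrib_left[symmetric] mult.left_commute)
  qed
  obtain p1 where p1: "p1 \<in> S" "v p1 > 0" using v1 by blast
  \<comment> \<open>The successor makes the exponent positive, so that a nonzero
    \<open>\<rho> ^ n\<close> forces \<open>\<rho> \<noteq> 0\<close>.\<close>
  define n where "n = Suc n1"
  have kpos: "kpow S adj n p q > 0" if "p \<in> S" "q \<in> S" for p q
    unfolding kpow_adj using prim[of n p q] that finite_walks by (simp add: n_def card_gt_0_iff del: walks.simps)
  \<comment> \<open>Primitivity carries positivity of \<open>v\<close> from the single state
    \<open>p1\<close> to every state.\<close>
  have rv_pos: "\<rho> ^ n * v p > 0" if p: "p \<in> S" for p
  proof -
    have "0 < kpow S adj n p p1 * v p1" using kpos[OF p p1(1)] p1 by simp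
    also have "\<dots> \<le> (\<Sum>q\<in>S. kpow S adj n p q * v q)"
      using finS p1(1) v0 by (intro member_le_sum) (auto simp: kpow_adj)
    finally show ?thesis using v_pow[OF p] by simp
  qed
  have vpos: "v p > 0" if "p \<in> S" for p
    using rv_pos[OF that] v0[OF that] by (metis less_eq_real_def mult_zero_right)
  have vne: "v p \<noteq> 0" if "p \<in> S" for p
    using vpos[OF that] by simp
  have "\<rho> * v p1 \<ge> 0" unfolding v[OF p1(1), symmetric] using v0 by (intro sum_nonneg) auto
  moreover have "\<rho> \<noteq> 0" using rv_pos[OF p1(1)] by (auto simp: n_def)
  ultimately have rho: "\<rho> > 0" using p1 by (simp add: zero_le_mult_iff)
  define P where "P p q = adj p q * v q / (\<rho> * v p)" for p q
  define T where "T \<theta> p q = kernel \<theta> p q * of_real (v q) / (of_real \<rho> * of_real (v p))" for \<theta> p q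
  define Z where "Z = (\<Sum>p\<in>S. (v p)\<^sup>2)"
  have Z: "Z > 0" unfolding Z_def by (rule sum_pos[OF finS ne]) (simp add: vpos less_imp_neq[symmetric])
  define \<pi> where "\<pi> p = (v p)\<^sup>2 / Z" for p
  have P_pow: "kpow S P m p q = kpow S adj m p q * v q / (\<rho> ^ m * v p)" if "p \<in> S" "q \<in> S" for m p q
    unfolding P_def[abs_def] using vne rho that by (intro kpow_conjugate) auto
  have T_pow: "kpow S (T \<theta>) m p q = kpow S (kernel \<theta>) m p q * of_real (v q) / (of_real \<rho> ^ m * of_real (v p))"
    if "p \<in> S" "q \<in> S" for \<theta> m p q
    unfolding T_def[abs_def] using vne rho that by (intro kpow_conjugate) auto
  \<comment> \<open>The smallest entry of the \<open>n\<close>-step matrix, capped at 1. It is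
    positive by primitivity, and \<pi> q \<le> 1 turns it into a Doeblin constant.\<close>
  define \<epsilon> where "\<epsilon> = Min (insert 1 ((\<lambda>(p, q). kpow S P n p q) ` (S \<times> S)))"
  have P_pow_pos: "kpow S P n p q > 0" if "p \<in> S" "q \<in> S" for p q
    using P_pow[OF that] kpos[OF that] vpos that rho by simp
  have eps: "0 < \<epsilon>" "\<epsilon> \<le> 1"
    using finS P_pow_pos by (auto simp: \<epsilon>_def Min_gr_iff)
  have pisum: "(\<Sum>p\<in>S. \<pi> p) = 1" using Z by (simp add: \<pi>_def sum_divide_distrib[symmetric] Z_def[symmetric])
  have pi0: "\<pi> p \<ge> 0" for p using Z by (simp add: \<pi>_def)
  interpret stationary_kernel S P \<pi> n \<epsilon>
  proof
    show "finite S" by (rule finS)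
    show "P p q \<ge> 0" if "p \<in> S" "q \<in> S" for p q using that v0 rho by (simp add: P_def)
    show "(\<Sum>q\<in>S. P p q) = 1" if "p \<in> S" for p
      using v[OF that] vpos[OF that] rho by (simp add: P_def sum_divide_distrib[symmetric])
    show "\<pi> p \<ge> 0" for p by (rule pi0)
    show "(\<Sum>p\<in>S. \<pi> p) = 1" by (rule pisum)
    \<comment> \<open>Symmetry of \<open>adj\<close> makes the chain reversible, which is why the
      stationary law is the normalised square of \<open>v\<close>.\<close>
    show "(\<Sum>p\<in>S. \<pi> p * P p q) = \<pi> q" if q: "q \<in> S" for q
    proof -
      have "(\<Sum>p\<in>S. \<pi> p * P p q) = (\<Sum>p\<in>S. adj q p * v p * (v q / (\<rho> * Z)))"
        using vne by (intro sum.cong refl) (auto simp: \<pi>_def P_def adj_sym[of _ q] power2_eq_square mult_ac)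
      also have "\<dots> = \<pi> q"
        unfolding sum_distrib_right[symmetric] v[OF q] using rho by (simp add: \<pi>_def power2_eq_square)
      finally show ?thesis .
    qed
    show "0 < \<epsilon>" "\<epsilon> \<le> 1" by (fact eps)+
    show "\<epsilon> * \<pi> q \<le> kpow S P n p q" if "p \<in> S" "q \<in> S" for p q
    proof -
      have "\<pi> q \<le> 1" using member_le_sum[of q S \<pi>] pi0 finS pisum that by auto
      then have "\<epsilon> * \<pi> q \<le> \<epsilon>" using eps by (simp add: mult_left_le)
      also have "\<epsilon> \<le> kpow S P n p q" unfolding \<epsilon>_def using finS that by (intro Min_le) auto
      finally show ?thesis .
    qed
  qed
  define W where "W f p q = (\<Sum>s\<in>F p q. f (om s)) * v q / (\<rho> * v p)" for f :: "real \<Rightarrow> real" and p q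
  have sub: "norm (T \<theta> p q) \<le> P p q" if "p \<in> S" "q \<in> S" for \<theta> p q
    using norm_kernel_le[of \<theta> p q] vpos that rho
    by (simp add: T_def P_def norm_mult norm_divide divide_right_mono mult_right_mono less_imp_le)
  have expand: "norm (T \<theta> p q - (P p q + \<i> * \<theta> * W (\<lambda>x. x) p q - \<theta>\<^sup>2 / 2 * W (\<lambda>x. x\<^sup>2) p q))
      \<le> \<bar>\<theta>\<bar> ^ 3 * W (\<lambda>x. \<bar>x\<bar> ^ 3 / 6) p q" if "p \<in> S" "q \<in> S" for \<theta> p q
  proof -
    define k where "k = v q / (\<rho> * v p)"
    have k: "k > 0" using vpos that rho by (simp add: k_def)
    have "T \<theta> p q - (P p q + \<i> * \<theta> * W (\<lambda>x. x) p q - \<theta>\<^sup>2 / 2 * W (\<lambda>x. x\<^sup>2) p q)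
       = (\<Sum>s\<in>F p q. cis (\<theta> * om s) - (1 + \<i> * of_real (\<theta> * om s) - (of_real (\<theta> * om s))\<^sup>2 / 2)) * of_real k"
      unfolding sum_subtractf sum.distrib sum_divide_distrib[symmetric] of_real_mult power_mult_distrib
        sum_distrib_left[symmetric]
      by (simp add: T_def P_def W_def kernel_def k_def algebra_simps)
    also have "norm \<dots> = norm (\<Sum>s\<in>F p q. cis (\<theta> * om s) - (1 + \<i> * of_real (\<theta> * om s) - (of_real (\<theta> * om s))\<^sup>2 / 2)) * k"
      using k by (simp add: norm_mult)
    also have "\<dots> \<le> (\<Sum>s\<in>F p q. \<bar>\<theta> * om s\<bar> ^ 3 / 6) * k"
      using k by (intro mult_right_mono sum_norm_le norm_cis_expansion_le) auto
    also have "\<dots> = \<bar>\<theta>\<bar> ^ 3 * W (\<lambda>x. \<bar>x\<bar> ^ 3 / 6) p q"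
      by (simp add: W_def k_def abs_mult power_mult_distrib sum_distrib_left sum_distrib_right sum_divide_distrib mult_ac)
    finally show ?thesis .
  qed
  have W3: "W (\<lambda>x. \<bar>x\<bar> ^ 3 / 6) p q \<ge> 0" if "p \<in> S" "q \<in> S" for p q
    unfolding W_def using that rho v0 by (intro divide_nonneg_nonneg mult_nonneg_nonneg sum_nonneg) auto
  have centred: "(\<Sum>p\<in>S. \<pi> p * (\<Sum>q\<in>S. W (\<lambda>x. x) p q)) = 0"
  proof -
    \<comment> \<open>Up to the factor \<open>\<rho> * Z\<close> the mean weight is a form in
      \<open>v\<close> with antisymmetric coefficients, and therefore zero.\<close>
    define B where "B = (\<Sum>p\<in>S. \<Sum>q\<in>S. (\<Sum>s\<in>F p q. om s) * v p * v q)"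
    have "(\<Sum>p\<in>S. \<pi> p * (\<Sum>q\<in>S. W (\<lambda>x. x) p q)) = (\<Sum>p\<in>S. \<Sum>q\<in>S. (\<Sum>s\<in>F p q. om s) * v p * v q / (\<rho> * Z))"
      unfolding sum_distrib_left using vne
      by (intro sum.cong refl) (auto simp: \<pi>_def W_def power2_eq_square mult_ac)
    also have "\<dots> = B / (\<rho> * Z)" by (simp add: B_def sum_divide_distrib)
    also have "B = - B"
    proof -
      have "B = (\<Sum>q\<in>S. \<Sum>p\<in>S. (\<Sum>s\<in>F p q. om s) * v p * v q)" unfolding B_def by (rule sum.swap)
      also have "\<dots> = (\<Sum>q\<in>S. \<Sum>p\<in>S. - ((\<Sum>s\<in>F q p. om s) * v q * v p))"
        by (intro sum.cong refl) (subst sum_om_antisym, simp add: mult_ac)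
      finally show ?thesis by (simp add: B_def sum_negf)
    qed
    then have "B / (\<rho> * Z) = 0" by simp
    finally show ?thesis .
  qed
  obtain \<kappa> where lim: "\<And>x. (\<lambda>N. kpow S (T (x / sqrt (real N))) N o0 o0) \<longlonglongrightarrow> of_real (\<pi> o0 * exp (- \<kappa> * x\<^sup>2))"
    by (rule pinned_clt[OF sub expand W3 centred o0]) (rule that | assumption)+
  have pio: "\<pi> o0 > 0" using vpos[OF o0] Z by (simp add: \<pi>_def)
  have "(\<lambda>N. kpow S (kernel (x / sqrt (real N))) N o0 o0 / of_real (kpow S adj N o0 o0))
       \<longlonglongrightarrow> of_real (exp (- \<kappa> * x\<^sup>2))" for x
  proof -
    have T0: "T 0 = (\<lambda>p q. of_real (P p q))" by (intro ext) (simp add: T_def P_def kernel_def)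
    have "(\<lambda>N. of_real (kpow S P N o0 o0)) \<longlonglongrightarrow> complex_of_real (\<pi> o0)"
      using lim[of 0] by (simp add: T0 kpow_of_real)
    then have "(\<lambda>N. kpow S (T (x / sqrt (real N))) N o0 o0 / of_real (kpow S P N o0 o0))
       \<longlonglongrightarrow> of_real (\<pi> o0 * exp (- \<kappa> * x\<^sup>2)) / of_real (\<pi> o0)"
      using pio by (intro tendsto_divide lim) auto
    moreover have "kpow S (T \<theta>) N o0 o0 / of_real (kpow S P N o0 o0)
        = kpow S (kernel \<theta>) N o0 o0 / of_real (kpow S adj N o0 o0)" for \<theta> N
      using vpos[OF o0] rho by (simp add: T_pow[OF o0 o0] P_pow[OF o0 o0])
    ultimately show ?thesis using pio by simp
  qed
  then show thesis by (rule that)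
qed

theorem local_limit:
  "\<exists>C0 C1 :: real. C0 > 0 \<and> C1 > 0 \<and>
    (\<forall>(t :: nat \<Rightarrow> int) (\<tau> :: real).
      (\<lambda>N. real_of_int (t N) / sqrt (real N)) \<longlonglongrightarrow> \<tau> \<longrightarrow>
      (\<lambda>N. sqrt (real N) * (card {l \<in> walks N o0 o0. weight l = of_int (t N)} / card (walks N o0 o0)))
        \<longlonglongrightarrow> C0 * exp (- C1 * \<tau>\<^sup>2))"
proof -
  obtain c C where c: "c > 0" "C \<ge> 1" and bnd: "\<And>\<theta> N. \<bar>\<theta>\<bar> \<le> pi \<Longrightarrow>
       norm (kpow S (kernel \<theta>) N o0 o0) \<le> C * exp (- c * N * \<theta>\<^sup>2) * kpow S adj N o0 o0"
    by (rule char_bound) (rule that | assumption)+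
  obtain \<kappa> where lim: "\<And>x. (\<lambda>N. kpow S (kernel (x / sqrt (real N))) N o0 o0 / of_real (kpow S adj N o0 o0))
       \<longlonglongrightarrow> of_real (exp (- \<kappa> * x\<^sup>2))"
    using char_limit by blast
  define R where "R N \<theta> = kpow S (kernel \<theta>) N o0 o0 / of_real (kpow S adj N o0 o0)" for N \<theta>
  have bound: "norm (R N \<theta>) \<le> C * exp (- c * N * \<theta>\<^sup>2)" if "\<bar>\<theta>\<bar> \<le> pi" for N \<theta>
  proof (cases "kpow S adj N o0 o0 = 0")
    case True
    then show ?thesis using c by (simp add: R_def)
  next
    case False
    then have "kpow S adj N o0 o0 > 0" by (simp add: kpow_adj)
    then show ?thesis using bnd[OF that, of N] by (simp add: R_def norm_divide divide_le_eq)
  qed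
  have gauss: "exp (- \<kappa> * x\<^sup>2) \<le> C * exp (- c * x\<^sup>2)" for x
  proof (rule tendsto_upperbound)
    show "(\<lambda>N. norm (R N (x / sqrt (real N)))) \<longlonglongrightarrow> exp (- \<kappa> * x\<^sup>2)"
      using tendsto_norm[OF lim[of x]] by (simp add: R_def)
    have "\<forall>\<^sub>F N in sequentially. pi * sqrt (real N) \<ge> \<bar>x\<bar>" by real_asymp
    then show "\<forall>\<^sub>F N in sequentially. norm (R N (x / sqrt (real N))) \<le> C * exp (- c * x\<^sup>2)"
      using eventually_gt_at_top[of 0]
    proof eventually_elim
      case (elim N)
      then have "\<bar>x / sqrt (real N)\<bar> \<le> pi" by (simp add: divide_le_eq)
      from bound[OF this, of N] elim show ?case by (simp add: power_divide)
    qed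
  qed simp
  \<comment> \<open>At the chosen \<open>x\<close> the damping bound equals
    \<open>exp (- 1)\<close>, whereas a nonpositive \<open>\<kappa>\<close> would make the limit at
    least 1.\<close>
  have kappa: "\<kappa> > 0"
  proof (rule ccontr)
    assume k: "\<not> \<kappa> > 0"
    define x where "x = sqrt ((ln C + 1) / c)"
    have "x\<^sup>2 = (ln C + 1) / c" using c by (simp add: x_def)
    then have "C * exp (- c * x\<^sup>2) = exp (- 1)" using c by (simp add: exp_diff exp_minus inverse_eq_divide)
    moreover have "1 \<le> exp (- \<kappa> * x\<^sup>2)" using k by (simp add: mult_nonpos_nonneg)
    ultimately have "1 \<le> exp (- 1 :: real)" using gauss[of x] by linarith
    then show False by simp
  qed
  have R_eq: "R N \<theta> = (\<Sum>l\<in>walks N o0 o0. cis (\<theta> * weight l)) / of_nat (card (walks N o0 o0))" for N \<theta>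
    by (simp add: R_def kpow_kernel kpow_adj)
  show ?thesis
  proof (intro exI conjI allI impI)
    fix t :: "nat \<Rightarrow> int" and \<tau> :: real
    assume t: "(\<lambda>N. real_of_int (t N) / sqrt (real N)) \<longlonglongrightarrow> \<tau>"
    show "(\<lambda>N. sqrt (real N) * (card {l \<in> walks N o0 o0. weight l = of_int (t N)} / card (walks N o0 o0)))
        \<longlonglongrightarrow> 1 / (2 * sqrt (pi * \<kappa>)) * exp (- (1 / (4 * \<kappa>)) * \<tau>\<^sup>2)"
    proof -
      have "(\<lambda>N. sqrt (real N) * (card {l \<in> walks N o0 o0. weight l = of_int (t N)} / card (walks N o0 o0)))
        \<longlonglongrightarrow> 1 / (2 * sqrt (pi * \<kappa>)) * exp (- 1 / (4 * \<kappa>) * \<tau>\<^sup>2)"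
        by (rule local_limit_fourier[OF finite_walks integral bound[unfolded R_eq]
              lim[folded R_def, unfolded R_eq] kappa c(1) _ t]) (use c in auto)
      then show ?thesis by simp
    qed
  qed (use kappa in auto)
qed

end

section \<open>Floors and their weight modulo integers\<close>

definition eps :: "int \<times> int \<Rightarrow> int" where
  "eps c = (if even (fst c + snd c) then 1 else - 1)"

definition up :: "int \<times> int \<Rightarrow> int \<times> int" where "up c = (fst c, snd c + 1)"
definition rt :: "int \<times> int \<Rightarrow> int \<times> int" where "rt c = (fst c + 1, snd c)"

lemma up_rt_simps [simp]:
  "fst (up c) = fst c" "snd (up c) = snd c + 1" "fst (rt c) = fst c + 1" "snd (rt c) = snd c"
  "eps (up c) = - eps c" "eps (rt c) = - eps c"
  by (auto simp: up_def rt_def eps_def)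

lemma eps_simps [simp]: "eps c * eps c = 1" "eps c * (eps c * x) = x"
  by (auto simp: eps_def)

lemma eps_cases: "eps c = 1 \<or> eps c = - 1"
  by (auto simp: eps_def)

lemma odd_eps [simp]: "odd (eps c)"
  by (auto simp: eps_def)

type_synonym floor = "int \<times> int \<Rightarrow> int \<times> int \<times> int"

definition dx :: "floor \<Rightarrow> int \<times> int \<Rightarrow> int" where "dx s c = fst (s c)"
definition dy :: "floor \<Rightarrow> int \<times> int \<Rightarrow> int" where "dy s c = fst (snd (s c))"
definition dz :: "floor \<Rightarrow> int \<times> int \<Rightarrow> int" where "dz s c = snd (snd (s c))"

definition dirs :: "(int \<times> int \<times> int) set" where
  "dirs = {(1,0,0), (-1,0,0), (0,1,0), (0,-1,0), (0,0,1), (0,0,-1)}"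

text \<open>A floor records, for every square, the direction of the other half of its domino; the
  squares of \<open>p\<close> are matched with the floor below and those of \<open>q\<close> with the floor above.\<close>

definition floors :: "(int \<times> int) set \<Rightarrow> (int \<times> int) set \<Rightarrow> (int \<times> int) set \<Rightarrow> floor set" where
  "floors C p q = {s. (\<forall>c. c \<notin> C \<longrightarrow> s c = (0, 0, 0)) \<and> (\<forall>c\<in>C. s c \<in> dirs) \<and>
     (\<forall>c\<in>C. dz s c = 0 \<longrightarrow> (fst c + dx s c, snd c + dy s c) \<in> C \<and>
        s (fst c + dx s c, snd c + dy s c) = (- dx s c, - dy s c, 0)) \<and>
     {c \<in> C. dz s c = - 1} = p \<and> {c \<in> C. dz s c = 1} = q}"

definition side :: "int \<times> int \<Rightarrow> int \<times> int \<Rightarrow> int" where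
  "side c z = (if snd c = snd z then sgn (fst c - fst z) else 0)"

definition row :: "int \<times> int \<Rightarrow> int \<times> int \<Rightarrow> int" where
  "row c z = (if snd c = snd z then 1 else 0)"

text \<open>Four times the contribution of a floor to the twist, up to the orientation of the axes,
  kept integral for congruences. A square \<open>c\<close> of a domino across the rows meets a
  square \<open>z\<close> of an upright domino in its row. The signs \<open>eps\<close> convert
  displacements into black-minus-white vectors; \<open>side\<close> tells which square is
  ahead.\<close>

definition tw4 :: "(int \<times> int) set \<Rightarrow> floor \<Rightarrow> int" where
  "tw4 C s = (\<Sum>c\<in>C. \<Sum>z\<in>C. side c z * eps c * eps z * dy s c * dz s z)"

text \<open>Modulo 2 and off the diagonal the antisymmetric \<open>side\<close> becomes the
  symmetric \<open>row\<close>. This is how a quadratic form can describe the twist.\<close>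

lemma even_side_row: "c \<noteq> z \<Longrightarrow> even (side c z - row c z)"
  by (auto simp: side_def row_def sgn_if prod_eq_iff)

lemma side_anti: "side z c = - side c z"
  by (auto simp: side_def sgn_if)

lemma row_sym: "row z c = row c z"
  by (auto simp: row_def)

lemma even_symmetric_sum:
  fixes h :: "'a \<Rightarrow> 'a \<Rightarrow> int"
  assumes "finite A" "\<And>c z. h c z = h z c"
  shows "even ((\<Sum>c\<in>A. \<Sum>z\<in>A. h c z) - (\<Sum>c\<in>A. h c c))"
  using assms(1)
proof (induction A rule: finite_induct)
  case (insert a A)
  have "(\<Sum>c\<in>insert a A. \<Sum>z\<in>insert a A. h c z)
      = h a a + (\<Sum>z\<in>A. h a z) + (\<Sum>c\<in>A. h c a) + (\<Sum>c\<in>A. \<Sum>z\<in>A. h c z)"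
    using insert by (simp add: sum.distrib)
  also have "(\<Sum>c\<in>A. h c a) = (\<Sum>z\<in>A. h a z)" using assms(2) by (intro sum.cong) auto
  finally have "(\<Sum>c\<in>insert a A. \<Sum>z\<in>insert a A. h c z) - (\<Sum>c\<in>insert a A. h c c)
      = 2 * (\<Sum>z\<in>A. h a z) + ((\<Sum>c\<in>A. \<Sum>z\<in>A. h c z) - (\<Sum>c\<in>A. h c c))"
    using insert by simp
  then show ?case by (simp only: dvd_add dvd_triv_left insert.IH)
qed simp

lemma even_sum_diff:
  fixes f g :: "'a \<Rightarrow> int"
  assumes "\<And>x. x \<in> A \<Longrightarrow> even (f x - g x)"
  shows "even (sum f A - sum g A)"
  unfolding sum_subtractf[symmetric] by (rule dvd_sum) (rule assms)

lemma floor_values: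
  assumes s: "s \<in> floors C p q"
  shows "p \<subseteq> C" "q \<subseteq> C" "\<And>c. c \<in> p \<longleftrightarrow> c \<in> C \<and> s c = (0, 0, -1)" "\<And>c. c \<in> q \<longleftrightarrow> c \<in> C \<and> s c = (0, 0, 1)"
    "\<And>c. c \<notin> C \<Longrightarrow> s c = (0, 0, 0)"
    "\<And>c. s c = (0, 1, 0) \<Longrightarrow> c \<in> C \<and> up c \<in> C \<and> s (up c) = (0, -1, 0)"
    "\<And>c. s c = (1, 0, 0) \<Longrightarrow> c \<in> C \<and> rt c \<in> C \<and> s (rt c) = (-1, 0, 0)"
    "\<And>c. s c = (0, -1, 0) \<Longrightarrow> c \<in> C \<and> (fst c, snd c - 1) \<in> C \<and> s (fst c, snd c - 1) = (0, 1, 0)"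
    "\<And>c. s c = (-1, 0, 0) \<Longrightarrow> c \<in> C \<and> (fst c - 1, snd c) \<in> C \<and> s (fst c - 1, snd c) = (1, 0, 0)"
proof -
  have d: "s c \<in> dirs" if "c \<in> C" for c using s that by (auto simp: floors_def)
  have nz: "c \<in> C" if "s c \<noteq> (0,0,0)" for c using s that unfolding floors_def by blast
  have z: "(fst c + dx s c, snd c + dy s c) \<in> C \<and>
        s (fst c + dx s c, snd c + dy s c) = (- dx s c, - dy s c, 0)" if "c \<in> C" "dz s c = 0" for c
    using s that unfolding floors_def by blast
  have pq: "{c \<in> C. dz s c = - 1} = p" "{c \<in> C. dz s c = 1} = q" using s by (auto simp: floors_def)
  show "p \<subseteq> C" "q \<subseteq> C" using pq by auto
  show "c \<in> p \<longleftrightarrow> c \<in> C \<and> s c = (0, 0, -1)" for c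
    unfolding pq(1)[symmetric] using d[of c] by (auto simp: dirs_def dz_def)
  show "c \<in> q \<longleftrightarrow> c \<in> C \<and> s c = (0, 0, 1)" for c
    unfolding pq(2)[symmetric] using d[of c] by (auto simp: dirs_def dz_def)
  show "c \<notin> C \<Longrightarrow> s c = (0, 0, 0)" for c using nz by blast
  show "c \<in> C \<and> up c \<in> C \<and> s (up c) = (0, -1, 0)" if "s c = (0, 1, 0)" for c
    using nz[of c] z[of c] that by (simp add: dx_def dy_def dz_def up_def)
  show "c \<in> C \<and> rt c \<in> C \<and> s (rt c) = (-1, 0, 0)" if "s c = (1, 0, 0)" for c
    using nz[of c] z[of c] that by (simp add: dx_def dy_def dz_def rt_def)
  show "c \<in> C \<and> (fst c, snd c - 1) \<in> C \<and> s (fst c, snd c - 1) = (0, 1, 0)" if "s c = (0, -1, 0)" for c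
    using nz[of c] z[of c] that by (simp add: dx_def dy_def dz_def)
  show "c \<in> C \<and> (fst c - 1, snd c) \<in> C \<and> s (fst c - 1, snd c) = (1, 0, 0)" if "s c = (-1, 0, 0)" for c
    using nz[of c] z[of c] that by (simp add: dx_def dy_def dz_def)
qed

lemma floor_dirs: "s \<in> floors C p q \<Longrightarrow> c \<in> C \<Longrightarrow> s c \<in> dirs"
  by (auto simp: floors_def)

text \<open>The squares outside both plugs are paired by the dominoes lying in the floor. Each is
  represented by its square with the smaller coordinate: \<open>U\<close> for dominoes across the
  rows, \<open>V\<close> for those along them.\<close>

lemma sum_floor:
  fixes g :: "int \<times> int \<Rightarrow> int"
  assumes s: "s \<in> floors C p q" and fin: "finite C"
  defines "U \<equiv> {c. s c = (0, 1, 0)}" and "V \<equiv> {c. s c = (1, 0, 0)}"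
  shows "sum g (C - p - q) = (\<Sum>a\<in>U. g a + g (up a)) + (\<Sum>a\<in>V. g a + g (rt a))"
    "finite U" "finite V" "C - p - q = U \<union> up ` U \<union> (V \<union> rt ` V)"
proof -
  note v = floor_values[OF s]
  have 1: "up ` U = {c. s c = (0, -1, 0)}"
  proof (intro equalityI subsetI)
    fix c assume "c \<in> {c. s c = (0, -1, 0)}"
    then have "s (fst c, snd c - 1) = (0, 1, 0)" using v(8)[of c] by simp
    then show "c \<in> up ` U" by (intro image_eqI[of _ _ "(fst c, snd c - 1)"]) (auto simp: up_def U_def)
  qed (use v(6) in \<open>auto simp: U_def\<close>)
  have 2: "rt ` V = {c. s c = (-1, 0, 0)}"
  proof (intro equalityI subsetI)
    fix c assume "c \<in> {c. s c = (-1, 0, 0)}"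
    then have "s (fst c - 1, snd c) = (1, 0, 0)" using v(9)[of c] by simp
    then show "c \<in> rt ` V" by (intro image_eqI[of _ _ "(fst c - 1, snd c)"]) (auto simp: rt_def V_def)
  qed (use v(7) in \<open>auto simp: V_def\<close>)
  have "U \<subseteq> C" "V \<subseteq> C" unfolding U_def V_def using v(6,7) by blast+
  then show fUV: "finite U" "finite V" using fin finite_subset by blast+
  show 3: "C - p - q = U \<union> up ` U \<union> (V \<union> rt ` V)"
  proof (intro equalityI subsetI)
    fix c assume c: "c \<in> C - p - q"
    then have "s c \<in> dirs" "s c \<noteq> (0,0,1)" "s c \<noteq> (0,0,-1)" using floor_dirs[OF s] v(3,4) by auto
    then show "c \<in> U \<union> up ` U \<union> (V \<union> rt ` V)" unfolding 1 2 by (auto simp: dirs_def U_def V_def)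
  next
    fix c assume "c \<in> U \<union> up ` U \<union> (V \<union> rt ` V)"
    then have "s c \<in> {(0,1,0), (0,-1,0), (1,0,0), (-1,0,0)}" unfolding 1 2 by (auto simp: U_def V_def)
    moreover from this have "c \<in> C" using v(5)[of c] by (cases "c \<in> C") auto
    ultimately show "c \<in> C - p - q" using v(3,4)[of c] by auto
  qed
  have iu: "inj_on up U" "inj_on rt V" by (auto simp: inj_on_def up_def rt_def prod_eq_iff)
  have "U \<inter> up ` U = {}" "V \<inter> rt ` V = {}" "(U \<union> up ` U) \<inter> (V \<union> rt ` V) = {}"
    unfolding 1 2 by (auto simp: U_def V_def)
  then have "sum g (C - p - q) = (sum g U + sum g (up ` U)) + (sum g V + sum g (rt ` V))"
    unfolding 3 using fUV by (simp add: sum.union_disjoint)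
  then show "sum g (C - p - q) = (\<Sum>a\<in>U. g a + g (up a)) + (\<Sum>a\<in>V. g a + g (rt a))"
    using iu by (simp add: sum.reindex sum.distrib)
qed

locale board =
  fixes C :: "(int \<times> int) set"
  assumes fin: "finite C" and bal: "(\<Sum>c\<in>C. eps c) = 0"
begin

definition E :: "int \<Rightarrow> int" where "E j = (\<Sum>z\<in>C. if snd z = j then eps z else 0)"

text \<open>The linear term of the potential is chosen to cancel modulo 4 over a horizontal domino along
  the rows (\<open>site_coeff_rt\<close>) and to absorb the contribution of one across them (\<open>site_coeff_up\<close>).\<close>

definition left_count :: "int \<times> int \<Rightarrow> int" where
  "left_count c = (\<Sum>z\<in>C. if snd z = snd c \<and> fst z < fst c then 1 else 0)"

text \<open>Twice the signed number of squares in the rows below \<open>j\<close>, plus that of row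
  \<open>j\<close> itself. Consecutive values differ by \<open>E j + E (j + 1)\<close>, the row
  totals met by a domino across the two rows.\<close>

definition row_coeff :: "int \<Rightarrow> int" where
  "row_coeff j = (\<Sum>z\<in>C. eps z * ((if snd z \<le> j then 1 else 0) + (if snd z < j then 1 else 0)))"

definition site_coeff :: "int \<times> int \<Rightarrow> int" where
  "site_coeff c = 2 * (left_count c + fst c + snd c) + eps c * row_coeff (snd c)"

text \<open>The sum over the rows of the product of the signed numbers of squares of
  \<open>A\<close> and of \<open>B\<close> in that row.\<close>

definition Q :: "(int \<times> int) set \<Rightarrow> (int \<times> int) set \<Rightarrow> int" where
  "Q A B = (\<Sum>c\<in>A. \<Sum>z\<in>B. row c z * eps c * eps z)"

text \<open>Modulo 4, the contribution of a floor to four times the twist is a difference of values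
  of this quadratic form, so that the contributions of a closed walk add up to an integer.\<close>

definition potential :: "(int \<times> int) set \<Rightarrow> int" where
  "potential A = Q A A - (\<Sum>c\<in>A. site_coeff c)"

lemma row_coeff_step: "row_coeff (j + 1) - row_coeff j = E j + E (j + 1)"
  unfolding row_coeff_def E_def sum_subtractf[symmetric] sum.distrib[symmetric]
  by (intro sum.cong refl) auto

lemma even_row_coeff: "even (row_coeff j - E j)"
  unfolding row_coeff_def E_def by (rule even_sum_diff) auto

lemma Q_sym: "Q A B = Q B A"
  unfolding Q_def by (subst sum.swap) (simp add: row_sym[of _ "_"] mult_ac)

lemma Q_Un:
  assumes "finite A" "finite B" "A \<inter> B = {}"
  shows "Q (A \<union> B) D = Q A D + Q B D" "Q D (A \<union> B) = Q D A + Q D B"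
  using assms by (simp_all add: Q_def sum.union_disjoint sum.distrib)

lemma left_count_rt: "a \<in> C \<Longrightarrow> left_count (rt a) = left_count a + 1"
proof -
  assume a: "a \<in> C"
  have "left_count (rt a) = (\<Sum>z\<in>C. (if snd z = snd a \<and> fst z < fst a then 1 else 0) + (if z = a then 1 else 0))"
    unfolding left_count_def by (intro sum.cong refl) (auto simp: prod_eq_iff)
  then show ?thesis using a fin by (simp add: sum.distrib left_count_def)
qed

lemma site_coeff_rt: "a \<in> C \<Longrightarrow> 4 dvd site_coeff a + site_coeff (rt a)"
proof -
  assume a: "a \<in> C"
  have "site_coeff a + site_coeff (rt a) = 4 * (left_count a + fst a + snd a + 1)"
    by (simp add: site_coeff_def left_count_rt[OF a] algebra_simps)
  then show ?thesis by simp
qed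

lemma side_sum:
  assumes "c \<in> C"
  shows "(\<Sum>z\<in>C. side c z * eps z)
    = 2 * (\<Sum>z\<in>C. if snd z = snd c \<and> fst z < fst c then eps z else 0) + eps c - E (snd c)"
proof -
  have "(\<Sum>z\<in>C. side c z * eps z) = (\<Sum>z\<in>C. 2 * (if snd z = snd c \<and> fst z < fst c then eps z else 0)
      + (if z = c then eps z else 0) - (if snd z = snd c then eps z else 0))"
    by (intro sum.cong refl) (auto simp: side_def prod_eq_iff sgn_if)
  then show ?thesis using assms fin by (simp add: sum.distrib sum_subtractf sum_distrib_left E_def)
qed

text \<open>By \<open>side_sum\<close> the left side consists of doubled left-hand counts and of row
  totals. Under the factor 2 signed counts may be replaced by \<open>left_count\<close>, and the row
  totals cancel by \<open>row_coeff_step\<close>. The coordinates in \<open>site_coeff\<close> leave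
  a 2, which the constant 2 completes to a multiple of 4.\<close>

lemma site_coeff_up:
  assumes "a \<in> C" "up a \<in> C"
  shows "4 dvd eps a * ((\<Sum>z\<in>C. side a z * eps z) + (\<Sum>z\<in>C. side (up a) z * eps z)) - (site_coeff a + site_coeff (up a) + 2)"
proof -
  define l where "l c = (\<Sum>z\<in>C. if snd z = snd c \<and> fst z < fst c then eps z else 0)" for c
  have l: "even (l c - left_count c)" for c
    unfolding l_def left_count_def by (rule even_sum_diff) auto
  have "even (eps a * (l a + l (up a)) - (left_count a + left_count (up a)))"
    using l[of a] l[of "up a"] odd_eps[of a] by auto
  then obtain m where m: "eps a * (l a + l (up a)) = left_count a + left_count (up a) + 2 * m"
    by (metis add.commute diff_eq_eq dvdE)
  have "eps a * ((\<Sum>z\<in>C. side a z * eps z) + (\<Sum>z\<in>C. side (up a) z * eps z))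
      = 2 * (eps a * (l a + l (up a))) - eps a * (E (snd a) + E (snd a + 1))"
    unfolding side_sum[OF assms(1)] side_sum[OF assms(2)] l_def[symmetric] by (simp add: algebra_simps)
  moreover have "site_coeff a + site_coeff (up a) = 2 * (left_count a + left_count (up a)) + 4 * fst a + 4 * snd a + 2
      - eps a * (E (snd a) + E (snd a + 1))"
    using row_coeff_step[of "snd a"] by (simp add: site_coeff_def algebra_simps)
  ultimately have "eps a * ((\<Sum>z\<in>C. side a z * eps z) + (\<Sum>z\<in>C. side (up a) z * eps z)) - (site_coeff a + site_coeff (up a) + 2)
      = 4 * (m - fst a - snd a - 1)" unfolding m by simp
  then show ?thesis by (simp only: dvd_triv_left)
qed

text \<open>The set \<open>C - q\<close> exceeds \<open>p\<close> exactly by the squares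
  \<open>f\<close> of the dominoes lying in the floor. Hence the difference of potentials involves
  only these dominoes and their interaction with \<open>p\<close>, as the twist does.\<close>

lemma tw4_mod_complement:
  assumes s: "s \<in> floors C p q"
  shows "4 dvd tw4 C s - (potential p - potential (C - q))"
proof -
  note v = floor_values[OF s]
  define U where "U = {c. s c = (0, 1, 0)}"
  define V where "V = {c. s c = (1, 0, 0)}"
  note sf = sum_floor[OF s fin, folded U_def V_def]
  define f where "f = C - p - q"
  define Y where "Y = U \<union> up ` U"
  define H where "H A c = (\<Sum>z\<in>A. side c z * eps z)" for A c
  have UC: "a \<in> C" "up a \<in> C" "s a = (0,1,0)" "s (up a) = (0,-1,0)" if "a \<in> U" for a
    using that v(6) by (auto simp: U_def)
  have VC: "a \<in> C" "rt a \<in> C" "s a = (1,0,0)" "s (rt a) = (-1,0,0)" if "a \<in> V" for a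
    using that v(7) by (auto simp: V_def)
  have dis: "U \<inter> up ` U = {}"
  proof (rule equals0I)
    fix x assume "x \<in> U \<inter> up ` U"
    then obtain b where "x = up b" "b \<in> U" "x \<in> U" by blast
    then show False using UC(3)[of x] UC(4)[of b] by simp
  qed
  have finp: "finite p" "finite q" "finite f" using v(1,2) fin finite_subset by (auto simp: f_def)
  have pq: "p \<inter> q = {}" using v(3,4) by auto
  have Yv: "c \<in> C \<and> (s c = (0,1,0) \<or> s c = (0,-1,0))" if "c \<in> Y" for c
    using that UC unfolding Y_def by blast
  have sumC: "sum g C = sum g p + sum g q + sum g f" for g :: "int \<times> int \<Rightarrow> int"
  proof -
    have "C = (p \<union> q) \<union> f" "(p \<union> q) \<inter> f = {}" using v(1,2) by (auto simp: f_def)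
    then show ?thesis using finp pq by (metis (no_types, lifting) finite_UnI sum.union_disjoint)
  qed
  have sumY: "sum g Y = (\<Sum>a\<in>U. g a + g (up a))" for g :: "int \<times> int \<Rightarrow> int"
  proof -
    have "inj_on up U" by (auto simp: inj_on_def up_def prod_eq_iff)
    then show ?thesis unfolding Y_def using sf(2) dis by (simp add: sum.union_disjoint sum.reindex sum.distrib)
  qed
  have sumf: "sum g f = sum g Y + (\<Sum>a\<in>V. g a + g (rt a))" for g :: "int \<times> int \<Rightarrow> int"
    using sf(1)[of g] sumY by (simp add: f_def)
  have dz_sum: "(\<Sum>z\<in>C. side c z * eps z * dz s z) = H q c - H p c" for c
  proof -
    have "(\<Sum>z\<in>p. side c z * eps z * dz s z) = - H p c"
      unfolding H_def sum_negf[symmetric] using v(3) by (intro sum.cong refl) (auto simp: dz_def)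
    moreover have "(\<Sum>z\<in>q. side c z * eps z * dz s z) = H q c"
      unfolding H_def using v(4) by (intro sum.cong refl) (auto simp: dz_def)
    moreover have "(\<Sum>z\<in>f. side c z * eps z * dz s z) = 0"
      unfolding sumf sumY by (simp add: UC VC dz_def)
    ultimately show ?thesis unfolding sumC by simp
  qed
  have tw: "tw4 C s = (\<Sum>c\<in>Y. eps c * dy s c * (H q c - H p c))"
  proof -
    have "tw4 C s = (\<Sum>c\<in>C. eps c * dy s c * (H q c - H p c))"
      unfolding tw4_def dz_sum[symmetric] sum_distrib_left by (intro sum.cong refl) (simp add: mult_ac)
    also have "\<dots> = (\<Sum>c\<in>Y. eps c * dy s c * (H q c - H p c))"
    proof -
      have "(\<Sum>c\<in>p. eps c * dy s c * (H q c - H p c)) = 0" "(\<Sum>c\<in>q. eps c * dy s c * (H q c - H p c)) = 0"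
        using v(3,4) by (auto simp: dy_def intro!: sum.neutral)
      then show ?thesis unfolding sumC sumf by (simp add: VC dy_def)
    qed
    finally show ?thesis .
  qed
  \<comment> \<open>A domino along a row lies entirely on one side of \<open>c\<close>, and its two
    squares have opposite signs.\<close>
  have HfY: "H f c = H Y c" if "c \<in> Y" for c
  proof -
    have "side c a = side c (rt a)" if "a \<in> V" for a
    proof -
      have "c \<noteq> a" "c \<noteq> rt a" using Yv[OF \<open>c \<in> Y\<close>] VC[OF that] by auto
      then show ?thesis by (auto simp: side_def sgn_if prod_eq_iff)
    qed
    then have "(\<Sum>a\<in>V. side c a * eps a + side c (rt a) * eps (rt a)) = 0" by (intro sum.neutral) auto
    then show ?thesis by (simp add: H_def sumf)
  qed
  \<comment> \<open>The plug \<open>q\<close> is eliminated by decomposing the board. The term with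
    \<open>H C\<close> depends on the board alone and yields the linear part; the one with
    \<open>H p\<close> gains a factor 2, so only its parity matters.\<close>
  have tw2: "tw4 C s = (\<Sum>c\<in>Y. eps c * dy s c * H C c) - 2 * (\<Sum>c\<in>Y. eps c * dy s c * H p c)
      - (\<Sum>c\<in>Y. eps c * dy s c * H Y c)"
    unfolding tw sum_distrib_left sum_subtractf[symmetric]
  proof (intro sum.cong refl)
    fix c assume "c \<in> Y"
    have "H C c = H p c + H q c + H f c" unfolding H_def by (rule sumC)
    then show "eps c * dy s c * (H q c - H p c) = eps c * dy s c * H C c - 2 * (eps c * dy s c * H p c)
        - eps c * dy s c * H Y c"
      using HfY[OF \<open>c \<in> Y\<close>] by (simp add: algebra_simps)
  qed
  have t1: "4 dvd (\<Sum>c\<in>Y. eps c * dy s c * H C c) - ((\<Sum>c\<in>f. site_coeff c) + 2 * int (card U))"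
  proof -
    have "(\<Sum>c\<in>Y. eps c * dy s c * H C c) - ((\<Sum>c\<in>f. site_coeff c) + 2 * int (card U))
        = (\<Sum>a\<in>U. eps a * (H C a + H C (up a)) - (site_coeff a + site_coeff (up a) + 2)) - (\<Sum>a\<in>V. site_coeff a + site_coeff (rt a))"
      unfolding sumf sumY by (simp add: UC dy_def sum.distrib sum_subtractf algebra_simps)
    also have "4 dvd \<dots>"
      unfolding H_def using UC VC by (intro dvd_diff dvd_sum site_coeff_up site_coeff_rt) auto
    finally show ?thesis .
  qed
  have t2: "even ((\<Sum>c\<in>Y. eps c * dy s c * H p c) - Q Y p)"
  proof -
    have "even (eps c * dy s c * H p c - (\<Sum>z\<in>p. row c z * eps c * eps z))" if c: "c \<in> Y" for c
      unfolding H_def sum_distrib_left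
    proof (rule even_sum_diff)
      fix z assume z: "z \<in> p"
      have "c \<noteq> z" using Yv[OF c] v(3)[of z] z by auto
      moreover have "odd (dy s c)" using Yv[OF c] by (auto simp: dy_def)
      ultimately show "even (eps c * dy s c * (side c z * eps z) - row c z * eps c * eps z)"
        using even_side_row[of c z] odd_eps[of c] odd_eps[of z] by auto
    qed
    then show ?thesis unfolding Q_def by (rule even_sum_diff)
  qed
  \<comment> \<open>Antisymmetry of \<open>side\<close> kills the interaction of \<open>U\<close>
    with itself and of its upper squares with themselves. The mixed terms coincide, which supplies
    the factor 2.\<close>
  have t3: "4 dvd (\<Sum>c\<in>Y. eps c * dy s c * H Y c) - 2 * Q U (up ` U)"
  proof -
    let ?W = "up ` U"
    define g where "g A B = (\<Sum>c\<in>A. \<Sum>z\<in>B. side c z * eps c * eps z)" for A B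
    have fU: "finite U" "finite ?W" using sf(2) by auto
    have g_anti: "g A B = - g B A" for A B
    proof -
      have "g A B = (\<Sum>z\<in>B. \<Sum>c\<in>A. side c z * eps c * eps z)" unfolding g_def by (rule sum.swap)
      also have "\<dots> = (\<Sum>z\<in>B. \<Sum>c\<in>A. - (side z c * eps z * eps c))"
      proof (intro sum.cong refl)
        fix c z show "side c z * eps c * eps z = - (side z c * eps z * eps c)"
          unfolding side_anti[of c z] by (simp add: mult_ac)
      qed
      finally show ?thesis by (simp add: g_def sum_negf)
    qed
    have "(\<Sum>c\<in>Y. eps c * dy s c * H Y c) = (\<Sum>c\<in>U. \<Sum>z\<in>Y. side c z * eps c * eps z) - (\<Sum>c\<in>?W. \<Sum>z\<in>Y. side c z * eps c * eps z)"
    proof -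
      have "(\<Sum>c\<in>U. eps c * dy s c * H Y c) = (\<Sum>c\<in>U. \<Sum>z\<in>Y. side c z * eps c * eps z)"
        unfolding H_def sum_distrib_left by (intro sum.cong refl) (auto simp: UC dy_def)
      moreover have "(\<Sum>c\<in>?W. eps c * dy s c * H Y c) = - (\<Sum>c\<in>?W. \<Sum>z\<in>Y. side c z * eps c * eps z)"
        unfolding H_def sum_distrib_left sum_negf[symmetric] by (intro sum.cong refl) (auto simp: UC dy_def)
      ultimately show ?thesis unfolding Y_def using dis fU by (simp add: sum.union_disjoint)
    qed
    also have "\<dots> = (g U U + g U ?W) - (g ?W U + g ?W ?W)"
      unfolding Y_def g_def using dis fU by (simp add: sum.union_disjoint sum.distrib)
    also have "\<dots> = 2 * g U ?W" using g_anti[of U U] g_anti[of ?W ?W] g_anti[of ?W U] by simp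
    finally have e: "(\<Sum>c\<in>Y. eps c * dy s c * H Y c) - 2 * Q U ?W = 2 * (g U ?W - Q U ?W)" by simp
    have "even (g U ?W - Q U ?W)"
      unfolding g_def Q_def
    proof (intro even_sum_diff)
      fix c z assume "c \<in> U" "z \<in> ?W"
      then have "c \<noteq> z" using dis by auto
      then show "even (side c z * eps c * eps z - row c z * eps c * eps z)"
        using even_side_row[of c z] odd_eps[of c] odd_eps[of z] by auto
    qed
    then show ?thesis unfolding e by (elim evenE) simp
  qed
  have Qf: "Q f B = Q Y B" for B
  proof -
    have "(\<Sum>a\<in>V. (\<Sum>z\<in>B. row a z * eps a * eps z) + (\<Sum>z\<in>B. row (rt a) z * eps (rt a) * eps z)) = 0"
      by (intro sum.neutral) (auto simp: row_def sum.distrib[symmetric] intro!: sum.neutral)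
    then show ?thesis unfolding Q_def sumf by simp
  qed
  have QYY: "Q Y Y = 2 * Q U U + 2 * Q U (up ` U)"
  proof -
    have "inj_on up U" by (auto simp: inj_on_def up_def prod_eq_iff)
    then have "Q (up ` U) (up ` U) = Q U U"
      unfolding Q_def by (simp add: sum.reindex row_def)
    then show ?thesis using Q_Un[of U "up ` U"] sf(2) dis Q_sym[of "up ` U" U] by (simp add: Y_def)
  qed
  have QUU: "even (Q U U - int (card U))"
    using even_symmetric_sum[OF sf(2), of "\<lambda>c z. row c z * eps c * eps z"]
    by (simp add: Q_def row_def mult_ac)
  have cp: "C - q = p \<union> f" "p \<inter> f = {}" using v(1,2) pq by (auto simp: f_def)
  have "potential p - potential (C - q) = (\<Sum>c\<in>f. site_coeff c) - 2 * Q Y p - 2 * Q U U - 2 * Q U (up ` U)"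
  proof -
    have "Q f f = Q Y Y" using Qf[of f] Q_sym[of Y f] Qf[of Y] by simp
    moreover have "Q p f = Q Y p" using Q_sym[of p f] Qf[of p] by simp
    ultimately show ?thesis
      unfolding potential_def cp(1) using Q_Un[OF finp(1,3) cp(2)] QYY Qf[of p] finp cp(2)
      by (simp add: sum.union_disjoint)
  qed
  then have "tw4 C s - (potential p - potential (C - q))
      = ((\<Sum>c\<in>Y. eps c * dy s c * H C c) - ((\<Sum>c\<in>f. site_coeff c) + 2 * int (card U)))
        - 2 * ((\<Sum>c\<in>Y. eps c * dy s c * H p c) - Q Y p)
        - ((\<Sum>c\<in>Y. eps c * dy s c * H Y c) - 2 * Q U (up ` U))
        + 2 * (Q U U - int (card U)) + 4 * (Q U (up ` U) + int (card U) - Q U (up ` U))"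
    unfolding tw2 by simp
  also have "4 dvd \<dots>"
  proof -
    have two: "4 dvd 2 * x" if "even x" for x :: int using that by auto
    show ?thesis by (intro dvd_add dvd_diff t1 t3 two t2 QUU) simp
  qed
  finally show ?thesis .
qed

text \<open>Expanding the quadratic form, the difference is its value on the whole board plus twice
  \<open>(\<Sum>c\<in>q. site_coeff c) - Q C q\<close>. The latter is even since
  \<open>site_coeff c\<close> has the parity of the row total, and balance makes the former a
  multiple of 4.\<close>

lemma potential_complement:
  assumes "q \<subseteq> C"
  shows "4 dvd potential (C - q) - potential q"
proof -
  have fq: "finite q" "finite (C - q)" using assms fin finite_subset by auto
  have two: "4 dvd 2 * x" if "even x" for x :: int using that by auto
  have dec: "C = (C - q) \<union> q" "(C - q) \<inter> q = {}" using assms by auto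
  have QC: "Q C C = Q (C - q) (C - q) + 2 * Q C q - Q q q"
    using Q_Un[OF fq(2,1) dec(2), of C] Q_Un[OF fq(2,1) dec(2), of "C - q"] Q_Un[OF fq(2,1) dec(2), of q]
      Q_sym[of "C - q" q] dec(1)[symmetric] by (simp add: Q_sym)
  have alC: "(\<Sum>c\<in>C. site_coeff c) = (\<Sum>c\<in>C - q. site_coeff c) + (\<Sum>c\<in>q. site_coeff c)"
    using sum.union_disjoint[OF fq(2,1) dec(2), of site_coeff] dec(1)[symmetric] by simp
  have 1: "even ((\<Sum>c\<in>q. site_coeff c) - Q C q)"
  proof -
    have "Q C q = (\<Sum>c\<in>q. eps c * E (snd c))"
      unfolding Q_sym[of C q] unfolding Q_def E_def sum_distrib_left
      by (intro sum.cong refl) (auto simp: row_def)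
    moreover have "even (site_coeff c - eps c * E (snd c))" for c
      using even_row_coeff[of "snd c"] odd_eps[of c] by (auto simp: site_coeff_def)
    ultimately show ?thesis using even_sum_diff[of q site_coeff "\<lambda>c. eps c * E (snd c)"] by simp
  qed
  have 2: "4 dvd Q C C - (\<Sum>c\<in>C. site_coeff c)"
  proof -
    \<comment> \<open>Adding the double sum to its transpose gives every pair of squares the
      coefficient 2, so the total is a multiple of the square of the sum of
      \<open>eps\<close>.\<close>
    have b: "(\<Sum>c\<in>C. eps c * row_coeff (snd c)) = 0"
    proof -
      define h where "h c z = eps c * eps z * ((if snd z \<le> snd c then 1 else 0) + (if snd z < snd c then 1 else 0))" for c z
      have "(\<Sum>c\<in>C. eps c * row_coeff (snd c)) = (\<Sum>c\<in>C. \<Sum>z\<in>C. h c z)"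
        unfolding row_coeff_def h_def sum_distrib_left by (simp add: mult_ac)
      moreover have "2 * (\<Sum>c\<in>C. \<Sum>z\<in>C. h c z) = (\<Sum>c\<in>C. \<Sum>z\<in>C. h c z) + (\<Sum>c\<in>C. \<Sum>z\<in>C. h z c)"
        by (subst (3) sum.swap) simp
      moreover have "\<dots> = (\<Sum>c\<in>C. \<Sum>z\<in>C. 2 * (eps c * eps z))"
        unfolding sum.distrib[symmetric] h_def by (intro sum.cong refl) auto
      moreover have "\<dots> = 2 * ((\<Sum>c\<in>C. eps c) * (\<Sum>z\<in>C. eps z))"
        by (simp only: sum_distrib_left[symmetric] sum_distrib_right[symmetric])
      ultimately show ?thesis using bal by simp
    qed
    have l: "2 * (\<Sum>c\<in>C. left_count c) = (\<Sum>c\<in>C. \<Sum>z\<in>C. row c z) - int (card C)"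
    proof -
      define h :: "int \<times> int \<Rightarrow> int \<times> int \<Rightarrow> int"
        where "h c z = (if snd z = snd c \<and> fst z < fst c then 1 else 0)" for c z
      have "2 * (\<Sum>c\<in>C. left_count c) = (\<Sum>c\<in>C. \<Sum>z\<in>C. h c z) + (\<Sum>c\<in>C. \<Sum>z\<in>C. h z c)"
        unfolding left_count_def h_def[symmetric] by (subst (3) sum.swap) simp
      also have "\<dots> = (\<Sum>c\<in>C. \<Sum>z\<in>C. row c z - (if z = c then 1 else 0))"
        unfolding sum.distrib[symmetric] h_def row_def by (intro sum.cong refl) (auto simp: prod_eq_iff)
      finally show ?thesis using fin by (simp add: sum_subtractf)
    qed
    \<comment> \<open>Here the term fst + snd of \<open>site_coeff\<close> does its work: 2(i + j)
      is congruent to 1 - \<open>eps\<close> modulo 4, and the signs add up to zero.\<close>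
    have ij: "4 dvd (\<Sum>c\<in>C. 2 * (fst c + snd c)) - int (card C)"
    proof -
      have "4 dvd 2 * (fst c + snd c) - (1 - eps c)" for c
        by (auto simp: eps_def elim!: evenE oddE)
      then have "4 dvd (\<Sum>c\<in>C. 2 * (fst c + snd c) - (1 - eps c))" by (intro dvd_sum)
      then show ?thesis using bal by (simp add: sum_subtractf)
    qed
    have rr: "4 dvd Q C C - (\<Sum>c\<in>C. \<Sum>z\<in>C. row c z)"
    proof -
      define h where "h c z = row c z * ((1 - eps c * eps z) div 2)" for c z
      have h2: "2 * h c z = row c z - row c z * eps c * eps z" for c z
        using eps_cases[of c] eps_cases[of z] by (auto simp: h_def)
      have "even (\<Sum>c\<in>C. \<Sum>z\<in>C. h c z)"
        using even_symmetric_sum[OF fin, of h] by (simp add: h_def row_sym mult_ac)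
      then have "4 dvd 2 * (\<Sum>c\<in>C. \<Sum>z\<in>C. h c z)" by (rule two)
      then have "4 dvd (\<Sum>c\<in>C. \<Sum>z\<in>C. row c z) - Q C C"
        by (simp add: sum_distrib_left h2 Q_def sum_subtractf)
      then show ?thesis by (subst dvd_minus_iff[symmetric]) simp
    qed
    have "(\<Sum>c\<in>C. site_coeff c) = 2 * (\<Sum>c\<in>C. left_count c) + (\<Sum>c\<in>C. 2 * (fst c + snd c)) + (\<Sum>c\<in>C. eps c * row_coeff (snd c))"
      unfolding site_coeff_def sum.distrib[symmetric] sum_distrib_left by (intro sum.cong refl) (simp add: algebra_simps)
    then have "Q C C - (\<Sum>c\<in>C. site_coeff c) = (Q C C - (\<Sum>c\<in>C. \<Sum>z\<in>C. row c z))
        - ((\<Sum>c\<in>C. 2 * (fst c + snd c)) - int (card C))"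
      using b l by simp
    then show ?thesis using dvd_diff[OF rr ij] by (simp only:)
  qed
  have "potential (C - q) - potential q = (Q C C - (\<Sum>c\<in>C. site_coeff c)) + 2 * ((\<Sum>c\<in>q. site_coeff c) - Q C q)"
    unfolding potential_def QC alC by simp
  then show ?thesis using dvd_add[OF 2 two[OF 1]] by (simp only:)
qed

lemma tw4_mod:
  assumes s: "s \<in> floors C p q"
  shows "4 dvd tw4 C s - (potential p - potential q)"
proof -
  have "tw4 C s - (potential p - potential q) = (tw4 C s - (potential p - potential (C - q))) - (potential (C - q) - potential q)" by simp
  then show ?thesis
    using dvd_diff[OF tw4_mod_complement[OF s] potential_complement[OF floor_values(2)[OF s]]] by (simp only:)
qed

end

section \<open>Neighbouring squares, reflection and elementary floors\<close>

definition nb :: "int \<times> int \<Rightarrow> int \<times> int \<Rightarrow> bool" where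
  "nb a b \<longleftrightarrow> \<bar>fst a - fst b\<bar> + \<bar>snd a - snd b\<bar> = 1"

lemma nb_sym: "nb a b \<Longrightarrow> nb b a" by (auto simp: nb_def abs_minus_commute)

lemma nb_eps: "nb a b \<Longrightarrow> eps b = - eps a"
proof -
  assume "nb a b"
  then have "odd ((fst a + snd a) - (fst b + snd b))" unfolding nb_def by presburger
  then show ?thesis by (auto simp: eps_def)
qed

lemma nb_neq: "nb a b \<Longrightarrow> a \<noteq> b" by (auto simp: nb_def)

definition flip :: "floor \<Rightarrow> floor" where "flip s c = (dx s c, dy s c, - dz s c)"

lemma flip_simps [simp]: "dx (flip s) = dx s" "dy (flip s) = dy s" "dz (flip s) c = - dz s c"
  by (auto simp: flip_def dx_def dy_def dz_def)

lemma flip_flip [simp]: "flip (flip s) = s"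
  by (auto simp: flip_def dx_def dy_def dz_def)

lemma flip_floors: assumes s: "s \<in> floors C p q" shows "flip s \<in> floors C q p"
proof -
  have "flip s c = (0, 0, 0)" if "c \<notin> C" for c
    using floor_values(5)[OF s that] by (simp add: flip_def dx_def dy_def dz_def)
  moreover have "flip s c \<in> dirs" if "c \<in> C" for c
    using floor_dirs[OF s that] unfolding flip_def dirs_def dx_def dy_def dz_def by (cases "s c") auto
  moreover have "(fst c + dx (flip s) c, snd c + dy (flip s) c) \<in> C \<and>
        flip s (fst c + dx (flip s) c, snd c + dy (flip s) c) = (- dx (flip s) c, - dy (flip s) c, 0)"
    if "c \<in> C" "dz (flip s) c = 0" for c
  proof -
    have "dz s c = 0" using that by simp
    then have "(fst c + dx s c, snd c + dy s c) \<in> C \<and> s (fst c + dx s c, snd c + dy s c) = (- dx s c, - dy s c, 0)"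
      using s that(1) unfolding floors_def by blast
    then show ?thesis unfolding flip_simps by (simp add: flip_def[of s] dx_def dy_def dz_def)
  qed
  moreover have "{c \<in> C. dz (flip s) c = - 1} = q" "{c \<in> C. dz (flip s) c = 1} = p"
    using s by (auto simp: floors_def)
  ultimately show ?thesis unfolding floors_def by blast
qed

lemma tw4_flip: "tw4 C (flip s) = - tw4 C s"
  by (simp add: tw4_def sum_negf)

lemma finite_floors: "finite C \<Longrightarrow> finite (floors C p q)"
  by (rule finite_subset[OF _ finite_set_of_finite_funs[of C dirs "(0,0,0)"]])
    (auto simp: floors_def dirs_def)

text \<open>The floor of upright dominoes only. It leads from a plug to its complement at weight 0,
  so two of them in succession are an idle loop for adjusting lengths.\<close>

definition vertical_floor :: "(int \<times> int) set \<Rightarrow> (int \<times> int) set \<Rightarrow> floor" where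
  "vertical_floor C p c = (if c \<in> p then (0, 0, -1) else if c \<in> C then (0, 0, 1) else (0, 0, 0))"

lemma vertical_floor_floors: "p \<subseteq> C \<Longrightarrow> vertical_floor C p \<in> floors C p (C - p)"
  by (auto simp: floors_def vertical_floor_def dirs_def dx_def dy_def dz_def)

lemma tw4_vertical_floor: "tw4 C (vertical_floor C p) = 0"
proof -
  have "dy (vertical_floor C p) c = 0" for c by (simp add: vertical_floor_def dy_def)
  then show ?thesis by (simp add: tw4_def)
qed

definition slide_floor :: "(int \<times> int) set \<Rightarrow> (int \<times> int) set \<Rightarrow> int \<times> int \<Rightarrow> int \<times> int \<Rightarrow> floor" where
  "slide_floor C p x y c = (if c = x then (fst y - fst x, snd y - snd x, 0)
     else if c = y then (fst x - fst y, snd x - snd y, 0) else vertical_floor C p c)"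

lemma slide_floor_floors:
  assumes "p \<subseteq> C" "x \<in> C - p" "y \<in> C - p" "nb x y"
  shows "slide_floor C p x y \<in> floors C p (C - p - {x, y})"
proof -
  let ?s = "slide_floor C p x y"
  have xy: "x \<noteq> y" using nb_neq[OF assms(4)] .
  have d: "(fst y - fst x, snd y - snd x, 0) \<in> dirs" "(fst x - fst y, snd x - snd y, 0) \<in> dirs"
    using assms(4) unfolding nb_def dirs_def by auto
  have sx: "?s x = (fst y - fst x, snd y - snd x, 0)" by (simp add: slide_floor_def)
  have sy: "?s y = (fst x - fst y, snd x - snd y, 0)" using xy by (simp add: slide_floor_def)
  have sp: "?s c = (0, 0, -1)" if "c \<in> p" for c using that assms(2,3) by (auto simp: slide_floor_def vertical_floor_def)
  have sq: "?s c = (0, 0, 1)" if "c \<in> C" "c \<notin> p" "c \<noteq> x" "c \<noteq> y" for c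
    using that by (simp add: slide_floor_def vertical_floor_def)
  have cs: "c = x \<or> c = y \<or> c \<in> p \<or> (c \<in> C \<and> c \<notin> p \<and> c \<noteq> x \<and> c \<noteq> y)" if "c \<in> C" for c
    using that by blast
  have dz: "dz ?s x = 0" "dz ?s y = 0" by (simp_all add: dz_def sx sy)
  have "?s c = (0, 0, 0)" if "c \<notin> C" for c
    using that assms(1-3) by (auto simp: slide_floor_def vertical_floor_def)
  moreover have "?s c \<in> dirs" if "c \<in> C" for c
    using cs[OF that]
  proof (elim disjE)
    show "?s c \<in> dirs" if "c = x" using d sx that by simp
    show "?s c \<in> dirs" if "c = y" using d sy that by simp
    show "?s c \<in> dirs" if "c \<in> p" using sp[OF that] by (simp add: dirs_def)
    show "?s c \<in> dirs" if "c \<in> C \<and> c \<notin> p \<and> c \<noteq> x \<and> c \<noteq> y"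
      using sq[of c] that by (simp add: dirs_def)
  qed
  moreover have "(fst c + dx ?s c, snd c + dy ?s c) \<in> C \<and>
        ?s (fst c + dx ?s c, snd c + dy ?s c) = (- dx ?s c, - dy ?s c, 0)" if "c \<in> C" "dz ?s c = 0" for c
  proof -
    have "c = x \<or> c = y" using cs[OF that(1)] that(2) sp[of c] sq[of c] by (auto simp: dz_def)
    then show ?thesis using sx sy assms(2,3) by (auto simp: dx_def dy_def)
  qed
  moreover have "{c \<in> C. dz ?s c = - 1} = p"
  proof (intro equalityI subsetI)
    fix c assume "c \<in> {c \<in> C. dz ?s c = - 1}"
    then show "c \<in> p" using cs[of c] dz sq[of c] by (auto simp: dz_def)
  qed (use sp assms(1) in \<open>auto simp: dz_def\<close>)
  moreover have "{c \<in> C. dz ?s c = 1} = C - p - {x, y}"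
  proof (intro equalityI subsetI)
    fix c assume "c \<in> {c \<in> C. dz ?s c = 1}"
    then show "c \<in> C - p - {x, y}" using dz sp[of c] by (auto simp: dz_def)
  qed (use sq in \<open>auto simp: dz_def\<close>)
  ultimately show ?thesis unfolding floors_def by blast
qed

section \<open>Plugs as configurations of tokens\<close>

context board
begin

definition plugs :: "(int \<times> int) set set" where
  "plugs = {p. p \<subseteq> C \<and> (\<Sum>c\<in>p. eps c) = 0}"

definition om :: "floor \<Rightarrow> real" where "om s = real_of_int (tw4 C s) / 4"

sublocale W: floor_walks plugs "{}" "floors C" om flip
proof
  show "finite plugs" unfolding plugs_def using fin by (auto intro: finite_subset[of _ "Pow C"])
  show "q = q'" if "s \<in> floors C p q" "s \<in> floors C p q'" for p q q' s
    using that unfolding floors_def by blast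
  show "{} \<in> plugs" by (simp add: plugs_def)
  show "finite (floors C p q)" for p q by (rule finite_floors[OF fin])
  show "flip s \<in> floors C q p" if "s \<in> floors C p q" for p q s by (rule flip_floors[OF that])
  show "om (flip s) = - om s" for s by (simp add: om_def tw4_flip)
qed simp

lemma plugs_closed:
  assumes s: "s \<in> floors C p q" and p: "p \<in> plugs"
  shows "q \<in> plugs"
proof -
  note v = floor_values[OF s]
  have "(\<Sum>c\<in>C - p - q. eps c) = 0" unfolding sum_floor(1)[OF s fin] by simp
  moreover have "sum eps C = sum eps (C - p - q) + sum eps q + sum eps p"
  proof -
    have "p \<inter> q = {}" using v(3,4) by auto
    then have "q \<subseteq> C - p" using v(2) by auto
    then show ?thesis using v(1) fin by (metis finite_Diff sum.subset_diff)
  qed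
  ultimately show ?thesis using bal p v(2) by (simp add: plugs_def)
qed

lemma plugs_compl: "p \<in> plugs \<Longrightarrow> C - p \<in> plugs"
  using plugs_closed[OF vertical_floor_floors] by (auto simp: plugs_def)

lemma weight_mod: "l \<in> W.walks n p q \<Longrightarrow> \<exists>m::int. W.weight l = of_int (potential p - potential q) / 4 + of_int m"
proof (induction n arbitrary: p l)
  case 0
  then show ?case by (auto split: if_splits intro!: exI[of _ 0])
next
  case (Suc n)
  then obtain r s l' where l: "l = s # l'" "s \<in> floors C p r" "l' \<in> W.walks n r q"
    by (metis W.walks_Suc_iff)
  obtain m where m: "W.weight l' = of_int (potential r - potential q) / 4 + of_int m" using Suc.IH[OF l(3)] by blast
  obtain k where "tw4 C s - (potential p - potential r) = 4 * k" using tw4_mod[OF l(2)] by (auto elim: dvdE)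
  then have "tw4 C s = potential p - potential r + 4 * k" by simp
  then have "om s = of_int (potential p - potential r) / 4 + of_int k" by (simp add: om_def field_simps)
  then show ?case using m l(1) by (intro exI[of _ "m + k"]) (simp add: field_simps)
qed

lemma weight_integral: "l \<in> W.walks n {} {} \<Longrightarrow> W.weight l \<in> \<int>"
  using weight_mod[of l n "{}" "{}"] by auto

lemma wk_vertical: "p \<in> plugs \<Longrightarrow> W.wk 1 p (C - p) 0"
  using W.wk_step[OF vertical_floor_floors plugs_compl, of p] by (simp add: plugs_def om_def tw4_vertical_floor)

lemma wk_pad: "p \<in> plugs \<Longrightarrow> W.wk (2 * n) p p 0"
proof (induction n)
  case 0
  then show ?case by (simp add: W.wk_0)
next
  case (Suc n)
  have "C - (C - p) = p" using Suc.prems by (auto simp: plugs_def)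
  then have "W.wk (1 + 1) p p (0 + 0)"
    using W.wk_append[OF wk_vertical wk_vertical, of p] plugs_compl[of p] Suc.prems by simp
  from W.wk_append[OF this Suc.IH[OF Suc.prems]] show ?case by simp
qed

text \<open>A set \<open>T\<close> of tokens encodes the plug \<open>plug T\<close>; two floors realise the move of a token to
  a free neighbouring square, so that plugs evolve like an exclusion process.\<close>

definition plug :: "(int \<times> int) set \<Rightarrow> (int \<times> int) set" where
  "plug T = {c \<in> C. (c \<in> T) \<noteq> (eps c = 1)}"

definition token_count :: nat where "token_count = card {c \<in> C. eps c = 1}"

text \<open>Taking the symmetric difference with the squares of sign 1 turns balance into a
  cardinality: the sum of \<open>eps\<close> over \<open>plug T\<close> is
  \<open>token_count - card T\<close>.\<close>

lemma plug_mem: assumes "T \<subseteq> C" shows "plug T \<in> plugs \<longleftrightarrow> card T = token_count"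
proof -
  have "(\<Sum>c\<in>plug T. eps c) = (\<Sum>c\<in>C. (if (c \<in> T) \<noteq> (eps c = 1) then eps c else 0))"
    unfolding plug_def using fin by (simp add: sum.inter_filter)
  also have "\<dots> = (\<Sum>c\<in>C. (if eps c = 1 then 1 else 0) - (if c \<in> T then 1 else 0))"
    using eps_cases by (intro sum.cong refl) fastforce
  also have "\<dots> = int token_count - int (card T)"
  proof -
    have "(\<Sum>c\<in>C. if eps c = 1 then 1 else 0 :: int) = int token_count"
      using fin by (simp add: token_count_def sum.inter_filter[symmetric])
    moreover have "(\<Sum>c\<in>C. if c \<in> T then 1 else 0 :: int) = int (card T)"
    proof -
      have "{c \<in> C. c \<in> T} = T" using assms by auto
      then show ?thesis using fin by (simp add: sum.inter_filter[symmetric])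
    qed
    ultimately show ?thesis by (simp add: sum_subtractf)
  qed
  finally show ?thesis by (auto simp: plugs_def plug_def)
qed

lemma plug_plug: "p \<subseteq> C \<Longrightarrow> plug (plug p) = p" by (auto simp: plug_def)

text \<open>Four times the weight of moving a token from \<open>x\<close> to \<open>y\<close>: every
  other square of their rows acts through its occupation, 1 or -1. The first factor vanishes for
  moves along a row.\<close>

definition move_weight :: "(int \<times> int) set \<Rightarrow> int \<times> int \<Rightarrow> int \<times> int \<Rightarrow> int" where
  "move_weight T x y = (snd y - snd x) * (\<Sum>e\<in>{x, y}. \<Sum>z\<in>C - {x, y}. side e z * (if z \<in> T then 1 else - 1))"

lemma tw4_slide_floor:
  assumes T: "T \<subseteq> C" "x \<in> T" "y \<in> C - T" "nb x y" "eps x = 1"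
  shows "tw4 C (slide_floor C (plug T) x y) = move_weight T x y"
proof -
  let ?s = "slide_floor C (plug T) x y"
  have xy: "x \<in> C" "y \<in> C" "x \<noteq> y" "eps y = - 1" using T nb_neq nb_eps[of x y] by auto
  have dys: "dy ?s c = (if c = x then snd y - snd x else if c = y then snd x - snd y else 0)" for c
    by (simp add: slide_floor_def vertical_floor_def dy_def)
  have "tw4 C ?s = (\<Sum>c\<in>{x, y}. \<Sum>z\<in>C. side c z * eps c * eps z * dy ?s c * dz ?s z)"
    unfolding tw4_def using fin xy by (intro sum.mono_neutral_right) (auto simp: dys)
  also have "\<dots> = (\<Sum>c\<in>{x, y}. \<Sum>z\<in>C - {x, y}. side c z * eps c * eps z * dy ?s c * dz ?s z)"
    using fin by (intro sum.cong refl sum.mono_neutral_right) (auto simp: slide_floor_def dz_def)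
  also have "\<dots> = (\<Sum>c\<in>{x, y}. \<Sum>z\<in>C - {x, y}. (snd y - snd x) * (side c z * (if z \<in> T then 1 else - 1)))"
  proof (intro sum.cong refl)
    fix c z assume c: "c \<in> {x, y}" and z: "z \<in> C - {x, y}"
    have "eps c * dy ?s c = snd y - snd x" using c xy T(5) by (auto simp: dys)
    moreover have "eps z * dz ?s z = (if z \<in> T then 1 else - 1)"
      using z eps_cases[of z] by (auto simp: slide_floor_def vertical_floor_def dz_def plug_def)
    moreover have "side c z * eps c * eps z * dy ?s c * dz ?s z = (eps c * dy ?s c) * (side c z * (eps z * dz ?s z))"
      by (simp only: mult_ac)
    ultimately show "side c z * eps c * eps z * dy ?s c * dz ?s z = (snd y - snd x) * (side c z * (if z \<in> T then 1 else - 1))"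
      by (simp only: mult_ac)
  qed
  finally show ?thesis by (simp only: move_weight_def sum_distrib_left)
qed

lemma card_move: "T \<subseteq> C \<Longrightarrow> x \<in> T \<Longrightarrow> y \<in> C - T \<Longrightarrow> card (insert y (T - {x})) = card T"
  using fin finite_subset[of T C] card_Suc_Diff1[of T x] by (subst card_insert_disjoint) auto

text \<open>If \<open>eps x = 1\<close>, then neither \<open>x\<close> nor \<open>y\<close> belongs
  to \<open>plug T\<close>, so a domino can be laid on them. The upright floor that follows undoes
  the complement and leaves \<open>plug T\<close> enlarged by both squares.\<close>

lemma move_black:
  assumes T: "T \<subseteq> C" "x \<in> T" "y \<in> C - T" "nb x y" "eps x = 1" and n: "card T = token_count"
  shows "W.wk 2 (plug T) (plug (insert y (T - {x}))) (of_int (move_weight T x y) / 4)"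
proof -
  let ?p = "plug T"
  have ey: "eps y = - 1" using nb_eps[OF T(4)] T(5) by simp
  have pp: "?p \<in> plugs" using plug_mem[OF T(1)] n by simp
  have s: "slide_floor C ?p x y \<in> floors C ?p (C - ?p - {x, y})"
    using T ey by (intro slide_floor_floors) (auto simp: plug_def)
  have q: "C - ?p - {x, y} \<in> plugs" by (rule plugs_closed[OF s pp])
  have "W.wk (1 + 1) ?p (C - (C - ?p - {x, y})) (om (slide_floor C ?p x y) + 0)"
    by (rule W.wk_append[OF W.wk_step[OF s q] wk_vertical[OF q]])
  moreover have "C - (C - ?p - {x, y}) = plug (insert y (T - {x}))"
    using T ey by (auto simp: plug_def)
  ultimately show ?thesis by (simp only: om_def tw4_slide_floor[OF T] one_add_one add_0_right)
qed

text \<open>A token on a square of the other colour moves by the reversed walk of the opposite move.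
  Reversal negates the weight, and so does exchanging \<open>x\<close> and \<open>y\<close>.\<close>

lemma move:
  assumes T: "T \<subseteq> C" "x \<in> T" "y \<in> C - T" "nb x y" and n: "card T = token_count"
  shows "W.wk 2 (plug T) (plug (insert y (T - {x}))) (of_int (move_weight T x y) / 4)"
proof (cases "eps x = 1")
  case True
  then show ?thesis using move_black assms by blast
next
  case False
  then have ey: "eps y = 1" using nb_eps[OF T(4)] eps_cases[of x] by auto
  let ?T = "insert y (T - {x})"
  have T': "?T \<subseteq> C" "y \<in> ?T" "x \<in> C - ?T" "nb y x" using T nb_sym nb_neq[OF T(4)] by auto
  have c: "card ?T = token_count" using card_move[OF T(1-3)] n by simp
  have "W.wk 2 (plug ?T) (plug (insert x (?T - {y}))) (of_int (move_weight ?T y x) / 4)"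
    by (rule move_black[OF T' ey c])
  moreover have "insert x (?T - {y}) = T" using T by auto
  ultimately have "W.wk 2 (plug T) (plug ?T) (- (of_int (move_weight ?T y x) / 4))"
    using W.wk_rev plug_mem[OF T'(1)] c by auto
  moreover have "move_weight ?T y x = - move_weight T x y"
  proof -
    have "(\<Sum>e\<in>{y, x}. \<Sum>z\<in>C - {y, x}. side e z * (if z \<in> ?T then 1 else - 1))
        = (\<Sum>e\<in>{x, y}. \<Sum>z\<in>C - {x, y}. side e z * (if z \<in> T then 1 else - 1))"
      by (intro sum.cong) auto
    then show ?thesis unfolding move_weight_def by (simp add: algebra_simps)
  qed
  ultimately show ?thesis by simp
qed

text \<open>Crossing an edge in both directions cancels the influence of all squares equally
  occupied at the two times; only \<open>m\<close> and \<open>n\<close> remain, with opposite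
  signs.\<close>

lemma move_weight_back:
  assumes "m \<in> C - {x, y}" "n \<in> C - {x, y}" "m \<noteq> n" "m \<in> T" "m \<notin> T'" "n \<in> T'" "n \<notin> T"
    and "\<And>z. z \<in> C - {x, y, m, n} \<Longrightarrow> z \<in> T \<longleftrightarrow> z \<in> T'"
  shows "move_weight T x y + move_weight T' y x = (snd y - snd x) * (\<Sum>e\<in>{x, y}. 2 * (side e m - side e n))"
proof -
  have "move_weight T' y x = - ((snd y - snd x) * (\<Sum>e\<in>{x, y}. \<Sum>z\<in>C - {x, y}. side e z * (if z \<in> T' then 1 else - 1)))"
    unfolding move_weight_def insert_commute[of y x] by (simp add: algebra_simps)
  then have "move_weight T x y + move_weight T' y x = (snd y - snd x) * (\<Sum>e\<in>{x, y}. \<Sum>z\<in>C - {x, y}.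
      side e z * (if z \<in> T then 1 else - 1) - side e z * (if z \<in> T' then 1 else - 1))"
    unfolding move_weight_def by (simp only: sum_subtractf right_diff_distrib)
  also have "(\<Sum>e\<in>{x, y}. \<Sum>z\<in>C - {x, y}. side e z * (if z \<in> T then 1 else - 1) - side e z * (if z \<in> T' then 1 else - 1))
      = (\<Sum>e\<in>{x, y}. \<Sum>z\<in>{m, n}. side e z * (if z \<in> T then 1 else - 1) - side e z * (if z \<in> T' then 1 else - 1))"
    using assms fin by (intro sum.cong refl sum.mono_neutral_right) auto
  also have "\<dots> = (\<Sum>e\<in>{x, y}. 2 * (side e m - side e n))"
    using assms by (intro sum.cong refl) simp
  finally show ?thesis .
qed

end

locale connected_board = board +
  assumes conn: "\<And>x y. x \<in> C \<Longrightarrow> y \<in> C \<Longrightarrow> (x, y) \<in> {(a, b). a \<in> C \<and> b \<in> C \<and> nb a b}\<^sup>*"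
    and tripod: "\<exists>c\<in>C. \<exists>a\<in>C. \<exists>b\<in>C. \<exists>d\<in>C. nb c a \<and> nb c b \<and> nb c d \<and> a \<noteq> b \<and> a \<noteq> d \<and> b \<noteq> d"
begin

definition linked :: "(int \<times> int) set \<Rightarrow> (int \<times> int) set \<Rightarrow> bool" where
  "linked p q \<longleftrightarrow> (\<exists>n w. W.wk (2 * n) p q w)"

lemma linked_trans: "linked p q \<Longrightarrow> linked q r \<Longrightarrow> linked p r"
proof -
  assume "linked p q" "linked q r"
  then obtain n w m w' where "W.wk (2 * n) p q w" "W.wk (2 * m) q r w'" unfolding linked_def by blast
  then have "W.wk (2 * (n + m)) p r (w + w')" unfolding distrib_left by (rule W.wk_append)
  then show "linked p r" unfolding linked_def by blast
qed

lemma linked_move: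
  assumes "T \<subseteq> C" "x \<in> T" "y \<in> C - T" "nb x y" "card T = token_count"
  shows "linked (plug T) (plug (insert y (T - {x})))"
  unfolding linked_def using move[OF assms] by (intro exI[of _ "1 :: nat"]) auto

text \<open>Tokens are indistinguishable. If the next square of the path is occupied, its token
  travels on to \<open>y\<close> first, and then the token from \<open>x\<close> takes the vacated
  square.\<close>

lemma linked_slide:
  assumes "(x, y) \<in> {(a, b). a \<in> C \<and> b \<in> C \<and> nb a b}\<^sup>*" "T \<subseteq> C" "x \<in> T" "y \<in> C - T" "card T = token_count"
  shows "linked (plug T) (plug (insert y (T - {x})))"
  using assms
proof (induction arbitrary: T rule: converse_rtrancl_induct)
  case base
  then show ?case by simp
next
  case (step x x')
  then have xx: "x \<in> C" "x' \<in> C" "nb x x'" by auto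
  show ?case
  proof (cases "x' \<in> T")
    case False
    let ?T = "insert x' (T - {x})"
    have 1: "linked (plug T) (plug ?T)" using False step.prems xx by (intro linked_move) auto
    show ?thesis
    proof (cases "x' = y")
      case True
      then show ?thesis using 1 by simp
    next
      case neq: False
      have "linked (plug ?T) (plug (insert y (?T - {x'})))"
        using step.prems xx neq False card_move[of T x x'] by (intro step.IH) auto
      moreover have "?T - {x'} = T - {x}" using False by auto
      ultimately show ?thesis using linked_trans[OF 1] by simp
    qed
  next
    case True
    let ?T = "insert y (T - {x'})"
    have 1: "linked (plug T) (plug ?T)" using True step.prems by (intro step.IH) auto
    have "linked (plug ?T) (plug (insert x' (?T - {x})))"
      using step.prems xx True nb_neq[OF xx(3)] card_move[of T x' y] by (intro linked_move) auto
    moreover have "insert x' (?T - {x}) = insert y (T - {x})"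
      using True step.prems nb_neq[OF xx(3)] by auto
    ultimately show ?thesis using linked_trans[OF 1] by simp
  qed
qed

text \<open>A misplaced token slides to a missing position along a path in the board; each such
  slide lowers the number of misplaced tokens by one.\<close>

lemma linked_tokens:
  assumes "T \<subseteq> C" "T' \<subseteq> C" "card T = token_count" "card T' = token_count"
  shows "linked (plug T) (plug T')"
  using assms
proof (induction "card (T - T')" arbitrary: T)
  case 0
  have "finite T" "finite T'" using 0 fin finite_subset by auto
  then have "T \<subseteq> T'" using 0 by auto
  then have "T = T'" using 0 \<open>finite T'\<close> by (intro card_subset_eq) auto
  moreover have "plug T' \<in> plugs" using plug_mem 0 by simp
  ultimately show ?case unfolding linked_def using wk_pad by blast
next
  case (Suc k)
  have f: "finite T" "finite T'" using Suc.prems fin finite_subset by auto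
  have "T - T' \<noteq> {}" using Suc.hyps(2) by (metis card.empty nat.distinct(1))
  then obtain x where x: "x \<in> T - T'" by blast
  have "card (T' - T) = card (T - T')"
    using card_le_sym_Diff[of T T'] card_le_sym_Diff[of T' T] f Suc.prems by simp
  then have "T' - T \<noteq> {}" using Suc.hyps(2) by (metis card.empty nat.distinct(1))
  then obtain y where y: "y \<in> T' - T" by blast
  let ?T = "insert y (T - {x})"
  have 1: "linked (plug T) (plug ?T)" using x y Suc.prems conn[of x y] by (intro linked_slide) auto
  have "?T - T' = (T - T') - {x}" using x y by auto
  then have "card (?T - T') = k" using Suc.hyps(2) x f by simp
  then have "linked (plug ?T) (plug T')"
    using Suc.prems x y card_move[of T x y] by (intro Suc.hyps(1)) auto
  with 1 show ?case by (rule linked_trans)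
qed

lemma linked_plugs:
  assumes "p \<in> plugs" "q \<in> plugs"
  shows "linked p q"
proof -
  have pq: "p \<subseteq> C" "q \<subseteq> C" using assms by (auto simp: plugs_def)
  have "plug p \<subseteq> C" "plug q \<subseteq> C" by (auto simp: plug_def)
  moreover have "card (plug p) = token_count" "card (plug q) = token_count"
    using plug_mem[OF \<open>plug p \<subseteq> C\<close>] plug_mem[OF \<open>plug q \<subseteq> C\<close>] assms pq by (simp_all add: plug_plug)
  ultimately show ?thesis using linked_tokens[of "plug p" "plug q"] pq by (simp add: plug_plug)
qed

text \<open>Even lengths come from padding a link. Odd lengths start with one upright floor to
  \<open>C - p\<close> and then use a padded link from there.\<close>

lemma eventually_wk:
  assumes "p \<in> plugs" "q \<in> plugs"
  shows "\<exists>n0. \<forall>n\<ge>n0. \<exists>w. W.wk n p q w"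
proof -
  obtain a w where a: "W.wk (2 * a) p q w" using linked_plugs[OF assms] by (auto simp: linked_def)
  obtain b w' where b: "W.wk (2 * b) (C - p) q w'"
    using linked_plugs[OF plugs_compl[OF assms(1)] assms(2)] by (auto simp: linked_def)
  have "\<exists>w. W.wk n p q w" if n: "n \<ge> 2 * a + 2 * b + 1" for n
  proof (cases "even n")
    case True
    then obtain k where k: "n = 2 * k" by (auto elim: evenE)
    then have "n = 2 * (k - a) + 2 * a" using n by simp
    then show ?thesis using W.wk_append[OF wk_pad[OF assms(1)] a] by metis
  next
    case False
    then obtain k where k: "n = 2 * k + 1" by (auto elim: oddE)
    then have e: "n = 1 + (2 * (k - b) + 2 * b)" using n by simp
    show ?thesis unfolding e
      using W.wk_append[OF wk_vertical[OF assms(1)] W.wk_append[OF wk_pad[OF plugs_compl[OF assms(1)]] b]] by blast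
  qed
  then show ?thesis by blast
qed

lemma uniform_wk: "\<exists>n1. \<forall>n\<ge>n1. \<forall>p\<in>plugs. \<forall>q\<in>plugs. \<exists>w. W.wk n p q w"
proof -
  obtain N where N: "\<And>p q n. p \<in> plugs \<Longrightarrow> q \<in> plugs \<Longrightarrow> n \<ge> N p q \<Longrightarrow> \<exists>w. W.wk n p q w"
    using eventually_wk by metis
  define n1 where "n1 = (\<Sum>p\<in>plugs. \<Sum>q\<in>plugs. N p q)"
  have "N p q \<le> n1" if "p \<in> plugs" "q \<in> plugs" for p q
  proof -
    have "N p q \<le> (\<Sum>q\<in>plugs. N p q)" using W.finS that by (intro member_le_sum) auto
    also have "\<dots> \<le> n1" unfolding n1_def
      using W.finS that by (intro member_le_sum[of p plugs "\<lambda>p. \<Sum>q\<in>plugs. N p q"]) auto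
    finally show ?thesis .
  qed
  then show ?thesis using N by (metis order_trans)
qed

text \<open>Three distinct neighbours can be placed around \<open>c\<close> in 24 ways, all checked
  directly. The value 4 becomes 1 after the division by 4 in \<open>om\<close>.\<close>

lemma tripod_weight:
  assumes "nb c a" "nb c b" "nb c d" "a \<noteq> b" "a \<noteq> d" "b \<noteq> d"
  shows "\<bar>(snd c - snd a) * (\<Sum>e\<in>{a, c}. 2 * (side e b - side e d))
    + (snd d - snd c) * (\<Sum>e\<in>{c, d}. 2 * (side e b - side e a))
    + (snd c - snd b) * (\<Sum>e\<in>{b, c}. 2 * (side e d - side e a))\<bar> = 4"
proof -
  have "c \<noteq> a" "c \<noteq> b" "c \<noteq> d" using assms nb_neq by auto
  then have s: "(\<Sum>e\<in>{a, c}. g e) = g a + g c" "(\<Sum>e\<in>{c, d}. g e) = g c + g d" "(\<Sum>e\<in>{b, c}. g e) = g b + g c"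
    for g :: "int \<times> int \<Rightarrow> int" by auto
  obtain i j where c: "c = (i, j)" by (cases c)
  have dirs: "z = (i + 1, j) \<or> z = (i - 1, j) \<or> z = (i, j + 1) \<or> z = (i, j - 1)" if "nb c z" for z
    using that by (cases z) (auto simp: nb_def c)
  show ?thesis unfolding s
    using dirs[OF assms(1)] dirs[OF assms(2)] dirs[OF assms(3)] assms(4-6)
    by (elim disjE) (simp_all add: c side_def)
qed

text \<open>Two tokens exchange their places around the tripod. Every edge is traversed once in each
  direction, so that only the squares of the tripod contribute to the weight.\<close>

lemma exchange_loop:
  "\<exists>p\<in>plugs. \<exists>w. W.wk 12 p p w \<and> W.wk 12 p p (w + 1)"
proof -
  obtain c a b d where abc: "c \<in> C" "a \<in> C" "b \<in> C" "d \<in> C" "nb c a" "nb c b" "nb c d" "a \<noteq> b" "a \<noteq> d" "b \<noteq> d"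
    using tripod by blast
  have cn: "c \<noteq> a" "c \<noteq> b" "c \<noteq> d" using abc nb_neq by auto
  have nb': "nb a c" "nb b c" "nb d c" using abc nb_sym by auto
  \<comment> \<open>By balance, tokens fill half the board. As the tripod has four squares, there
    are at least two tokens, and the remaining ones fit outside the tripod.\<close>
  have half: "2 * token_count = card C"
  proof -
    have "(\<Sum>c\<in>C. 2 * (if eps c = 1 then 1 else 0) :: int) = (\<Sum>c\<in>C. 1 + eps c)"
      using eps_cases by (intro sum.cong refl) fastforce
    then have "2 * int token_count = int (card C)"
      using fin bal by (simp add: token_count_def sum.distrib sum_distrib_left[symmetric] sum.inter_filter[symmetric])
    then show ?thesis by simp
  qed
  have "card {a, b, c, d} \<le> card C" using abc fin by (intro card_mono) auto
  then have "token_count \<ge> 2" using half abc cn by simp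
  have "card (C - {a, b, c, d}) = card C - 4"
    using abc cn by (subst card_Diff_subset) auto
  then have "token_count - 2 \<le> card (C - {a, b, c, d})" using half \<open>token_count \<ge> 2\<close> by simp
  then obtain X where X: "X \<subseteq> C - {a, b, c, d}" "card X = token_count - 2"
    by (rule obtain_subset_with_card_n)
  have fX: "finite X" using X fin finite_subset by (metis finite_Diff)
  \<comment> \<open>The first token goes from \<open>a\<close> through \<open>c\<close> to
    \<open>d\<close>, the second from \<open>b\<close> through \<open>c\<close> to \<open>a\<close>,
    and then the first from \<open>d\<close> through \<open>c\<close> to \<open>b\<close>. The
    tokens \<open>X\<close> never move.\<close>
  define T0 where "T0 = {a, b} \<union> X"
  define T1 where "T1 = {c, b} \<union> X"
  define T2 where "T2 = {d, b} \<union> X"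
  define T3 where "T3 = {d, c} \<union> X"
  define T4 where "T4 = {d, a} \<union> X"
  define T5 where "T5 = {c, a} \<union> X"
  note Td = T0_def T1_def T2_def T3_def T4_def T5_def
  have ct: "card T0 = token_count" "card T1 = token_count" "card T2 = token_count" "card T3 = token_count" "card T4 = token_count" "card T5 = token_count"
    unfolding Td using X fX abc cn \<open>token_count \<ge> 2\<close> by (simp_all add: subset_Diff_insert)
  have sub: "T0 \<subseteq> C" "T1 \<subseteq> C" "T2 \<subseteq> C" "T3 \<subseteq> C" "T4 \<subseteq> C" "T5 \<subseteq> C"
    unfolding Td using X abc by auto
  have m1: "insert c (T0 - {a}) = T1" and m2: "insert d (T1 - {c}) = T2" and m3: "insert c (T2 - {b}) = T3"
    and m4: "insert a (T3 - {c}) = T4" and m5: "insert c (T4 - {d}) = T5" and m6: "insert b (T5 - {c}) = T0"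
    unfolding Td using X abc cn by auto
  have w1: "W.wk 2 (plug T0) (plug T1) (of_int (move_weight T0 a c) / 4)"
    using move[of T0 a c] X abc cn nb' ct sub unfolding m1 by (auto simp: Td)
  have w2: "W.wk 2 (plug T1) (plug T2) (of_int (move_weight T1 c d) / 4)"
    using move[of T1 c d] X abc cn nb' ct sub unfolding m2 by (auto simp: Td)
  have w3: "W.wk 2 (plug T2) (plug T3) (of_int (move_weight T2 b c) / 4)"
    using move[of T2 b c] X abc cn nb' ct sub unfolding m3 by (auto simp: Td)
  have w4: "W.wk 2 (plug T3) (plug T4) (of_int (move_weight T3 c a) / 4)"
    using move[of T3 c a] X abc cn nb' ct sub unfolding m4 by (auto simp: Td)
  have w5: "W.wk 2 (plug T4) (plug T5) (of_int (move_weight T4 d c) / 4)"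
    using move[of T4 d c] X abc cn nb' ct sub unfolding m5 by (auto simp: Td)
  have w6: "W.wk 2 (plug T5) (plug T0) (of_int (move_weight T5 c b) / 4)"
    using move[of T5 c b] X abc cn nb' ct sub unfolding m6 by (auto simp: Td)
  define w where "w = move_weight T0 a c + move_weight T1 c d + move_weight T2 b c + move_weight T3 c a + move_weight T4 d c + move_weight T5 c b"
  have loop: "W.wk 12 (plug T0) (plug T0) (of_int w / 4)"
    using W.wk_append[OF w1 W.wk_append[OF w2 W.wk_append[OF w3 W.wk_append[OF w4 W.wk_append[OF w5 w6]]]]]
    by (simp add: w_def add_divide_distrib add.assoc)
  have e1: "move_weight T0 a c + move_weight T3 c a = (snd c - snd a) * (\<Sum>e\<in>{a, c}. 2 * (side e b - side e d))"
    using X abc cn by (intro move_weight_back) (auto simp: Td)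
  have e2: "move_weight T1 c d + move_weight T4 d c = (snd d - snd c) * (\<Sum>e\<in>{c, d}. 2 * (side e b - side e a))"
    using X abc cn by (intro move_weight_back) (auto simp: Td)
  have e3: "move_weight T2 b c + move_weight T5 c b = (snd c - snd b) * (\<Sum>e\<in>{b, c}. 2 * (side e d - side e a))"
    using X abc cn by (intro move_weight_back) (auto simp: Td)
  have "\<bar>w\<bar> = 4" using tripod_weight[OF abc(5-10)] e1 e2 e3 by (simp add: w_def)
  then have w: "w = 4 \<or> w = - 4" by auto
  have pl: "plug T0 \<in> plugs" using plug_mem sub ct by simp
  \<comment> \<open>An idle walk of the same length for comparison. Depending on the sign of
    \<open>w\<close>, the smaller of the two weights is 0 or -1.\<close>
  have "W.wk 12 (plug T0) (plug T0) 0" using wk_pad[OF pl, of 6] by simp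
  then show ?thesis using w loop pl by (intro bexI[OF _ pl]) (auto intro: exI[of _ "0::real"] exI[of _ "- 1::real"])
qed

lemma local_limit_twist:
  "\<exists>C0 C1 :: real. C0 > 0 \<and> C1 > 0 \<and>
    (\<forall>(t :: nat \<Rightarrow> int) (\<tau> :: real).
      (\<lambda>N. real_of_int (t N) / sqrt (real N)) \<longlonglongrightarrow> \<tau> \<longrightarrow>
      (\<lambda>N. sqrt (real N) * (card {l \<in> W.walks N {} {}. W.weight l = of_int (t N)} / card (W.walks N {} {})))
        \<longlonglongrightarrow> C0 * exp (- C1 * \<tau>\<^sup>2))"
    "\<exists>n1. \<forall>N\<ge>n1. W.walks N {} {} \<noteq> {}"
proof -
  obtain n1 where n1: "\<And>n p q. n \<ge> n1 \<Longrightarrow> p \<in> plugs \<Longrightarrow> q \<in> plugs \<Longrightarrow> \<exists>w. W.wk n p q w"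
    using uniform_wk by blast
  obtain r w where r: "r \<in> plugs" "W.wk 12 r r w" "W.wk 12 r r (w + 1)" using exchange_loop by blast
  \<comment> \<open>Between any two plugs, the walk goes to \<open>r\<close> in \<open>n1\<close>
    steps, takes one of its two loops of length 12 and goes on in \<open>n1\<close> steps; this
    gives equal lengths and weights one apart.\<close>
  interpret X: span_floor_walks plugs "{}" "floors C" om flip n1 "n1 + (12 + n1)"
  proof
    show "W.walks n p q \<noteq> {}" if "n \<ge> n1" "p \<in> plugs" "q \<in> plugs" for n p q
      using n1[OF that] by (auto simp: W.wk_def)
    show "\<exists>w. W.wk (n1 + (12 + n1)) p q w \<and> W.wk (n1 + (12 + n1)) p q (w + 1)"
      if p: "p \<in> plugs" and q: "q \<in> plugs" for p q
    proof -
      obtain w1 w2 where w: "W.wk n1 p r w1" "W.wk n1 r q w2" using n1[OF order_refl] p q r(1) by blast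
      show ?thesis
        using W.wk_append[OF w(1) W.wk_append[OF r(2) w(2)]] W.wk_append[OF w(1) W.wk_append[OF r(3) w(2)]]
        by (intro exI[of _ "w1 + (w + w2)"]) (simp add: add_ac)
    qed
    show "W.weight l \<in> \<int>" if "l \<in> W.walks n {} {}" for n l by (rule weight_integral[OF that])
  qed simp
  show "\<exists>C0 C1 :: real. C0 > 0 \<and> C1 > 0 \<and>
    (\<forall>(t :: nat \<Rightarrow> int) (\<tau> :: real).
      (\<lambda>N. real_of_int (t N) / sqrt (real N)) \<longlonglongrightarrow> \<tau> \<longrightarrow>
      (\<lambda>N. sqrt (real N) * (card {l \<in> W.walks N {} {}. W.weight l = of_int (t N)} / card (W.walks N {} {})))
        \<longlonglongrightarrow> C0 * exp (- C1 * \<tau>\<^sup>2))"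
    by (rule X.local_limit)
  show "\<exists>n1. \<forall>N\<ge>n1. W.walks N {} {} \<noteq> {}" using X.prim W.o0 by blast
qed

end

section \<open>Unit squares and cubes\<close>

lemma mem_lattice_cube:
  "x \<in> lattice_cube c \<longleftrightarrow> (\<forall>i. of_int (c $ i) \<le> x $ i \<and> x $ i \<le> of_int (c $ i) + 1)"
  by (simp add: lattice_cube_def mem_box_cart)

lemma closed_lattice_cube: "closed (lattice_cube c)"
  by (simp add: lattice_cube_def closed_cbox)

lemma int_near_half: "real_of_int m \<le> of_int n + 1 / 2 \<Longrightarrow> of_int n + 1 / 2 \<le> real_of_int m + 1 \<Longrightarrow> m = n"
  by linarith

lemma cube_center_mem_iff: "cube_center c \<in> lattice_cube c' \<longleftrightarrow> c = c'"
proof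
  assume "cube_center c \<in> lattice_cube c'"
  then have "of_int (c' $ i) \<le> real_of_int (c $ i) + 1 / 2" "real_of_int (c $ i) + 1 / 2 \<le> of_int (c' $ i) + 1" for i
    by (simp_all add: mem_lattice_cube cube_center_def)
  then have "c' $ i = c $ i" for i using int_near_half by blast
  then show "c = c'" by (simp add: vec_eq_iff)
qed (simp add: mem_lattice_cube cube_center_def)

lemma cube_center_interior: "lattice_cube c \<subseteq> d \<Longrightarrow> cube_center c \<in> interior d"
proof -
  assume "lattice_cube c \<subseteq> d"
  then have "box (\<chi> i. real_of_int (c $ i)) (\<chi> i. real_of_int (c $ i) + 1) \<subseteq> d"
    unfolding lattice_cube_def using box_subset_cbox by blast
  moreover have "cube_center c \<in> box (\<chi> i. real_of_int (c $ i)) (\<chi> i. real_of_int (c $ i) + 1)"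
    by (simp add: mem_box_cart cube_center_def)
  ultimately show ?thesis by (meson interiorI open_box)
qed

lemma lattice_cube_subset_UN: "lattice_cube c \<subseteq> (\<Union>c'\<in>A. lattice_cube c') \<longleftrightarrow> c \<in> A"
proof
  assume "lattice_cube c \<subseteq> (\<Union>c'\<in>A. lattice_cube c')"
  then have "cube_center c \<in> (\<Union>c'\<in>A. lattice_cube c')" using cube_center_mem_iff[of c c] by blast
  then show "c \<in> A" by (auto simp: cube_center_mem_iff)
qed auto

lemma lattice_cube_subset_Un: "lattice_cube c \<subseteq> lattice_cube p \<union> lattice_cube q \<longleftrightarrow> c = p \<or> c = q"
  using lattice_cube_subset_UN[of c "{p, q}"] by simp

lemma negligible_cube_inter: "c \<noteq> c' \<Longrightarrow> negligible (lattice_cube c \<inter> lattice_cube c')"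
proof -
  assume "c \<noteq> c'"
  then obtain i where i: "c $ i \<noteq> c' $ i" by (auto simp: vec_eq_iff)
  have "x $ i = of_int (max (c $ i) (c' $ i))" if "x \<in> lattice_cube c \<inter> lattice_cube c'" for x
  proof -
    have "of_int (c $ i) \<le> x $ i" "x $ i \<le> of_int (c $ i) + 1" "of_int (c' $ i) \<le> x $ i" "x $ i \<le> of_int (c' $ i) + 1"
      using that by (auto simp: mem_lattice_cube)
    then show ?thesis using i by linarith
  qed
  then have "lattice_cube c \<inter> lattice_cube c' \<subseteq> {x. x $ i = of_int (max (c $ i) (c' $ i))}" by auto
  moreover have "negligible {x. x $ i = (of_int (max (c $ i) (c' $ i)) :: real)}"
    by (simp only: cart_eq_inner_axis) (rule negligible_standard_hyperplane, simp add: axis_in_Basis_iff)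
  ultimately show ?thesis by (rule negligible_subset[rotated])
qed

text \<open>The intersection is open and covered by finitely many sets of the form cube intersected
  with another cube. These are null sets, and an open null set is empty.\<close>

lemma interior_cubes_disjoint:
  assumes "finite A" "finite B" "A \<inter> B = {}"
  shows "interior (\<Union>c\<in>A. lattice_cube c) \<inter> interior (\<Union>c\<in>B. lattice_cube c) = {}"
proof -
  have 1: "negligible (\<Union>c'\<in>B. lattice_cube c \<inter> lattice_cube c')" if "c \<in> A" for c
  proof (intro negligible_Union finite_imageI assms(2))
    fix t assume "t \<in> (\<lambda>c'. lattice_cube c \<inter> lattice_cube c') ` B"
    then obtain c' where "t = lattice_cube c \<inter> lattice_cube c'" "c \<noteq> c'" using assms(3) \<open>c \<in> A\<close> by blast
    then show "negligible t" by (simp add: negligible_cube_inter)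
  qed
  have "negligible (\<Union>c\<in>A. \<Union>c'\<in>B. lattice_cube c \<inter> lattice_cube c')"
    by (intro negligible_Union finite_imageI assms(1)) (use 1 in blast)
  moreover have "interior (\<Union>c\<in>A. lattice_cube c) \<inter> interior (\<Union>c\<in>B. lattice_cube c)
      \<subseteq> (\<Union>c\<in>A. \<Union>c'\<in>B. lattice_cube c \<inter> lattice_cube c')"
  proof
    fix x assume "x \<in> interior (\<Union>c\<in>A. lattice_cube c) \<inter> interior (\<Union>c\<in>B. lattice_cube c)"
    then have "x \<in> (\<Union>c\<in>A. lattice_cube c)" "x \<in> (\<Union>c\<in>B. lattice_cube c)"
      using interior_subset by (meson IntD1 IntD2 subsetD)+
    then show "x \<in> (\<Union>c\<in>A. \<Union>c'\<in>B. lattice_cube c \<inter> lattice_cube c')" by blast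
  qed
  ultimately have "negligible (interior (\<Union>c\<in>A. lattice_cube c) \<inter> interior (\<Union>c\<in>B. lattice_cube c))"
    by (rule negligible_subset)
  then show ?thesis using open_not_negligible[OF open_Int[OF open_interior open_interior]] by auto
qed

lemma squares_UN: "squares (\<Union>c\<in>S. lattice_cube c) = S"
  by (auto simp: squares_def lattice_cube_subset_UN)

lemma squares_disk:
  assumes "quadriculated_disk D"
  shows "finite (squares D)" "D = (\<Union>c\<in>squares D. lattice_cube c)"
proof -
  obtain S where "finite S" "D = (\<Union>c\<in>S. lattice_cube c)" using assms by (auto simp: quadriculated_disk_def)
  then show "finite (squares D)" "D = (\<Union>c\<in>squares D. lattice_cube c)" by (simp_all add: squares_UN)
qed

lemma adjacent_2:
  "adjacent c (c' :: int ^ 2) \<longleftrightarrow> \<bar>c $ 1 - c' $ 1\<bar> + \<bar>c $ 2 - c' $ 2\<bar> = 1"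
proof
  assume "adjacent c c'"
  then obtain i where "c - c' = axis i 1 \<or> c' - c = axis i 1" by (auto simp: adjacent_def)
  then show "\<bar>c $ 1 - c' $ 1\<bar> + \<bar>c $ 2 - c' $ 2\<bar> = 1"
    using exhaust_2[of i] by (auto simp: vec_eq_iff forall_2 axis_def)
next
  assume "\<bar>c $ 1 - c' $ 1\<bar> + \<bar>c $ 2 - c' $ 2\<bar> = 1"
  then have "(c $ 1 - c' $ 1 = 1 \<and> c $ 2 - c' $ 2 = 0) \<or> (c' $ 1 - c $ 1 = 1 \<and> c' $ 2 - c $ 2 = 0)
     \<or> (c $ 1 - c' $ 1 = 0 \<and> c $ 2 - c' $ 2 = 1) \<or> (c' $ 1 - c $ 1 = 0 \<and> c' $ 2 - c $ 2 = 1)"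
    by linarith
  then have "c - c' = axis 1 1 \<or> c' - c = axis 1 1 \<or> c - c' = axis 2 1 \<or> c' - c = axis 2 1"
    by (auto simp: vec_eq_iff forall_2 axis_def)
  then show "adjacent c c'" unfolding adjacent_def by blast
qed

lemma nonadjacent_cubes:
  assumes "c \<noteq> c'" "\<not> adjacent c (c' :: int ^ 2)"
  shows "lattice_cube c \<inter> lattice_cube c' \<subseteq> {\<chi> i. of_int (max (c $ i) (c' $ i))}"
proof
  fix x assume x: "x \<in> lattice_cube c \<inter> lattice_cube c'"
  have b: "of_int (c $ i) \<le> x $ i" "x $ i \<le> of_int (c $ i) + 1" "of_int (c' $ i) \<le> x $ i" "x $ i \<le> of_int (c' $ i) + 1" for i
    using x by (auto simp: mem_lattice_cube)
  have le: "\<bar>c $ i - c' $ i\<bar> \<le> 1" for i using b[of i] by linarith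
  have "c $ 1 \<noteq> c' $ 1 \<or> c $ 2 \<noteq> c' $ 2" using assms(1) by (auto simp: vec_eq_iff forall_2)
  then have "c $ 1 \<noteq> c' $ 1" "c $ 2 \<noteq> c' $ 2"
    using assms(2) le[of 1] le[of 2] unfolding adjacent_2 by linarith+
  then have "x $ 1 = of_int (max (c $ 1) (c' $ 1))" "x $ 2 = of_int (max (c $ 2) (c' $ 2))"
    using b[of 1] b[of 2] by linarith+
  then show "x \<in> {\<chi> i. of_int (max (c $ i) (c' $ i))}" by (simp add: vec_eq_iff forall_2)
qed

text \<open>Squares without a common edge meet in at most one point, and removing finitely many points
  does not disconnect a disk.\<close>

lemma squares_connected:
  assumes D: "quadriculated_disk D" and x: "x \<in> squares D" and y: "y \<in> squares D"
  shows "(x, y) \<in> {(a, b). a \<in> squares D \<and> b \<in> squares D \<and> adjacent a b}\<^sup>*"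
proof (rule ccontr)
  assume xy: "(x, y) \<notin> {(a, b). a \<in> squares D \<and> b \<in> squares D \<and> adjacent a b}\<^sup>*"
  let ?R = "{(a, b). a \<in> squares D \<and> b \<in> squares D \<and> adjacent a b}"
  define A where "A = {z \<in> squares D. (x, z) \<in> ?R\<^sup>*}"
  define B where "B = squares D - A"
  define DA where "DA = (\<Union>c\<in>A. lattice_cube c)"
  define DB where "DB = (\<Union>c\<in>B. lattice_cube c)"
  note sq = squares_disk[OF D]
  have fin: "finite A" "finite B" using sq(1) by (auto simp: A_def B_def)
  have xA: "x \<in> A" and yB: "y \<in> B" using x y xy by (auto simp: A_def B_def)
  have na: "c \<noteq> c' \<and> \<not> adjacent c c'" if "c \<in> A" "c' \<in> B" for c c'
  proof -
    have "\<not> adjacent c c'"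
    proof
      assume "adjacent c c'"
      then have "(c, c') \<in> ?R" using that by (auto simp: A_def B_def)
      then have "c' \<in> A" using that by (auto simp: A_def B_def intro: rtrancl_into_rtrancl)
      then show False using that by (auto simp: B_def)
    qed
    then show ?thesis using that by (auto simp: B_def)
  qed
  define F where "F = DA \<inter> DB"
  have "F \<subseteq> (\<Union>c\<in>A. \<Union>c'\<in>B. {\<chi> i. of_int (max (c $ i) (c' $ i))})"
  proof
    fix z assume "z \<in> F"
    then obtain c c' where c: "c \<in> A" "c' \<in> B" "z \<in> lattice_cube c \<inter> lattice_cube c'"
      unfolding F_def DA_def DB_def by blast
    have "z \<in> {\<chi> i. of_int (max (c $ i) (c' $ i))}"
      using nonadjacent_cubes[of c c'] na[OF c(1,2)] c(3) by blast
    then show "z \<in> (\<Union>c\<in>A. \<Union>c'\<in>B. {\<chi> i. of_int (max (c $ i) (c' $ i))})" using c(1,2) by blast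
  qed
  then have finF: "finite F" by (rule finite_subset) (use fin in auto)
  have Dun: "D = DA \<union> DB" unfolding DA_def DB_def using sq(2) by (auto simp: A_def B_def)
  obtain f g where fg: "homeomorphism D (cball 0 1 :: (real ^ 2) set) f g"
    using D by (auto simp: quadriculated_disk_def homeomorphic_def)
  \<comment> \<open>The planar ball minus a finite set is connected; the same would fail for a
    segment, hence this condition.\<close>
  have "\<not> collinear (cball 0 1 :: (real ^ 2) set)"
    by (simp add: collinear_aff_dim aff_dim_cball)
  then have "connected (cball 0 1 - f ` F)"
    using finF by (intro connected_convex_diff_countable countable_finite) auto
  moreover have "continuous_on (cball 0 1 - f ` F) g"
    using fg by (auto simp: homeomorphism_def intro: continuous_on_subset)
  ultimately have "connected (g ` (cball 0 1 - f ` F))" by (rule connected_continuous_image[rotated])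
  moreover have "g ` (cball 0 1 - f ` F) = D - F"
  proof -
    have "F \<subseteq> D" using Dun by (auto simp: F_def)
    have gf: "\<And>x. x \<in> D \<Longrightarrow> g (f x) = x" "f ` D = cball 0 1" using fg by (auto simp: homeomorphism_def)
    have "cball 0 1 - f ` F = f ` (D - F)"
    proof -
      have "inj_on f D" using gf(1) by (rule inj_on_inverseI)
      then show ?thesis using \<open>F \<subseteq> D\<close> gf(2) by (simp add: inj_on_image_set_diff)
    qed
    then have "g ` (cball 0 1 - f ` F) = (\<lambda>x. g (f x)) ` (D - F)" by (simp add: image_image)
    also have "\<dots> = (\<lambda>x. x) ` (D - F)" by (rule image_cong) (use gf(1) in auto)
    also have "\<dots> = D - F" by simp
    finally show ?thesis .
  qed
  ultimately have con: "connected (D - F)" by simp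
  have cl: "closed DA" "closed DB" unfolding DA_def DB_def
    using fin closed_lattice_cube by (auto intro: closed_UN)
  have "cube_center x \<in> DA" "cube_center x \<notin> DB" "cube_center y \<in> DB" "cube_center y \<notin> DA"
    using xA yB by (auto simp: DA_def DB_def cube_center_mem_iff B_def)
  then have "DA \<inter> (D - F) \<noteq> {}" "DB \<inter> (D - F) \<noteq> {}" using Dun by (auto simp: F_def)
  moreover have "D - F \<subseteq> DA \<union> DB" "DA \<inter> DB \<inter> (D - F) = {}" using Dun by (auto simp: F_def)
  ultimately show False using con cl unfolding connected_closed by blast
qed

lemma black_2: "black (c :: int ^ 2) \<longleftrightarrow> even (c $ 1 + c $ 2)"
  by (simp add: black_def sum_2)

text \<open>The coordinates are ordered so that the axis \<open>a\<close> of the shade comes first;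
  rows of the board then always run along the shade.\<close>

definition plane :: "3 \<Rightarrow> int ^ 2 \<Rightarrow> int \<times> int" where
  "plane a c = (if a = 1 then (c $ 1, c $ 2) else (c $ 2, c $ 1))"

lemma inj_plane: "inj (plane a)"
  by (auto simp: inj_on_def plane_def vec_eq_iff forall_2 split: if_splits)

lemma connected_board_disk:
  assumes D: "quadriculated_disk D" and bal: "balanced D" and nt: "nontrivial D"
  shows "connected_board (plane a ` squares D)"
proof
  let ?S = "squares D"
  have fin: "finite ?S" by (rule squares_disk(1)[OF D])
  show "finite (plane a ` ?S)" using fin by simp
  have eps_plane: "eps (plane a c) = (if black c then 1 else - 1)" for c
    by (auto simp: eps_def plane_def black_2 add.commute)
  have nb_plane: "nb (plane a c) (plane a d) \<longleftrightarrow> adjacent c d" for c d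
    by (simp add: nb_def plane_def adjacent_2 add.commute)
  have "(\<Sum>c\<in>plane a ` ?S. eps c) = (\<Sum>c\<in>?S. if black c then 1 else - 1)"
    by (subst sum.reindex) (auto simp: eps_plane intro: inj_on_subset[OF inj_plane])
  also have "\<dots> = int (card {c \<in> ?S. black c}) - int (card {c \<in> ?S. \<not> black c})"
    using fin by (simp add: sum.If_cases Collect_conj_eq[symmetric] Int_def Compl_eq)
  finally show "(\<Sum>c\<in>plane a ` ?S. eps c) = 0" using bal by (simp add: balanced_def)
  show "(x, y) \<in> {(u, v). u \<in> plane a ` ?S \<and> v \<in> plane a ` ?S \<and> nb u v}\<^sup>*"
    if mem: "x \<in> plane a ` ?S" "y \<in> plane a ` ?S" for x y
  proof -
    obtain x' y' where xy: "x = plane a x'" "y = plane a y'" "x' \<in> ?S" "y' \<in> ?S" using mem by blast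
    have "(x', y') \<in> {(u, v). u \<in> ?S \<and> v \<in> ?S \<and> adjacent u v}\<^sup>*" by (rule squares_connected[OF D xy(3,4)])
    then show ?thesis unfolding xy(1,2)
    proof (induction rule: rtrancl_induct)
      case (step u v)
      then have "(plane a u, plane a v) \<in> {(u, v). u \<in> plane a ` ?S \<and> v \<in> plane a ` ?S \<and> nb u v}"
        using nb_plane by auto
      then show ?case using step.IH by (rule rtrancl_into_rtrancl[rotated])
    qed simp
  qed
  obtain c where c: "c \<in> ?S" "card {c' \<in> ?S. adjacent c c'} \<ge> 3" using nt by (auto simp: nontrivial_def)
  then obtain Y where Y: "Y \<subseteq> {c' \<in> ?S. adjacent c c'}" "card Y = 3" by (meson obtain_subset_with_card_n)
  then obtain p q r where "Y = {p, q, r}" "p \<noteq> q" "p \<noteq> r" "q \<noteq> r" by (auto simp: card_3_iff)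
  then have pqr: "p \<in> ?S" "q \<in> ?S" "r \<in> ?S" "adjacent c p" "adjacent c q" "adjacent c r" "p \<noteq> q" "p \<noteq> r" "q \<noteq> r"
    using Y by auto
  show "\<exists>c\<in>plane a ` ?S. \<exists>u\<in>plane a ` ?S. \<exists>v\<in>plane a ` ?S. \<exists>w\<in>plane a ` ?S.
      nb c u \<and> nb c v \<and> nb c w \<and> u \<noteq> v \<and> u \<noteq> w \<and> v \<noteq> w"
  proof (intro bexI conjI)
    show "nb (plane a c) (plane a p)" "nb (plane a c) (plane a q)" "nb (plane a c) (plane a r)"
      using pqr(4-6) by (simp_all only: nb_plane)
    show "plane a p \<noteq> plane a q" "plane a p \<noteq> plane a r" "plane a q \<noteq> plane a r"
      using pqr(7-9) by (simp_all only: inj_eq[OF inj_plane] not_False_eq_True)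
  qed (use c(1) pqr(1-3) in blast)+
qed

lemma (in floor_walks) walks_iff:
  "l \<in> walks n p q \<longleftrightarrow> length l = n \<and> (\<exists>r. r 0 = p \<and> r n = q \<and> (\<forall>k<n. l ! k \<in> F (r k) (r (Suc k)) \<and> r (Suc k) \<in> S))"
proof (induction n arbitrary: p l)
  case 0
  show ?case by (auto split: if_splits)
next
  case (Suc n)
  show ?case
  proof
    assume "l \<in> walks (Suc n) p q"
    then obtain r1 s l' where l: "l = s # l'" "r1 \<in> S" "s \<in> F p r1" "l' \<in> walks n r1 q"
      by (metis walks_Suc_iff)
    then obtain r where r: "length l' = n" "r 0 = r1" "r n = q" "\<And>k. k < n \<Longrightarrow> l' ! k \<in> F (r k) (r (Suc k)) \<and> r (Suc k) \<in> S"
      using Suc.IH by blast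
    define r' where "r' k = (case k of 0 \<Rightarrow> p | Suc k \<Rightarrow> r k)" for k
    have "l ! k \<in> F (r' k) (r' (Suc k)) \<and> r' (Suc k) \<in> S" if "k < Suc n" for k
      using that l r by (cases k) (auto simp: r'_def)
    then show "length l = Suc n \<and> (\<exists>r. r 0 = p \<and> r (Suc n) = q \<and> (\<forall>k<Suc n. l ! k \<in> F (r k) (r (Suc k)) \<and> r (Suc k) \<in> S))"
      using l(1) r(1,3) by (intro conjI exI[of _ r']) (auto simp: r'_def)
  next
    assume "length l = Suc n \<and> (\<exists>r. r 0 = p \<and> r (Suc n) = q \<and> (\<forall>k<Suc n. l ! k \<in> F (r k) (r (Suc k)) \<and> r (Suc k) \<in> S))"
    then obtain r where r: "length l = Suc n" "r 0 = p" "r (Suc n) = q"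
      "\<And>k. k < Suc n \<Longrightarrow> l ! k \<in> F (r k) (r (Suc k)) \<and> r (Suc k) \<in> S" by blast
    then obtain s l' where l: "l = s # l'" by (cases l) auto
    have "l' ! k \<in> F (r (Suc k)) (r (Suc (Suc k))) \<and> r (Suc (Suc k)) \<in> S" if "k < n" for k
      using r(4)[of "Suc k"] that l by simp
    then have "l' \<in> walks n (r (Suc 0)) q" unfolding Suc.IH using r l by (intro conjI exI[of _ "\<lambda>k. r (Suc k)"]) auto
    then show "l \<in> walks (Suc n) p q" unfolding walks_Suc_iff using r(2) r(4)[of 0] l by auto
  qed
qed

section \<open>Tilings as walks\<close>

definition column :: "(int \<times> int) set \<Rightarrow> nat \<Rightarrow> (int \<times> int \<times> int) set" where
  "column C N = {(i, j, k). (i, j) \<in> C \<and> 0 \<le> k \<and> k < int N}"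

text \<open>A tiling is encoded by the displacement from each cube to the other cube of its domino.\<close>

definition field :: "(int \<times> int \<times> int) set \<Rightarrow> (int \<times> int \<times> int \<Rightarrow> int \<times> int \<times> int) \<Rightarrow> bool" where
  "field X n \<longleftrightarrow> (\<forall>x. x \<notin> X \<longrightarrow> n x = 0) \<and> (\<forall>x\<in>X. n x \<in> dirs \<and> x + n x \<in> X \<and> n (x + n x) = - n x)"

definition slice :: "(int \<times> int \<times> int \<Rightarrow> int \<times> int \<times> int) \<Rightarrow> nat \<Rightarrow> floor" where
  "slice n k c = n (fst c, snd c, int k)"

context board
begin

text \<open>The plug below floor \<open>k\<close> is read off from the dominoes of that floor
  pointing downwards; the partner rule identifies the upward ones with those of the next floor. The
  value \<open>{}\<close> beyond the top encodes that no domino leaves the column there.\<close>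

lemma slice_floors:
  assumes f: "field (column C N) n"
  defines "r \<equiv> \<lambda>k. if k < N then {c \<in> C. dz (slice n k) c = - 1} else {}"
  assumes k: "k < N"
  shows "slice n k \<in> floors C (r k) (r (Suc k))"
proof -
  have out: "n x = (0, 0, 0)" if "x \<notin> column C N" for x
    using f that unfolding field_def zero_prod_def by blast
  have ins: "n x \<in> dirs" "x + n x \<in> column C N" "n (x + n x) = - n x" if "x \<in> column C N" for x
    using f that unfolding field_def by blast+
  have mem: "(fst c, snd c, int m) \<in> column C N \<longleftrightarrow> c \<in> C \<and> m < N" for c m
    by (auto simp: column_def)
  have "slice n k c = (0, 0, 0)" if "c \<notin> C" for c
    using out mem that by (auto simp: slice_def)
  moreover have "slice n k c \<in> dirs" if "c \<in> C" for c
    using ins(1) mem that k by (auto simp: slice_def)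
  moreover have "(fst c + dx (slice n k) c, snd c + dy (slice n k) c) \<in> C \<and>
        slice n k (fst c + dx (slice n k) c, snd c + dy (slice n k) c) = (- dx (slice n k) c, - dy (slice n k) c, 0)"
    if c: "c \<in> C" and z: "dz (slice n k) c = 0" for c
  proof -
    define x where "x = (fst c, snd c, int k)"
    have x: "x \<in> column C N" using mem c k by (simp add: x_def)
    have nx: "n x = (dx (slice n k) c, dy (slice n k) c, 0)"
      using z by (simp add: dx_def dy_def dz_def slice_def x_def prod_eq_iff)
    have e: "x + n x = (fst c + dx (slice n k) c, snd c + dy (slice n k) c, int k)"
      unfolding nx by (simp add: x_def)
    show ?thesis
      using ins(2)[OF x, unfolded e] ins(3)[OF x, unfolded e, unfolded nx] by (simp add: column_def slice_def)
  qed
  moreover have "{c \<in> C. dz (slice n k) c = - 1} = r k" using k by (simp add: r_def)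
  moreover have "{c \<in> C. dz (slice n k) c = 1} = r (Suc k)"
  proof (intro equalityI subsetI)
    fix c assume "c \<in> {c \<in> C. dz (slice n k) c = 1}"
    then have c: "c \<in> C" "dz (slice n k) c = 1" by auto
    define x where "x = (fst c, snd c, int k)"
    have x: "x \<in> column C N" using mem c k by (simp add: x_def)
    have nx: "n x = (0, 0, 1)" using ins(1)[OF x] c(2) by (auto simp: dirs_def dz_def slice_def x_def)
    have e: "x + n x = (fst c, snd c, int (Suc k))" unfolding nx by (simp add: x_def)
    have "Suc k < N" "n (fst c, snd c, int (Suc k)) = (0, 0, -1)"
      using ins(2)[OF x, unfolded e] ins(3)[OF x, unfolded e, unfolded nx] mem[of c "Suc k"] by simp_all
    then show "c \<in> r (Suc k)" using c(1) by (simp add: r_def dz_def slice_def)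
  next
    fix c assume "c \<in> r (Suc k)"
    then have c: "c \<in> C" "Suc k < N" "dz (slice n (Suc k)) c = -1" by (auto simp: r_def split: if_splits)
    define x where "x = (fst c, snd c, int (Suc k))"
    have x: "x \<in> column C N" using mem c by (simp add: x_def del: of_nat_Suc)
    have nx: "n x = (0, 0, -1)" using ins(1)[OF x] c(3) by (auto simp: dirs_def dz_def slice_def x_def)
    have e: "x + n x = (fst c, snd c, int k)" unfolding nx by (simp add: x_def)
    show "c \<in> {c \<in> C. dz (slice n k) c = 1}"
      using ins(3)[OF x, unfolded e, unfolded nx] c(1) by (simp add: dz_def slice_def)
  qed
  ultimately show ?thesis unfolding floors_def by blast
qed

lemma slices_walk:
  assumes f: "field (column C N) n"
  shows "map (slice n) [0..<N] \<in> W.walks N {} {}"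
proof -
  define r where "r k = (if k < N then {c \<in> C. dz (slice n k) c = - 1} else {})" for k
  have s: "slice n k \<in> floors C (r k) (r (Suc k))" if "k < N" for k
    using slice_floors[OF f that] by (simp add: r_def)
  \<comment> \<open>No domino leaves through the bottom, since its partner would have height
    -1.\<close>
  have r0: "r 0 = {}"
  proof -
    have False if "c \<in> r 0" for c
    proof -
      have c: "c \<in> C" "0 < N" "dz (slice n 0) c = -1" using that by (auto simp: r_def split: if_splits)
      then have "(fst c, snd c, 0) \<in> column C N" by (simp add: column_def)
      then have "n (fst c, snd c, 0) \<in> dirs" "(fst c, snd c, 0) + n (fst c, snd c, 0) \<in> column C N"
        using f unfolding field_def by blast+
      then show False using c(3) by (auto simp: dirs_def dz_def slice_def column_def)
    qed
    then show ?thesis by blast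
  qed
  have pl: "k \<le> N \<Longrightarrow> r k \<in> plugs" for k
  proof (induction k)
    case (Suc k)
    then show ?case using plugs_closed[OF s[of k]] by simp
  qed (simp add: r0 plugs_def)
  show ?thesis unfolding W.walks_iff
    using s pl r0 by (intro conjI exI[of _ r]) (auto simp: r_def)
qed

definition field_of :: "nat \<Rightarrow> floor list \<Rightarrow> int \<times> int \<times> int \<Rightarrow> int \<times> int \<times> int" where
  "field_of N l x = (if 0 \<le> snd (snd x) \<and> snd (snd x) < int N
     then (l ! nat (snd (snd x))) (fst x, fst (snd x)) else 0)"

lemma field_of_walk:
  assumes "l \<in> W.walks N {} {}"
  shows "field (column C N) (field_of N l)"
proof -
  obtain r where r: "length l = N" "r 0 = {}" "r N = {}" "\<And>k. k < N \<Longrightarrow> l ! k \<in> floors C (r k) (r (Suc k))"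
    using assms unfolding W.walks_iff by blast
  have val: "field_of N l (i, j, int k) = (l ! k) (i, j)" if "k < N" for i j k
    using that by (simp add: field_of_def)
  have "field_of N l x = 0" if "x \<notin> column C N" for x
  proof (cases "0 \<le> snd (snd x) \<and> snd (snd x) < int N")
    case True
    then have "(fst x, fst (snd x)) \<notin> C" "nat (snd (snd x)) < N" using that by (auto simp: column_def)
    then show ?thesis using floor_values(5)[OF r(4)] True by (simp add: field_of_def zero_prod_def)
  qed (auto simp: field_of_def)
  moreover have "field_of N l x \<in> dirs \<and> x + field_of N l x \<in> column C N \<and> field_of N l (x + field_of N l x) = - field_of N l x"
    if x: "x \<in> column C N" for x
  proof -
    obtain i j z where xz: "x = (i, j, z)" by (cases x) auto
    then have z: "0 \<le> z" "z < int N" "(i, j) \<in> C" using x by (auto simp: column_def)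
    then obtain k where "z = int k" using zero_le_imp_eq_int by blast
    then have k: "x = (i, j, int k)" "k < N" "(i, j) \<in> C" using xz z by auto
    note v = floor_values[OF r(4)[OF k(2)]]
    have nx: "field_of N l x = (l ! k) (i, j)" using val[OF k(2)] k(1) by simp
    have d: "(l ! k) (i, j) \<in> dirs" using floor_dirs[OF r(4)[OF k(2)] k(3)] .
    then consider "(l ! k) (i, j) = (0, 0, 1)" | "(l ! k) (i, j) = (0, 0, -1)"
      | u v where "(l ! k) (i, j) = (u, v, 0)" by (auto simp: dirs_def)
    then have "x + field_of N l x \<in> column C N \<and> field_of N l (x + field_of N l x) = - field_of N l x"
    proof cases
      case 1
      then have up: "(i, j) \<in> r (Suc k)" using v(4) k(3) by simp
      then have k': "Suc k < N" using r(3) k(2) by (metis Suc_lessI empty_iff)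
      have "(l ! Suc k) (i, j) = (0, 0, -1)" using floor_values(3)[OF r(4)[OF k']] up by blast
      then show ?thesis using val[OF k', of i j] k' k(1,3) unfolding nx 1 by (simp add: column_def add.commute)
    next
      case 2
      then have dn: "(i, j) \<in> r k" using v(3) k(3) by simp
      then obtain m where m: "k = Suc m" using r(2) by (cases k) auto
      then have m': "m < N" using k(2) by simp
      have "(l ! m) (i, j) = (0, 0, 1)" using floor_values(4)[OF r(4)[OF m']] dn m by blast
      then show ?thesis using val[OF m', of i j] m m' k(1,3) unfolding nx 2 by (simp add: column_def)
    next
      case (3 u v)
      have "(i + u, j + v) \<in> C \<and> (l ! k) (i + u, j + v) = (- u, - v, 0)"
      proof -
        have "dz (l ! k) (i, j) = 0" "dx (l ! k) (i, j) = u" "dy (l ! k) (i, j) = v"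
          using 3 by (auto simp: dx_def dy_def dz_def)
        moreover have "\<forall>c\<in>C. dz (l ! k) c = 0 \<longrightarrow> (fst c + dx (l ! k) c, snd c + dy (l ! k) c) \<in> C \<and>
            (l ! k) (fst c + dx (l ! k) c, snd c + dy (l ! k) c) = (- dx (l ! k) c, - dy (l ! k) c, 0)"
          using r(4)[OF k(2)] unfolding floors_def by blast
        ultimately show ?thesis using k(3) by force
      qed
      then show ?thesis using val[OF k(2), of "i + u" "j + v"] k unfolding nx 3 by (simp add: column_def)
    qed
    then show ?thesis using d nx by simp
  qed
  ultimately show ?thesis unfolding field_def by blast
qed

lemma bij_walks: "bij_betw (\<lambda>n. map (slice n) [0..<N]) {n. field (column C N) n} (W.walks N {} {})"
proof (rule bij_betw_byWitness[where f' = "field_of N"])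
  show "\<forall>n\<in>{n. field (column C N) n}. field_of N (map (slice n) [0..<N]) = n"
  proof (intro ballI ext)
    fix n x assume "n \<in> {n. field (column C N) n}"
    then have "x \<notin> column C N \<Longrightarrow> n x = 0" unfolding field_def by blast
    then show "field_of N (map (slice n) [0..<N]) x = n x"
      by (cases x) (auto simp: field_of_def slice_def column_def)
  qed
  show "\<forall>l\<in>W.walks N {} {}. map (slice (field_of N l)) [0..<N] = l"
  proof
    fix l assume "l \<in> W.walks N {} {}"
    then have "length l = N" unfolding W.walks_iff by blast
    then show "map (slice (field_of N l)) [0..<N] = l"
      by (intro nth_equalityI) (auto simp: slice_def field_of_def)
  qed
qed (use slices_walk field_of_walk in auto)

end

section \<open>Tilings as displacement fields, with the axes ordered along and across the
  shade\<close>

locale frame =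
  fixes a b :: 3
  assumes ab: "(a = 1 \<and> b = 2) \<or> (a = 2 \<and> b = 1)"
begin

text \<open>The triple lists the coordinate along the shade, the other horizontal one and the
  height, so that a single computation serves both horizontal axes.\<close>

definition mk :: "int \<times> int \<times> int \<Rightarrow> int ^ 3" where
  "mk x = (\<chi> t. if t = a then fst x else if t = b then fst (snd x) else snd (snd x))"

lemma distinct_ab: "a \<noteq> b" "b \<noteq> a" "a \<noteq> 3" "b \<noteq> 3" "3 \<noteq> a" "3 \<noteq> b"
  using ab by auto

lemma all_ab: "(\<forall>t. P t) \<longleftrightarrow> P a \<and> P b \<and> P 3"
  using ab by (auto simp: forall_3)

lemma mk_nth [simp]: "mk x $ a = fst x" "mk x $ b = fst (snd x)" "mk x $ 3 = snd (snd x)"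
  using distinct_ab by (auto simp: mk_def)

lemma mk_eq [simp]: "mk x = mk y \<longleftrightarrow> x = y"
  by (auto simp: vec_eq_iff all_ab prod_eq_iff)

lemma mk_surj: "c = mk (c $ a, c $ b, c $ 3)"
  by (simp add: vec_eq_iff all_ab)

lemma adjacent_mk: "adjacent (mk x) (mk y) \<longleftrightarrow> y - x \<in> dirs"
proof -
  have ex: "(\<exists>t. P t) \<longleftrightarrow> P a \<or> P b \<or> P 3" for P using all_ab[of "\<lambda>t. \<not> P t"] by blast
  have ax: "mk x - mk y = axis a 1 \<longleftrightarrow> x - y = (1, 0, 0)" "mk x - mk y = axis b 1 \<longleftrightarrow> x - y = (0, 1, 0)"
    "mk x - mk y = axis 3 1 \<longleftrightarrow> x - y = (0, 0, 1)" for x y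
    using distinct_ab by (simp_all add: vec_eq_iff all_ab axis_def prod_eq_iff)
  have neg: "x - y = d \<longleftrightarrow> y - x = - d" for d :: "int \<times> int \<times> int"
    by (metis minus_diff_eq minus_minus)
  show ?thesis
    unfolding adjacent_def ex ax neg[of "(1, 0, 0)"] neg[of "(0, 1, 0)"] neg[of "(0, 0, 1)"]
    by (simp add: dirs_def) blast
qed

lemma black_mk: "black (mk x) \<longleftrightarrow> even (fst x + fst (snd x) + snd (snd x))"
proof -
  have "(\<Sum>i\<in>UNIV. g i) = g a + g b + g 3" for g :: "3 \<Rightarrow> int"
    using ab by (auto simp: sum_3)
  then show ?thesis by (simp add: black_def)
qed

text \<open>The domino containing the cube \<open>x\<close>; each domino is named twice, by
  \<open>x\<close> and by its partner.\<close>

definition dm :: "(int \<times> int \<times> int \<Rightarrow> int \<times> int \<times> int) \<Rightarrow> int \<times> int \<times> int \<Rightarrow> (real ^ 3) set" where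
  "dm n x = lattice_cube (mk x) \<union> lattice_cube (mk (x + n x))"

lemma domino_eq_iff:
  "lattice_cube p \<union> lattice_cube q = lattice_cube r \<union> lattice_cube s \<longleftrightarrow> {p, q} = {r, s}"
proof
  assume e: "lattice_cube p \<union> lattice_cube q = lattice_cube r \<union> lattice_cube s"
  have "{c. lattice_cube c \<subseteq> lattice_cube p \<union> lattice_cube q} = {p, q}"
    "{c. lattice_cube c \<subseteq> lattice_cube r \<union> lattice_cube s} = {r, s}"
    by (auto simp: lattice_cube_subset_Un)
  then show "{p, q} = {r, s}" using e by simp
qed (auto simp: doubleton_eq_iff)

lemma dm_eq_iff: "dm n x = dm m y \<longleftrightarrow> {x, x + n x} = {y, y + m y}"
  by (simp add: dm_def domino_eq_iff doubleton_eq_iff)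

lemma interior_dominoes:
  "interior (lattice_cube p \<union> lattice_cube q) \<inter> interior (lattice_cube r \<union> lattice_cube s) = {} \<longleftrightarrow> {p, q} \<inter> {r, s} = {}"
proof
  assume i: "interior (lattice_cube p \<union> lattice_cube q) \<inter> interior (lattice_cube r \<union> lattice_cube s) = {}"
  have False if "c \<in> {p, q}" "c \<in> {r, s}" for c
  proof -
    have "lattice_cube c \<subseteq> lattice_cube p \<union> lattice_cube q" "lattice_cube c \<subseteq> lattice_cube r \<union> lattice_cube s"
      using that by auto
    then show False using i cube_center_interior by blast
  qed
  then show "{p, q} \<inter> {r, s} = {}" by blast
next
  assume "{p, q} \<inter> {r, s} = {}"
  from interior_cubes_disjoint[OF _ _ this]
  show "interior (lattice_cube p \<union> lattice_cube q) \<inter> interior (lattice_cube r \<union> lattice_cube s) = {}" by simp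
qed

lemma field_mem:
  assumes "field X n" "x \<in> X"
  shows "n x \<in> dirs" "x + n x \<in> X" "n (x + n x) = - n x" "n x \<noteq> 0" "x + n x + n (x + n x) = x"
proof -
  show 1: "n x \<in> dirs" "x + n x \<in> X" "n (x + n x) = - n x" using assms unfolding field_def by blast+
  show "n x \<noteq> 0" using 1(1) by (auto simp: dirs_def zero_prod_def)
  show "x + n x + n (x + n x) = x" unfolding 1(3) by (simp add: prod_eq_iff)
qed

lemma dm_partner: "field X n \<Longrightarrow> x \<in> X \<Longrightarrow> dm n (x + n x) = dm n x"
  by (simp add: dm_eq_iff field_mem(5) insert_commute)

lemma field_tiling:
  assumes f: "field X n"
  shows "dm n ` X \<in> tilings (\<Union>x\<in>X. lattice_cube (mk x))"
proof -
  have "domino (dm n x)" if "x \<in> X" for x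
    unfolding domino_def dm_def using field_mem(1)[OF f that] 
    by (intro exI[of _ "mk x"] exI[of _ "mk (x + n x)"]) (simp add: adjacent_mk)
  moreover have "pairwise (\<lambda>d d'. interior d \<inter> interior d' = {}) (dm n ` X)"
  proof (intro pairwiseI; clarify)
    fix x y assume xy: "x \<in> X" "y \<in> X" "dm n x \<noteq> dm n y"
    have "{x, x + n x} \<inter> {y, y + n y} = {}"
    proof (rule ccontr)
      assume "{x, x + n x} \<inter> {y, y + n y} \<noteq> {}"
      then have "x = y \<or> x = y + n y \<or> x + n x = y \<or> x + n x = y + n y" by auto
      then have "dm n x = dm n y"
        using dm_partner[OF f xy(1)] dm_partner[OF f xy(2)] by metis
      then show False using xy(3) by simp
    qed
    then have "{mk x, mk (x + n x)} \<inter> {mk y, mk (y + n y)} = {}" by auto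
    then show "interior (dm n x) \<inter> interior (dm n y) = {}" unfolding dm_def interior_dominoes .
  qed
  moreover have "\<Union>(dm n ` X) = (\<Union>x\<in>X. lattice_cube (mk x))"
    using field_mem(2)[OF f] by (auto simp: dm_def)
  ultimately show ?thesis by (auto simp: tilings_def)
qed

text \<open>A cube centre lies in no other lattice cube, so the domino covering it contains the
  whole cube. Two dominoes sharing a cube would both have its centre in their interior. Hence every
  cube has one partner, and taking partners is an involution.\<close>

lemma tiling_field:
  assumes T: "T \<in> tilings (\<Union>x\<in>X. lattice_cube (mk x))"
  shows "\<exists>n. field X n \<and> T = dm n ` X"
proof -
  have T3: "(\<forall>d\<in>T. domino d) \<and> pairwise (\<lambda>d d'. interior d \<inter> interior d' = {}) T \<and> \<Union>T = (\<Union>x\<in>X. lattice_cube (mk x))"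
    using T unfolding tilings_def by (rule CollectD)
  then have Tdom: "\<And>d. d \<in> T \<Longrightarrow> domino d" and TU: "\<Union>T = (\<Union>x\<in>X. lattice_cube (mk x))" by simp_all
  have Tint: "interior d \<inter> interior d' = {}" if "d \<in> T" "d' \<in> T" "d \<noteq> d'" for d d'
    using T3 that by (auto dest: pairwiseD)
  have sub: "x \<in> X" if "lattice_cube (mk x) \<subseteq> d" "d \<in> T" for x d
  proof -
    have "lattice_cube (mk x) \<subseteq> (\<Union>c\<in>mk ` X. lattice_cube c)" using that TU by auto
    then show ?thesis unfolding lattice_cube_subset_UN by auto
  qed
  have uniq: "d = d'" if "lattice_cube c \<subseteq> d" "lattice_cube c \<subseteq> d'" "d \<in> T" "d' \<in> T" for c d d'
  proof (rule ccontr)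
    assume "d \<noteq> d'"
    then have "interior d \<inter> interior d' = {}" by (rule Tint[OF that(3,4)])
    moreover have "cube_center c \<in> interior d \<inter> interior d'"
      by (intro IntI cube_center_interior that(1,2))
    ultimately show False by simp
  qed
  have form: "\<exists>p q. d = lattice_cube (mk p) \<union> lattice_cube (mk q) \<and> q - p \<in> dirs" if dT: "d \<in> T" for d
  proof -
    obtain u v where uv: "adjacent u v" "d = lattice_cube u \<union> lattice_cube v" using Tdom[OF dT] by (auto simp: domino_def)
    obtain p q where "u = mk p" "v = mk q" using mk_surj[of u] mk_surj[of v] by blast
    then have "d = lattice_cube (mk p) \<union> lattice_cube (mk q)" "q - p \<in> dirs" using uv adjacent_mk[of p q] by simp_all
    then show ?thesis by blast
  qed
  have dirs_uminus: "z \<in> dirs \<Longrightarrow> - z \<in> dirs" for z by (auto simp: dirs_def)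
  have ex: "\<exists>y. lattice_cube (mk x) \<union> lattice_cube (mk y) \<in> T \<and> y - x \<in> dirs" if x: "x \<in> X" for x
  proof -
    have "cube_center (mk x) \<in> \<Union>T" using x unfolding TU by (auto simp: cube_center_mem_iff)
    then obtain d where d: "d \<in> T" "cube_center (mk x) \<in> d" by blast
    obtain p q where pq: "d = lattice_cube (mk p) \<union> lattice_cube (mk q)" "q - p \<in> dirs" using form[OF d(1)] by blast
    then have "x = p \<or> x = q" using d(2) by (auto simp: cube_center_mem_iff)
    then show ?thesis
    proof
      assume "x = p" then show ?thesis using pq d(1) by blast
    next
      assume "x = q"
      moreover have "p - q \<in> dirs" using dirs_uminus[OF pq(2)] by simp
      ultimately show ?thesis using pq(1) d(1) \<open>x = q\<close> by (intro exI[of _ p]) (simp add: Un_commute)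
    qed
  qed
  then have "\<forall>x\<in>X. \<exists>y. lattice_cube (mk x) \<union> lattice_cube (mk y) \<in> T \<and> y - x \<in> dirs" by blast
  from bchoice[OF this] obtain f
    where f: "\<And>x. x \<in> X \<Longrightarrow> lattice_cube (mk x) \<union> lattice_cube (mk (f x)) \<in> T \<and> f x - x \<in> dirs" by blast
  define n where "n x = (if x \<in> X then f x - x else 0)" for x
  have xn: "x + n x = f x" if "x \<in> X" for x using that by (simp add: n_def)
  have fX: "f x \<in> X" if "x \<in> X" for x using sub[of "f x"] f[OF that] by blast
  have ff: "f (f x) = x" if "x \<in> X" for x
  proof -
    have "lattice_cube (mk x) \<union> lattice_cube (mk (f x)) = lattice_cube (mk (f x)) \<union> lattice_cube (mk (f (f x)))"
      using uniq[of "mk (f x)"] f[OF that] f[OF fX[OF that]] by blast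
    then have "{mk x, mk (f x)} = {mk (f x), mk (f (f x))}" unfolding domino_eq_iff .
    then show ?thesis by (auto simp: doubleton_eq_iff)
  qed
  have "field X n"
    unfolding field_def using f fX ff by (auto simp: n_def)
  moreover have "T = dm n ` X"
  proof (intro equalityI subsetI)
    fix d assume d: "d \<in> T"
    obtain p q where pq: "d = lattice_cube (mk p) \<union> lattice_cube (mk q)" using form[OF d] by blast
    have p: "p \<in> X" using sub[of p d] d pq by blast
    have "d = dm n p" unfolding dm_def xn[OF p]
      using uniq[of "mk p"] f[OF p] d pq by blast
    then show "d \<in> dm n ` X" using p by blast
  next
    fix d assume "d \<in> dm n ` X"
    then obtain x where x: "x \<in> X" "d = dm n x" by blast
    then show "d \<in> T" using f[OF x(1)] xn[OF x(1)] by (simp add: dm_def)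
  qed
  ultimately show ?thesis by blast
qed

lemma bij_tilings:
  assumes fin: "finite X"
  shows "bij_betw (\<lambda>n. dm n ` X) {n. field X n} (tilings (\<Union>x\<in>X. lattice_cube (mk x)))"
proof (rule bij_betw_imageI)
  show "inj_on (\<lambda>n. dm n ` X) {n. field X n}"
  proof (rule inj_onI, rule ext)
    fix n m x assume nm: "n \<in> {n. field X n}" "m \<in> {n. field X n}" and e: "dm n ` X = dm m ` X"
    show "n x = m x"
    proof (cases "x \<in> X")
      case True
      then obtain y where y: "y \<in> X" "dm n x = dm m y" using e by blast
      have "{x, x + n x} = {y, y + m y}" using y(2) unfolding dm_eq_iff .
      then consider "x = y" "x + n x = y + m y" | "x = y + m y" "x + n x = y" by (auto simp: doubleton_eq_iff)
      then show ?thesis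
      proof cases
        case 1
        then show ?thesis by simp
      next
        case 2
        have "x + m x = y" unfolding 2(1) by (rule field_mem(5)[of X]) (use nm y(1) in auto)
        then have "x + n x = x + m x" using 2(2) by simp
        then show ?thesis by (rule add_left_imp_eq)
      qed
    next
      case False
      then show ?thesis using nm unfolding field_def mem_Collect_eq by metis
    qed
  qed
  show "(\<lambda>n. dm n ` X) ` {n. field X n} = tilings (\<Union>x\<in>X. lattice_cube (mk x))"
    using field_tiling[OF _] tiling_field by blast
qed

text \<open>Height zero is excluded: the cylinder is then a flat copy of the disk, whereas the
  column is empty.\<close>

lemma cylinder_eq:
  assumes D: "quadriculated_disk D" and N: "N \<ge> 1"
  shows "cylinder D N = (\<Union>x\<in>column (plane a ` squares D) N. lattice_cube (mk x))"
proof -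
  have mkp: "mk (fst (plane a c), snd (plane a c), k) $ 1 = c $ 1" "mk (fst (plane a c), snd (plane a c), k) $ 2 = c $ 2" for c k
    using ab by (auto simp: mk_def plane_def)
  have mem: "x \<in> lattice_cube (mk (fst (plane a c), snd (plane a c), k)) \<longleftrightarrow>
      vector [x $ 1, x $ 2] \<in> lattice_cube c \<and> of_int k \<le> x $ 3 \<and> x $ 3 \<le> of_int k + 1" for x c k
    by (auto simp: mem_lattice_cube forall_2 forall_3 mkp)
  have z: "(0 \<le> (r::real) \<and> r \<le> real N) \<longleftrightarrow> (\<exists>k. 0 \<le> k \<and> k < int N \<and> of_int k \<le> r \<and> r \<le> of_int k + 1)" for r
  proof
    assume r: "0 \<le> r \<and> r \<le> real N"
    show "\<exists>k. 0 \<le> k \<and> k < int N \<and> of_int k \<le> r \<and> r \<le> of_int k + 1"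
    proof (cases "r = real N")
      case True
      \<comment> \<open>The top face belongs to the last floor, as rounding down would give
        \<open>N\<close>.\<close>
      then show ?thesis using N by (intro exI[of _ "int N - 1"]) auto
    next
      case False
      then have "r < real N" using r by simp
      then have "\<lfloor>r\<rfloor> < int N" by (simp add: floor_less_iff)
      then show ?thesis using r by (intro exI[of _ "\<lfloor>r\<rfloor>"]) (simp add: less_imp_le)
    qed
  next
    assume "\<exists>k. 0 \<le> k \<and> k < int N \<and> of_int k \<le> r \<and> r \<le> of_int k + 1"
    then obtain k :: int where k: "0 \<le> k" "k + 1 \<le> int N" "of_int k \<le> r" "r \<le> of_int k + 1" by auto
    have "real_of_int (k + 1) \<le> real_of_int (int N)" using k(2) by (simp only: of_int_le_iff)
    then show "0 \<le> r \<and> r \<le> real N" using k by auto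
  qed
  have col: "column (plane a ` squares D) N = (\<lambda>(c, k). (fst (plane a c), snd (plane a c), k)) ` (squares D \<times> {k. 0 \<le> k \<and> k < int N})"
  proof (intro equalityI subsetI)
    fix x assume "x \<in> column (plane a ` squares D) N"
    then obtain c where c: "c \<in> squares D" "(fst x, fst (snd x)) = plane a c" "0 \<le> snd (snd x)" "snd (snd x) < int N"
      by (auto simp: column_def)
    have e: "x = (fst (plane a c), snd (plane a c), snd (snd x))" unfolding c(2)[symmetric] by simp
    show "x \<in> (\<lambda>(c, k). (fst (plane a c), snd (plane a c), k)) ` (squares D \<times> {k. 0 \<le> k \<and> k < int N})"
      by (rule image_eqI[of _ _ "(c, snd (snd x))"]) (use e c(1,3,4) in \<open>simp_all only: prod.case mem_Times_iff fst_conv snd_conv mem_Collect_eq simp_thms\<close>)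
  next
    fix x assume "x \<in> (\<lambda>(c, k). (fst (plane a c), snd (plane a c), k)) ` (squares D \<times> {k. 0 \<le> k \<and> k < int N})"
    then obtain c k where "x = (fst (plane a c), snd (plane a c), k)" "c \<in> squares D" "0 \<le> k" "k < int N" by auto
    then show "x \<in> column (plane a ` squares D) N" by (simp add: column_def)
  qed
  have memD: "v \<in> D \<longleftrightarrow> (\<exists>c\<in>squares D. v \<in> lattice_cube c)" for v
    using arg_cong[OF squares_disk(2)[OF D], of "\<lambda>A. v \<in> A"] unfolding UN_iff .
  have "x \<in> cylinder D N \<longleftrightarrow> x \<in> (\<Union>x\<in>column (plane a ` squares D) N. lattice_cube (mk x))" for x
  proof -
    have "x \<in> cylinder D N \<longleftrightarrow> (\<exists>c\<in>squares D. vector [x $ 1, x $ 2] \<in> lattice_cube c) \<and> (0 \<le> x $ 3 \<and> x $ 3 \<le> real N)"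
      unfolding cylinder_def memD mem_Collect_eq ..
    also have "\<dots> \<longleftrightarrow> (\<exists>c\<in>squares D. \<exists>k. 0 \<le> k \<and> k < int N \<and> x \<in> lattice_cube (mk (fst (plane a c), snd (plane a c), k)))"
      unfolding z mem by blast
    also have "\<dots> \<longleftrightarrow> x \<in> (\<Union>x\<in>column (plane a ` squares D) N. lattice_cube (mk x))"
      unfolding col UN_iff bex_simps by (simp add: Bex_def)
    finally show ?thesis .
  qed
  then show ?thesis by blast
qed

end

section \<open>The twist as a sum over floors\<close>

text \<open>The sweep of a box minus the box is a half-infinite beam. Removing the closed box makes
  the inequality along \<open>a\<close> strict, and passing to the interior makes the transverse
  ones strict.\<close>

lemma shade_box:
  fixes lo hi :: "3 \<Rightarrow> real" and \<sigma> :: int and a :: 3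
  assumes lh: "\<And>t. lo t < hi t" and \<sigma>: "\<sigma> = 1 \<or> \<sigma> = - 1"
  shows "shade (of_int \<sigma> *\<^sub>R axis a 1) {r. \<forall>t. lo t \<le> r $ t \<and> r $ t \<le> hi t}
    = {r. (if \<sigma> = 1 then r $ a > hi a else r $ a < lo a) \<and> (\<forall>t. t \<noteq> a \<longrightarrow> lo t < r $ t \<and> r $ t < hi t)}"
    (is "shade ?u ?B = ?M")
proof -
  define U where "U = (\<Union>s\<in>{0..}. (\<lambda>x. x + s *\<^sub>R ?u) ` ?B) - ?B"
  have u: "(x + s *\<^sub>R ?u) $ t = x $ t + (if t = a then s * of_int \<sigma> else 0)" for x s t
    by (simp add: axis_def)
  have U_props: "(if \<sigma> = 1 then w $ a > hi a else w $ a < lo a) \<and> (\<forall>t. t \<noteq> a \<longrightarrow> lo t \<le> w $ t \<and> w $ t \<le> hi t)"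
    if w: "w \<in> U" for w
  proof -
    have wB: "w \<notin> ?B" and "w \<in> (\<Union>s\<in>{0..}. (\<lambda>x. x + s *\<^sub>R ?u) ` ?B)"
      using w unfolding U_def Diff_iff by blast+
    then obtain s x where s: "s \<in> {0..}" "x \<in> ?B" "w = x + s *\<^sub>R ?u" by (elim UN_E imageE)
    then have s0: "s \<ge> 0" by simp
    have wt: "w $ t = x $ t + (if t = a then s * of_int \<sigma> else 0)" for t unfolding s(3) by (rule u)
    have xt: "lo t \<le> x $ t" "x $ t \<le> hi t" for t using s(2) by auto
    have o: "lo t \<le> w $ t \<and> w $ t \<le> hi t" if "t \<noteq> a" for t using xt[of t] wt[of t] that by simp
    have "\<not> (lo a \<le> w $ a \<and> w $ a \<le> hi a)"
    proof
      assume "lo a \<le> w $ a \<and> w $ a \<le> hi a"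
      then have "lo t \<le> w $ t \<and> w $ t \<le> hi t" for t using o[of t] by (cases "t = a") auto
      then have "w \<in> ?B" by blast
      then show False using wB by blast
    qed
    then show ?thesis using o wt[of a] xt[of a] s0 \<sigma> by auto
  qed
  have "open ?M"
  proof -
    have o1: "open {r :: real ^ 3. if \<sigma> = 1 then r $ a > hi a else r $ a < lo a}"
      using \<sigma> by (auto intro!: open_Collect_less continuous_intros)
    have o2: "open (\<Inter>t\<in>UNIV - {a}. {r :: real ^ 3. lo t < r $ t} \<inter> {r. r $ t < hi t})"
      by (intro open_INT open_Int open_Collect_less continuous_intros ballI) auto
    have Meq: "?M = {r :: real ^ 3. if \<sigma> = 1 then r $ a > hi a else r $ a < lo a}
        \<inter> (\<Inter>t\<in>UNIV - {a}. {r :: real ^ 3. lo t < r $ t} \<inter> {r. r $ t < hi t})" by auto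
    show ?thesis unfolding Meq by (rule open_Int[OF o1 o2])
  qed
  moreover have "?M \<subseteq> U"
  proof
    fix r assume r: "r \<in> ?M"
    define s where "s = (if \<sigma> = 1 then r $ a - hi a else lo a - r $ a)"
    have s0: "s \<ge> 0" using r by (auto simp: s_def split: if_splits)
    have xt: "(r + (- s) *\<^sub>R ?u) $ t = r $ t + (if t = a then - s * of_int \<sigma> else 0)" for t by (rule u)
    have "r + (- s) *\<^sub>R ?u \<in> ?B"
    proof (rule CollectI, rule allI)
      fix t show "lo t \<le> (r + (- s) *\<^sub>R ?u) $ t \<and> (r + (- s) *\<^sub>R ?u) $ t \<le> hi t"
        unfolding xt using r lh[of a] \<sigma> by (cases "t = a") (auto simp: s_def less_imp_le)
    qed
    moreover have "r = (r + (- s) *\<^sub>R ?u) + s *\<^sub>R ?u" by simp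
    ultimately have "r \<in> (\<Union>s\<in>{0..}. (\<lambda>x. x + s *\<^sub>R ?u) ` ?B)" using s0 by blast
    moreover have "r \<notin> ?B" using r by (auto split: if_splits simp: not_le)
    ultimately show "r \<in> U" unfolding U_def by blast
  qed
  ultimately have "?M \<subseteq> interior U" by (rule interior_maximal[rotated])
  moreover have "interior U \<subseteq> ?M"
  proof
    fix r assume "r \<in> interior U"
    then obtain e where e: "e > 0" "ball r e \<subseteq> U" using mem_interior by blast
    have "r \<in> U" using e by auto
    \<comment> \<open>Moving by \<open>e / 2\<close> both ways along \<open>t\<close> stays in the
      set, so \<open>r\<close> cannot lie on a transverse boundary.\<close>
    have "lo t < r $ t \<and> r $ t < hi t" if t: "t \<noteq> a" for t
    proof -
      have "r + (e / 2) *\<^sub>R axis t 1 \<in> ball r e" "r + (- (e / 2)) *\<^sub>R axis t 1 \<in> ball r e"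
        using e(1) by (auto simp: dist_norm norm_axis_1)
      then have "r + (e / 2) *\<^sub>R axis t 1 \<in> U" "r + (- (e / 2)) *\<^sub>R axis t 1 \<in> U" using e(2) by blast+
      from U_props[OF this(1)] U_props[OF this(2)] t e(1) show ?thesis by (auto simp: axis_def)
    qed
    then show "r \<in> ?M" using U_props[OF \<open>r \<in> U\<close>] by auto
  qed
  ultimately show ?thesis unfolding shade_def U_def by blast
qed

lemma domino_box:
  fixes X :: "int ^ 3"
  shows "lattice_cube X \<union> lattice_cube (X + axis p 1)
    = {r. \<forall>t. of_int (X $ t) \<le> r $ t \<and> r $ t \<le> of_int (X $ t) + 1 + (if t = p then 1 else 0)}"
proof (intro equalityI subsetI)
  fix r assume "r \<in> lattice_cube X \<union> lattice_cube (X + axis p 1)"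
  then show "r \<in> {r. \<forall>t. of_int (X $ t) \<le> r $ t \<and> r $ t \<le> of_int (X $ t) + 1 + (if t = p then 1 else 0)}"
  proof
    assume "r \<in> lattice_cube X"
    then have "of_int (X $ t) \<le> r $ t \<and> r $ t \<le> of_int (X $ t) + 1" for t by (auto simp: mem_lattice_cube)
    then have "of_int (X $ t) \<le> r $ t \<and> r $ t \<le> of_int (X $ t) + 1 + (if t = p then 1 else 0)" for t
      by (smt (verit))
    then show ?thesis by blast
  next
    assume "r \<in> lattice_cube (X + axis p 1)"
    then have *: "of_int (X $ t + axis p 1 $ t) \<le> r $ t \<and> r $ t \<le> of_int (X $ t + axis p 1 $ t) + 1" for t
      by (auto simp: mem_lattice_cube)
    have "of_int (X $ t) \<le> r $ t \<and> r $ t \<le> of_int (X $ t) + 1 + (if t = p then 1 else 0)" for t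
      using *[of t] by (auto simp: axis_def split: if_splits)
    then show ?thesis by blast
  qed
next
  fix r :: "real ^ 3" assume "r \<in> {r. \<forall>t. of_int (X $ t) \<le> r $ t \<and> r $ t \<le> of_int (X $ t) + 1 + (if t = p then 1 else 0)}"
  then have *: "of_int (X $ t) \<le> r $ t \<and> r $ t \<le> of_int (X $ t) + 1 + (if t = p then 1 else 0)" for t by blast
  show "r \<in> lattice_cube X \<union> lattice_cube (X + axis p 1)"
  proof (cases "r $ p \<le> of_int (X $ p) + 1")
    case True
    have "of_int (X $ t) \<le> r $ t \<and> r $ t \<le> of_int (X $ t) + 1" for t
      using *[of t] True by (cases "t = p") auto
    then show ?thesis by (simp add: mem_lattice_cube)
  next
    case False
    have "of_int ((X + axis p 1) $ t) \<le> r $ t \<and> r $ t \<le> of_int ((X + axis p 1) $ t) + 1" for t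
      using *[of t] False by (cases "t = p") (auto simp: axis_def)
    then have "r \<in> lattice_cube (X + axis p 1)" unfolding mem_lattice_cube by blast
    then show ?thesis by blast
  qed
qed

lemma all_distinct_3: "a \<noteq> p \<Longrightarrow> a \<noteq> q \<Longrightarrow> p \<noteq> q \<Longrightarrow> (\<forall>t::3. P t) \<longleftrightarrow> P a \<and> P p \<and> P q"
  using exhaust_3[of a] exhaust_3[of p] exhaust_3[of q] by (auto simp: forall_3)

text \<open>Projected along \<open>a\<close>, the two dominoes are rectangles of perpendicular
  directions. Their interiors meet exactly when they share a unit square, which is a condition on
  corners; the remaining condition places the second domino strictly ahead.\<close>

lemma domino_meets_shade:
  fixes X Y :: "int ^ 3" and a p q :: 3
  assumes d: "a \<noteq> p" "a \<noteq> q" "p \<noteq> q" and \<sigma>: "\<sigma> = 1 \<or> \<sigma> = (- 1 :: int)"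
  shows "(lattice_cube Y \<union> lattice_cube (Y + axis q 1)) \<inter>
      shade (of_int \<sigma> *\<^sub>R axis a 1) (lattice_cube X \<union> lattice_cube (X + axis p 1)) \<noteq> {}
    \<longleftrightarrow> \<sigma> * (Y $ a - X $ a) > 0 \<and> (Y $ p = X $ p \<or> Y $ p = X $ p + 1) \<and> (X $ q = Y $ q \<or> X $ q = Y $ q + 1)"
    (is "?L \<noteq> {} \<longleftrightarrow> ?R")
proof -
  note all3 = all_distinct_3[OF d]
  have sh: "shade (of_int \<sigma> *\<^sub>R axis a 1) (lattice_cube X \<union> lattice_cube (X + axis p 1))
    = {r. (if \<sigma> = 1 then r $ a > of_int (X $ a) + 1 else r $ a < of_int (X $ a))
       \<and> of_int (X $ p) < r $ p \<and> r $ p < of_int (X $ p) + 2 \<and> of_int (X $ q) < r $ q \<and> r $ q < of_int (X $ q) + 1}"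
    unfolding domino_box using d by (subst shade_box[OF _ \<sigma>]) (auto simp: all3)
  have bx: "lattice_cube Y \<union> lattice_cube (Y + axis q 1)
    = {r. of_int (Y $ a) \<le> r $ a \<and> r $ a \<le> of_int (Y $ a) + 1 \<and> of_int (Y $ p) \<le> r $ p \<and> r $ p \<le> of_int (Y $ p) + 1
       \<and> of_int (Y $ q) \<le> r $ q \<and> r $ q \<le> of_int (Y $ q) + 2}"
    unfolding domino_box using d by (auto simp: all3)
  show ?thesis
  proof
    assume "?L \<noteq> {}"
    then obtain r :: "real ^ 3" where r: "(if \<sigma> = 1 then r $ a > of_int (X $ a) + 1 else r $ a < of_int (X $ a))"
       "of_int (X $ p) < r $ p" "r $ p < of_int (X $ p) + 2" "of_int (X $ q) < r $ q" "r $ q < of_int (X $ q) + 1"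
       "of_int (Y $ a) \<le> r $ a" "r $ a \<le> of_int (Y $ a) + 1" "of_int (Y $ p) \<le> r $ p" "r $ p \<le> of_int (Y $ p) + 1"
       "of_int (Y $ q) \<le> r $ q" "r $ q \<le> of_int (Y $ q) + 2"
      unfolding sh bx by blast
    have "\<sigma> * (Y $ a - X $ a) > 0"
    proof (cases "\<sigma> = 1")
      case True
      then have "real_of_int (X $ a) < of_int (Y $ a)" using r(1,7) by simp
      then show ?thesis using True by simp
    next
      case False
      then have "real_of_int (Y $ a) < of_int (X $ a)" using r(1,6) by simp
      then show ?thesis using False \<sigma> by simp
    qed
    moreover have "Y $ p = X $ p \<or> Y $ p = X $ p + 1" using r(2,3,8,9) by linarith
    moreover have "X $ q = Y $ q \<or> X $ q = Y $ q + 1" using r(4,5,10,11) by linarith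
    ultimately show ?R by blast
  next
    assume R: ?R
    \<comment> \<open>The centre of the common unit square, taken on the far face of the second
      domino, which lies strictly beyond the first.\<close>
    define r :: "real ^ 3" where "r = (\<chi> t. if t = a then (if \<sigma> = 1 then of_int (Y $ a) + 1 else of_int (Y $ a))
      else if t = p then of_int (Y $ p) + 1 / 2 else of_int (X $ q) + 1 / 2)"
    have ra: "r $ a = (if \<sigma> = 1 then of_int (Y $ a) + 1 else of_int (Y $ a))" "r $ p = of_int (Y $ p) + 1 / 2" "r $ q = of_int (X $ q) + 1 / 2"
      using d by (auto simp: r_def)
    have "if \<sigma> = 1 then r $ a > of_int (X $ a) + 1 else r $ a < of_int (X $ a)"
      using R \<sigma> unfolding ra by auto
    then have "r \<in> ?L" unfolding sh bx using R by (auto simp: ra)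
    then show "?L \<noteq> {}" by blast
  qed
qed

text \<open>Selects one of the two cubes of each domino, namely the one from which the displacement
  is positive.\<close>

definition pos_dirs :: "(int \<times> int \<times> int) set" where
  "pos_dirs = {(1, 0, 0), (0, 1, 0), (0, 0, 1)}"

definition parity :: "int \<times> int \<times> int \<Rightarrow> int" where
  "parity x = (if even (fst x + fst (snd x) + snd (snd x)) then 1 else - 1)"

lemma parity_add_dir: "d \<in> dirs \<Longrightarrow> parity (x + d) = - parity x"
  by (cases x) (auto simp: parity_def dirs_def)

context frame
begin

text \<open>Orientation of the ordered axes \<open>a\<close>, \<open>b\<close>, vertical.\<close>

definition sg :: int where "sg = (if a = 1 then 1 else - 1)"

text \<open>The displacement from a black cube points to the white one, hence the minus sign.
  Passing to the partner negates both factors, so both cubes of a domino yield its vector.\<close>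

definition bvec :: "(int \<times> int \<times> int \<Rightarrow> int \<times> int \<times> int) \<Rightarrow> int \<times> int \<times> int \<Rightarrow> real ^ 3" where
  "bvec n x = (\<chi> t. of_int (- parity x * mk (n x) $ t))"

lemma bvec_partner: "field X n \<Longrightarrow> x \<in> X \<Longrightarrow> bvec n (x + n x) = bvec n x"
proof -
  assume f: "field X n" and x: "x \<in> X"
  show "bvec n (x + n x) = bvec n x"
    unfolding bvec_def field_mem(3)[OF f x] parity_add_dir[OF field_mem(1)[OF f x]]
    by (simp add: vec_eq_iff all_ab)
qed

lemma domino_vec_dm:
  assumes f: "field X n" and x: "x \<in> X"
  shows "domino_vec (dm n x) = bvec n x"
proof -
  have d: "n x \<in> dirs" by (rule field_mem(1)[OF f x])
  have sub: "lattice_cube c \<subseteq> dm n x \<longleftrightarrow> c = mk x \<or> c = mk (x + n x)" for c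
    by (simp add: dm_def lattice_cube_subset_Un)
  have blk: "black (mk y) \<longleftrightarrow> parity y = 1" for y by (simp add: black_mk parity_def)
  have par: "parity x = 1 \<or> parity x = - 1" by (simp add: parity_def)
  have par': "parity (x + n x) = - parity x" by (rule parity_add_dir[OF d])
  have "black_cube (dm n x) = (if parity x = 1 then mk x else mk (x + n x))"
    unfolding black_cube_def sub using par par' by (intro the_equality) (auto simp: blk)
  moreover have "white_cube (dm n x) = (if parity x = 1 then mk (x + n x) else mk x)"
    unfolding white_cube_def sub using par par' by (intro the_equality) (auto simp: blk)
  ultimately show ?thesis
    using par by (auto simp: domino_vec_def bvec_def cube_center_def vec_eq_iff all_ab)
qed

lemma det_axis: "det (vector [p, q, of_int \<sigma> *\<^sub>R axis a 1] :: real ^ 3 ^ 3) = of_int (\<sigma> * sg) * (p $ b * q $ 3 - p $ 3 * q $ b)"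
  using ab by (auto simp: det_3 axis_def sg_def algebra_simps)

definition pair_term where
  "pair_term n \<sigma> x y = (if fst (snd x) = fst (snd y) \<and> snd (snd x) = snd (snd y) \<and> \<sigma> * (fst y - fst x) > 0
     then 1 / 4 * det (vector [bvec n y, bvec n x, of_int \<sigma> *\<^sub>R axis a 1] :: real ^ 3 ^ 3) else 0)"

lemma mk_add: "mk (x + (0, 1, 0)) = mk x + axis b 1" "mk (x + (0, 0, 1)) = mk x + axis 3 1"
  using distinct_ab by (auto simp: vec_eq_iff all_ab axis_def)

text \<open>If the determinant is nonzero, one domino is upright and the other points along
  \<open>b\<close>. Their projections share at most one unit square, so at most one of the four
  pairs of cubes lies on a common line along \<open>a\<close>, and one does exactly when the shade
  is met.\<close>

lemma tau_dm:
  assumes f: "field X n" and x: "x \<in> X" "n x \<in> pos_dirs" and y: "y \<in> X" "n y \<in> pos_dirs"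
    and \<sigma>: "\<sigma> = 1 \<or> \<sigma> = - 1"
  shows "tau (of_int \<sigma> *\<^sub>R axis a 1) (dm n x) (dm n y)
    = pair_term n \<sigma> x y + pair_term n \<sigma> x (y + n y) + pair_term n \<sigma> (x + n x) y + pair_term n \<sigma> (x + n x) (y + n y)"
proof -
  define \<Delta> where "\<Delta> = 1 / 4 * det (vector [bvec n y, bvec n x, of_int \<sigma> *\<^sub>R axis a 1] :: real ^ 3 ^ 3)"
  have bp: "bvec n (x + n x) = bvec n x" "bvec n (y + n y) = bvec n y" using bvec_partner[OF f] x y by auto
  have tau_eq: "tau (of_int \<sigma> *\<^sub>R axis a 1) (dm n x) (dm n y)
      = (if dm n y \<inter> shade (of_int \<sigma> *\<^sub>R axis a 1) (dm n x) \<noteq> {} then \<Delta> else 0)"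
    unfolding tau_def domino_vec_dm[OF f x(1)] domino_vec_dm[OF f y(1)] \<Delta>_def by simp
  have pt: "pair_term n \<sigma> x' y' = (if fst (snd x') = fst (snd y') \<and> snd (snd x') = snd (snd y') \<and> \<sigma> * (fst y' - fst x') > 0 then \<Delta> else 0)"
    if "bvec n x' = bvec n x" "bvec n y' = bvec n y" for x' y'
    unfolding pair_term_def that \<Delta>_def ..
  show ?thesis
  proof (cases "\<Delta> = 0")
    case True
    then show ?thesis unfolding tau_eq by (simp add: pt bp)
  next
    case False
    have "(n x = (0, 1, 0) \<and> n y = (0, 0, 1)) \<or> (n x = (0, 0, 1) \<and> n y = (0, 1, 0))"
      using x(2) y(2) False unfolding \<Delta>_def det_axis bvec_def pos_dirs_def by auto
    then show ?thesis
    proof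
      assume n: "n x = (0, 1, 0) \<and> n y = (0, 0, 1)"
      have "dm n y \<inter> shade (of_int \<sigma> *\<^sub>R axis a 1) (dm n x) \<noteq> {} \<longleftrightarrow>
        \<sigma> * (fst y - fst x) > 0 \<and> (fst (snd y) = fst (snd x) \<or> fst (snd y) = fst (snd x) + 1) \<and>
        (snd (snd x) = snd (snd y) \<or> snd (snd x) = snd (snd y) + 1)"
        using domino_meets_shade[of a b 3 \<sigma> "mk y" "mk x"] distinct_ab \<sigma> n by (simp add: dm_def mk_add)
      then show ?thesis unfolding tau_eq pt[OF refl refl] pt[OF refl bp(2)] pt[OF bp(1) refl] pt[OF bp] using n by auto
    next
      assume n: "n x = (0, 0, 1) \<and> n y = (0, 1, 0)"
      have "dm n y \<inter> shade (of_int \<sigma> *\<^sub>R axis a 1) (dm n x) \<noteq> {} \<longleftrightarrow>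
        \<sigma> * (fst y - fst x) > 0 \<and> (snd (snd y) = snd (snd x) \<or> snd (snd y) = snd (snd x) + 1) \<and>
        (fst (snd x) = fst (snd y) \<or> fst (snd x) = fst (snd y) + 1)"
        using domino_meets_shade[of a 3 b \<sigma> "mk y" "mk x"] distinct_ab \<sigma> n by (simp add: dm_def mk_add)
      then show ?thesis unfolding tau_eq pt[OF refl refl] pt[OF refl bp(2)] pt[OF bp(1) refl] pt[OF bp] using n by auto
    qed
  qed
qed

end

context frame
begin

lemma sum_field:
  fixes h :: "int \<times> int \<times> int \<Rightarrow> real"
  assumes f: "field X n" and fin: "finite X"
  shows "(\<Sum>x\<in>X. h x) = (\<Sum>x\<in>{x \<in> X. n x \<in> pos_dirs}. h x + h (x + n x))"
proof -
  let ?P = "{x \<in> X. n x \<in> pos_dirs}"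
  let ?N = "{x \<in> X. n x \<notin> pos_dirs}"
  have neg: "z \<notin> pos_dirs \<longleftrightarrow> - z \<in> pos_dirs" if "z \<in> dirs" for z
    using that unfolding dirs_def pos_dirs_def by (elim insertE emptyE) simp_all
  have "bij_betw (\<lambda>x. x + n x) ?P ?N"
  proof (rule bij_betw_byWitness[where f' = "\<lambda>x. x + n x"])
    show "\<forall>x\<in>?P. x + n x + n (x + n x) = x" "\<forall>x\<in>?N. x + n x + n (x + n x) = x"
      by (intro ballI, elim CollectE conjE, rule field_mem(5)[OF f], assumption)+
    have m1: "x + n x \<in> X" if "x \<in> X" for x by (rule field_mem(2)[OF f that])
    have m2: "n (x + n x) \<in> pos_dirs \<longleftrightarrow> n x \<notin> pos_dirs" if "x \<in> X" for x
      unfolding field_mem(3)[OF f that] using neg[OF field_mem(1)[OF f that]] by simp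
    show "(\<lambda>x. x + n x) ` ?P \<subseteq> ?N" "(\<lambda>x. x + n x) ` ?N \<subseteq> ?P"
      by (intro image_subsetI CollectI conjI; elim CollectE conjE; simp only: m1 m2 not_False_eq_True not_not)+
  qed
  then have "(\<Sum>x\<in>?N. h x) = (\<Sum>x\<in>?P. h (x + n x))" by (rule sum.reindex_bij_betw[symmetric])
  moreover have "(\<Sum>x\<in>X. h x) = (\<Sum>x\<in>?P. h x) + (\<Sum>x\<in>?N. h x)"
  proof -
    have "sum h (?P \<union> ?N) = sum h ?P + sum h ?N" by (rule sum.union_disjoint) (use fin in auto)
    moreover have "?P \<union> ?N = X" by blast
    ultimately show ?thesis by (simp only:)
  qed
  ultimately show ?thesis by (simp add: sum.distrib)
qed

lemma twist_pair_terms: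
  assumes f: "field X n" and fin: "finite X" and \<sigma>: "\<sigma> = 1 \<or> \<sigma> = - 1"
  shows "twist (of_int \<sigma> *\<^sub>R axis a 1) (dm n ` X) = (\<Sum>x\<in>X. \<Sum>y\<in>X. pair_term n \<sigma> x y)"
proof -
  let ?P = "{x \<in> X. n x \<in> pos_dirs}"
  have inj: "inj_on (dm n) ?P"
  proof (rule inj_onI)
    fix x y assume xy: "x \<in> ?P" "y \<in> ?P" "dm n x = dm n y"
    then have "{x, x + n x} = {y, y + n y}" unfolding dm_eq_iff by simp
    then consider "x = y" | "x = y + n y" by (auto simp: doubleton_eq_iff)
    then show "x = y"
    proof cases
      case 2
      then have "n x = - n y" using field_mem(3)[OF f, of y] xy by auto
      then show ?thesis using xy by (auto simp: pos_dirs_def)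
    qed
  qed
  have im: "dm n ` X = dm n ` ?P"
  proof (intro equalityI subsetI)
    fix d assume "d \<in> dm n ` X"
    then obtain x where x: "x \<in> X" "d = dm n x" by blast
    have "n x \<in> pos_dirs \<or> - n x \<in> pos_dirs" using field_mem(1)[OF f x(1)] by (auto simp: dirs_def pos_dirs_def)
    then show "d \<in> dm n ` ?P"
    proof
      assume "- n x \<in> pos_dirs"
      then have "x + n x \<in> ?P" using field_mem(2,3)[OF f x(1)] by simp
      then show ?thesis using dm_partner[OF f x(1)] x(2) by (intro image_eqI[of _ _ "x + n x"]) simp_all
    qed (use x in blast)
  qed auto
  have "twist (of_int \<sigma> *\<^sub>R axis a 1) (dm n ` X) = (\<Sum>x\<in>?P. \<Sum>y\<in>?P. tau (of_int \<sigma> *\<^sub>R axis a 1) (dm n x) (dm n y))"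
    unfolding twist_def im by (simp add: sum.reindex[OF inj])
  also have "\<dots> = (\<Sum>x\<in>?P. \<Sum>y\<in>?P. pair_term n \<sigma> x y + pair_term n \<sigma> x (y + n y)
      + pair_term n \<sigma> (x + n x) y + pair_term n \<sigma> (x + n x) (y + n y))"
    using tau_dm[OF f _ _ _ _ \<sigma>] by (intro sum.cong refl) auto
  also have "\<dots> = (\<Sum>x\<in>?P. (\<Sum>y\<in>X. pair_term n \<sigma> x y) + (\<Sum>y\<in>X. pair_term n \<sigma> (x + n x) y))"
    unfolding sum_field[OF f fin, of "pair_term n \<sigma> _"] by (simp add: sum.distrib add.assoc)
  also have "\<dots> = (\<Sum>x\<in>X. \<Sum>y\<in>X. pair_term n \<sigma> x y)"
    by (rule sum_field[OF f fin, symmetric])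
  finally show ?thesis .
qed

text \<open>The determinant has two terms. Exchanging the names \<open>x\<close> and
  \<open>y\<close> in the second merges the one-sided conditions into a sign of
  \<open>fst y - fst x\<close>; thereby \<open>\<sigma>\<close> disappears, so opposite shades give
  the same sum.\<close>

lemma pair_terms_sum:
  assumes "finite X" and \<sigma>: "\<sigma> = 1 \<or> \<sigma> = - 1"
  shows "(\<Sum>x\<in>X. \<Sum>y\<in>X. pair_term n \<sigma> x y) = of_int (sg * (\<Sum>x\<in>X. \<Sum>y\<in>X.
    if fst (snd x) = fst (snd y) \<and> snd (snd x) = snd (snd y)
    then sgn (fst y - fst x) * (parity x * parity y) * (fst (snd (n y)) * snd (snd (n x))) else 0)) / 4"
proof -
  define g where "g x y = (if fst (snd x) = fst (snd y) \<and> snd (snd x) = snd (snd y)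
     then (parity x * parity y) * (fst (snd (n y)) * snd (snd (n x))) else 0)" for x y
  define p where "p x y = (if \<sigma> * (fst y - fst x) > 0 then 1 else 0 :: int)" for x y :: "int \<times> int \<times> int"
  have "pair_term n \<sigma> x y = of_int (\<sigma> * sg * (p x y * g x y - p x y * g y x)) / 4" for x y
  proof (cases "fst (snd x) = fst (snd y) \<and> snd (snd x) = snd (snd y) \<and> \<sigma> * (fst y - fst x) > 0")
    case True
    have "pair_term n \<sigma> x y = 1 / 4 * (of_int (\<sigma> * sg) * (bvec n y $ b * bvec n x $ 3 - bvec n y $ 3 * bvec n x $ b))"
      using True unfolding pair_term_def det_axis by simp
    moreover have "bvec n z $ b = of_int (- parity z * fst (snd (n z)))" "bvec n z $ 3 = of_int (- parity z * snd (snd (n z)))" for z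
      using distinct_ab by (auto simp: bvec_def)
    moreover have "p x y = 1" "g x y = parity x * parity y * (fst (snd (n y)) * snd (snd (n x)))"
        "g y x = parity x * parity y * (fst (snd (n x)) * snd (snd (n y)))"
      using True by (simp_all add: p_def g_def mult.commute)
    ultimately show ?thesis by (simp add: algebra_simps)
  next
    case False
    then have "p x y * g x y = 0" "p x y * g y x = 0" by (auto simp: p_def g_def)
    then show ?thesis unfolding pair_term_def if_not_P[OF False] by (simp only: diff_self mult_zero_right of_int_0 div_0)
  qed
  then have "(\<Sum>x\<in>X. \<Sum>y\<in>X. pair_term n \<sigma> x y) = of_int (\<Sum>x\<in>X. \<Sum>y\<in>X. \<sigma> * sg * (p x y * g x y - p x y * g y x)) / 4"
    by (simp only: of_int_sum sum_divide_distrib)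
  also have "(\<Sum>x\<in>X. \<Sum>y\<in>X. \<sigma> * sg * (p x y * g x y - p x y * g y x))
      = \<sigma> * sg * ((\<Sum>x\<in>X. \<Sum>y\<in>X. p x y * g x y) - (\<Sum>x\<in>X. \<Sum>y\<in>X. p x y * g y x))"
    by (simp add: sum_distrib_left[symmetric] sum_subtractf)
  also have "(\<Sum>x\<in>X. \<Sum>y\<in>X. p x y * g y x) = (\<Sum>x\<in>X. \<Sum>y\<in>X. p y x * g x y)" by (rule sum.swap)
  also have "\<sigma> * sg * ((\<Sum>x\<in>X. \<Sum>y\<in>X. p x y * g x y) - (\<Sum>x\<in>X. \<Sum>y\<in>X. p y x * g x y))
      = sg * (\<Sum>x\<in>X. \<Sum>y\<in>X. \<sigma> * (p x y - p y x) * g x y)"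
  proof -
    have "(\<Sum>x\<in>X. \<Sum>y\<in>X. \<sigma> * (p x y - p y x) * g x y)
        = \<sigma> * (\<Sum>x\<in>X. \<Sum>y\<in>X. p x y * g x y - p y x * g x y)"
      by (simp only: sum_distrib_left mult.assoc left_diff_distrib)
    then show ?thesis by (simp add: sum_subtractf)
  qed
  also have "(\<Sum>x\<in>X. \<Sum>y\<in>X. \<sigma> * (p x y - p y x) * g x y) = (\<Sum>x\<in>X. \<Sum>y\<in>X.
    if fst (snd x) = fst (snd y) \<and> snd (snd x) = snd (snd y)
    then sgn (fst y - fst x) * (parity x * parity y) * (fst (snd (n y)) * snd (snd (n x))) else 0)"
  proof (intro sum.cong refl)
    fix x y :: "int \<times> int \<times> int"
    have "\<sigma> * (p x y - p y x) = sgn (fst y - fst x)" using \<sigma> by (auto simp: p_def sgn_if)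
    then show "\<sigma> * (p x y - p y x) * g x y = (if fst (snd x) = fst (snd y) \<and> snd (snd x) = snd (snd y)
      then sgn (fst y - fst x) * (parity x * parity y) * (fst (snd (n y)) * snd (snd (n x))) else 0)"
      by (simp add: g_def mult.assoc)
  qed
  finally show ?thesis .
qed

lemma sum_column:
  assumes "finite C"
  shows "(\<Sum>x\<in>column C N. h x) = (\<Sum>k<N. \<Sum>c\<in>C. h (fst c, snd c, int k))"
proof -
  have "bij_betw (\<lambda>(k, c). (fst c, snd c, int k)) ({..<N} \<times> C) (column C N)"
    by (rule bij_betw_byWitness[where f' = "\<lambda>x. (nat (snd (snd x)), (fst x, fst (snd x)))"])
      (auto simp: column_def)
  then have "(\<Sum>x\<in>column C N. h x) = (\<Sum>(k, c)\<in>{..<N} \<times> C. h (fst c, snd c, int k))"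
    by (subst sum.reindex_bij_betw[symmetric]) (auto simp: case_prod_unfold)
  then show ?thesis by (simp add: sum.cartesian_product)
qed

text \<open>Only cubes on a line along \<open>a\<close> interact, and these have equal heights; the
  double sum over the column therefore splits into its floors.\<close>

lemma twist_slices:
  assumes f: "field (column C N) n" and fin: "finite C" and \<sigma>: "\<sigma> = 1 \<or> \<sigma> = - 1"
  shows "twist (of_int \<sigma> *\<^sub>R axis a 1) (dm n ` column C N) = of_int (sg * (\<Sum>k<N. tw4 C (slice n k))) / 4"
proof -
  have finX: "finite (column C N)"
  proof -
    have "column C N \<subseteq> (\<lambda>(k, c). (fst c, snd c, int k)) ` ({..<N} \<times> C)"
    proof
      fix x assume "x \<in> column C N"
      then show "x \<in> (\<lambda>(k, c). (fst c, snd c, int k)) ` ({..<N} \<times> C)"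
        by (intro image_eqI[of _ _ "(nat (snd (snd x)), (fst x, fst (snd x)))"]) (auto simp: column_def)
    qed
    then show ?thesis by (rule finite_subset) (use fin in auto)
  qed
  define t where "t x y = (if fst (snd x) = fst (snd y) \<and> snd (snd x) = snd (snd y)
    then sgn (fst y - fst x) * (parity x * parity y) * (fst (snd (n y)) * snd (snd (n x))) else 0)" for x y
  have "(\<Sum>x\<in>column C N. \<Sum>y\<in>column C N. t x y)
      = (\<Sum>k<N. \<Sum>z\<in>C. \<Sum>m<N. \<Sum>c\<in>C. t (fst z, snd z, int k) (fst c, snd c, int m))"
    by (simp add: sum_column[OF fin])
  also have "\<dots> = (\<Sum>k<N. \<Sum>z\<in>C. \<Sum>c\<in>C. t (fst z, snd z, int k) (fst c, snd c, int k))"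
  proof (intro sum.cong refl)
    fix k z assume k: "k \<in> {..<N}"
    have "(\<Sum>m<N. \<Sum>c\<in>C. t (fst z, snd z, int k) (fst c, snd c, int m))
        = (\<Sum>m<N. if m = k then \<Sum>c\<in>C. t (fst z, snd z, int k) (fst c, snd c, int k) else 0)"
      by (intro sum.cong refl) (auto simp: t_def)
    then show "(\<Sum>m<N. \<Sum>c\<in>C. t (fst z, snd z, int k) (fst c, snd c, int m))
        = (\<Sum>c\<in>C. t (fst z, snd z, int k) (fst c, snd c, int k))" using k by simp
  qed
  also have "\<dots> = (\<Sum>k<N. tw4 C (slice n k))"
  proof (intro sum.cong refl)
    fix k
    have "t (fst z, snd z, int k) (fst c, snd c, int k)
        = side c z * eps c * eps z * dy (slice n k) c * dz (slice n k) z" for c z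
    proof (cases "snd z = snd c")
      case True
      have "parity (fst z, snd z, int k) * parity (fst c, snd c, int k) = eps c * eps z"
        by (auto simp: parity_def eps_def)
      then show ?thesis using True by (simp add: t_def side_def dy_def dz_def slice_def)
    qed (simp add: t_def side_def)
    then have "(\<Sum>z\<in>C. \<Sum>c\<in>C. t (fst z, snd z, int k) (fst c, snd c, int k))
        = (\<Sum>z\<in>C. \<Sum>c\<in>C. side c z * eps c * eps z * dy (slice n k) c * dz (slice n k) z)" by simp
    also have "\<dots> = tw4 C (slice n k)" unfolding tw4_def by (rule sum.swap)
    finally show "(\<Sum>z\<in>C. \<Sum>c\<in>C. t (fst z, snd z, int k) (fst c, snd c, int k)) = tw4 C (slice n k)" .
  qed
  finally show ?thesis
    unfolding twist_pair_terms[OF f finX \<sigma>] pair_terms_sum[OF finX \<sigma>] t_def by simp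
qed

end

section \<open>The local limit theorem for random tilings\<close>

lemma bij_betw_card_Collect:
  assumes f: "bij_betw f A B" and PQ: "\<And>x. x \<in> A \<Longrightarrow> Q (f x) \<longleftrightarrow> P x"
  shows "card {y \<in> B. Q y} = card {x \<in> A. P x}"
proof -
  have "{y \<in> B. Q y} = f ` {x \<in> A. P x}"
    using PQ bij_betw_imp_surj_on[OF f] by blast
  moreover have "inj_on f {x \<in> A. P x}"
    using bij_betw_imp_inj_on[OF f] by (rule inj_on_subset) auto
  ultimately show ?thesis by (simp add: card_image)
qed

text \<open>Tilings, fields and walks are in bijection, and the twist corresponds to the weight up
  to the sign \<open>sg\<close>. That sign is absorbed by applying the limit theorem to
  \<open>sg * t N\<close>, which leaves \<open>\<tau>\<^sup>2\<close> unchanged.\<close>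

lemma local_limit_axis:
  fixes D :: "(real ^ 2) set" and a b :: 3 and \<sigma> :: int
  assumes D: "quadriculated_disk D" "balanced D" "nontrivial D"
    and ab: "(a = 1 \<and> b = 2) \<or> (a = 2 \<and> b = 1)" and \<sigma>: "\<sigma> = 1 \<or> \<sigma> = - 1"
  shows "\<exists>C0 C1 :: real. C0 > 0 \<and> C1 > 0 \<and>
    (\<forall>(t :: nat \<Rightarrow> int) (\<tau> :: real).
      (\<lambda>N. real_of_int (t N) / sqrt (real N)) \<longlonglongrightarrow> \<tau> \<longrightarrow>
      (\<lambda>N. sqrt (real N) *
          measure_pmf.prob (random_tiling D N) {T. twist (of_int \<sigma> *\<^sub>R axis a 1) T = real_of_int (t N)})
        \<longlonglongrightarrow> C0 * exp (- C1 * \<tau>\<^sup>2))"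
proof -
  interpret frame a b by unfold_locales (rule ab)
  define C where "C = plane a ` squares D"
  interpret connected_board C unfolding C_def by (rule connected_board_disk[OF D])
  have sg: "sg = 1 \<or> sg = - 1" by (simp add: sg_def)
  obtain n1 where n1: "\<And>N. N \<ge> n1 \<Longrightarrow> W.walks N {} {} \<noteq> {}" using local_limit_twist(2) by blast
  have finX: "finite (column C N)" for N
  proof -
    have "column C N \<subseteq> (\<lambda>(c, k). (fst c, snd c, k)) ` (C \<times> {0..<int N})"
      by (force simp: column_def)
    then show ?thesis by (rule finite_subset) (use fin in auto)
  qed
  have prob: "measure_pmf.prob (random_tiling D N) {T. twist (of_int \<sigma> *\<^sub>R axis a 1) T = real_of_int m}
      = card {l \<in> W.walks N {} {}. W.weight l = of_int (sg * m)} / card (W.walks N {} {})"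
    if N: "N \<ge> 1" "N \<ge> n1" for N m
  proof -
    define Ti where "Ti = tilings (cylinder D N)"
    define Fi where "Fi = {n. field (column C N) n}"
    have b1: "bij_betw (\<lambda>n. dm n ` column C N) Fi Ti"
      using bij_tilings[OF finX, of N] cylinder_eq[OF D(1) N(1)] by (simp add: Ti_def Fi_def C_def)
    have b2: "bij_betw (\<lambda>n. map (slice n) [0..<N]) Fi (W.walks N {} {})"
      unfolding Fi_def by (rule bij_walks)
    have tw: "twist (of_int \<sigma> *\<^sub>R axis a 1) (dm n ` column C N) = sg * W.weight (map (slice n) [0..<N])"
      if "n \<in> Fi" for n
    proof -
      have "W.weight (map (slice n) [0..<N]) = (\<Sum>k<N. om (slice n k))"
        by (simp add: W.weight_def comp_def interv_sum_list_conv_sum_set_nat atLeast0LessThan)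
      also have "\<dots> = of_int (\<Sum>k<N. tw4 C (slice n k)) / 4" by (simp add: om_def sum_divide_distrib)
      finally have w: "W.weight (map (slice n) [0..<N]) = of_int (\<Sum>k<N. tw4 C (slice n k)) / 4" .
      have "field (column C N) n" using that by (simp add: Fi_def)
      from twist_slices[OF this fin \<sigma>] show ?thesis unfolding w by simp
    qed
    have cardT: "card Ti = card (W.walks N {} {})"
      using bij_betw_same_card[OF b1] bij_betw_same_card[OF b2] by simp
    have "finite Ti" "Ti \<noteq> {}"
    proof -
      have "finite Fi" using bij_betw_finite[OF b2] W.finite_walks by blast
      then show "finite Ti" using bij_betw_finite[OF b1] by blast
      have "Fi \<noteq> {}" using b2 n1[OF N(2)] by (auto simp: bij_betw_def)
      then show "Ti \<noteq> {}" using b1 by (auto simp: bij_betw_def)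
    qed
    have eq: "twist (of_int \<sigma> *\<^sub>R axis a 1) (dm n ` column C N) = real_of_int m
        \<longleftrightarrow> W.weight (map (slice n) [0..<N]) = of_int (sg * m)" if "n \<in> Fi" for n
      unfolding tw[OF that] using sg by auto
    have c1: "card (Ti \<inter> {T. twist (of_int \<sigma> *\<^sub>R axis a 1) T = real_of_int m})
        = card {n \<in> Fi. W.weight (map (slice n) [0..<N]) = of_int (sg * m)}"
      unfolding Int_def mem_Collect_eq by (rule bij_betw_card_Collect[OF b1], rule eq)
    have c2: "card {l \<in> W.walks N {} {}. W.weight l = of_int (sg * m)}
        = card {n \<in> Fi. W.weight (map (slice n) [0..<N]) = of_int (sg * m)}"
      by (rule bij_betw_card_Collect[OF b2], rule refl)
    show ?thesis
      unfolding random_tiling_def Ti_def[symmetric] measure_pmf_of_set[OF \<open>Ti \<noteq> {}\<close> \<open>finite Ti\<close>] c1 c2 cardT ..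
  qed
  obtain C0 C1 :: real where C: "C0 > 0" "C1 > 0" and lim: "\<And>(t :: nat \<Rightarrow> int) (\<tau> :: real).
      (\<lambda>N. real_of_int (t N) / sqrt (real N)) \<longlonglongrightarrow> \<tau> \<Longrightarrow>
      (\<lambda>N. sqrt (real N) * (card {l \<in> W.walks N {} {}. W.weight l = of_int (t N)} / card (W.walks N {} {})))
        \<longlonglongrightarrow> C0 * exp (- C1 * \<tau>\<^sup>2)"
    using local_limit_twist(1) by blast
  have "(\<lambda>N. sqrt (real N) *
          measure_pmf.prob (random_tiling D N) {T. twist (of_int \<sigma> *\<^sub>R axis a 1) T = real_of_int (t N)})
        \<longlonglongrightarrow> C0 * exp (- C1 * \<tau>\<^sup>2)"
    if t: "(\<lambda>N. real_of_int (t N) / sqrt (real N)) \<longlonglongrightarrow> \<tau>" for t \<tau>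
  proof -
    have "(\<lambda>N. of_int sg * (real_of_int (t N) / sqrt (real N))) \<longlonglongrightarrow> of_int sg * \<tau>"
      by (intro tendsto_mult tendsto_const t)
    then have "(\<lambda>N. real_of_int (sg * t N) / sqrt (real N)) \<longlonglongrightarrow> of_int sg * \<tau>" by simp
    from lim[OF this]
    have "(\<lambda>N. sqrt (real N) * (card {l \<in> W.walks N {} {}. W.weight l = of_int (sg * t N)} / card (W.walks N {} {})))
        \<longlonglongrightarrow> C0 * exp (- C1 * (of_int sg * \<tau>)\<^sup>2)" .
    moreover have "(of_int sg * \<tau>)\<^sup>2 = \<tau>\<^sup>2" using sg by auto
    ultimately have l: "(\<lambda>N. sqrt (real N) * (card {l \<in> W.walks N {} {}. W.weight l = of_int (sg * t N)} / card (W.walks N {} {})))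
        \<longlonglongrightarrow> C0 * exp (- C1 * \<tau>\<^sup>2)" by simp
    show ?thesis
    proof (rule Lim_transform_eventually[OF l])
      show "\<forall>\<^sub>F N in sequentially. sqrt (real N) * (card {l \<in> W.walks N {} {}. W.weight l = of_int (sg * t N)} / card (W.walks N {} {}))
        = sqrt (real N) * measure_pmf.prob (random_tiling D N) {T. twist (of_int \<sigma> *\<^sub>R axis a 1) T = real_of_int (t N)}"
        using eventually_ge_at_top[of "max 1 n1"] by eventually_elim (simp only: prob max.bounded_iff)
    qed
  qed
  then show ?thesis using C by blast
qed

theorem theorem3:
  fixes D :: "(real ^ 2) set" and u :: "real ^ 3"
  assumes "quadriculated_disk D" and "balanced D" and "nontrivial D"
    and "u \<in> {axis 1 1, - axis 1 1, axis 2 1, - axis 2 1}"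
  shows "\<exists>C0 C1 :: real. C0 > 0 \<and> C1 > 0 \<and>
    (\<forall>(t :: nat \<Rightarrow> int) (\<tau> :: real).
      (\<lambda>N. real_of_int (t N) / sqrt (real N)) \<longlonglongrightarrow> \<tau> \<longrightarrow>
      (\<lambda>N. sqrt (real N) *
          measure_pmf.prob (random_tiling D N) {T. twist u T = real_of_int (t N)})
        \<longlonglongrightarrow> C0 * exp (- C1 * \<tau>\<^sup>2))"
proof -
  obtain a b :: 3 and \<sigma> :: int where u: "u = of_int \<sigma> *\<^sub>R axis a 1"
    and ab: "(a = 1 \<and> b = 2) \<or> (a = 2 \<and> b = 1)" and \<sigma>: "\<sigma> = 1 \<or> \<sigma> = - 1"
  proof -
    have "u = of_int 1 *\<^sub>R axis 1 1 \<or> u = of_int (- 1) *\<^sub>R axis 1 1 \<or> u = of_int 1 *\<^sub>R axis 2 1 \<or> u = of_int (- 1) *\<^sub>R axis 2 1"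
      using assms(4) by auto
    then show thesis by (elim disjE) (rule that, assumption, simp, simp)+
  qed
  show ?thesis unfolding u by (rule local_limit_axis[OF assms(1-3) ab \<sigma>])
qed

end
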